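(* Let $A\subset\mathbb{R}^m$ be a finite set with $\dim\mathrm{conv}(A)=m$ and let $\alpha=(\alpha_a)_{a\in A}$ with $\alpha_a>0$. For every admissible random field $\mathcal{X}\in C^\infty(\mathbb{R}^m,\mathbb{R}^{m-1})$ independent of $\mathcal{E}_\alpha$ and of $(\mathcal{E}_\alpha)^{\odot d}$, every positive integer $d$ and every open set $U\subset\mathbb{R}^m$, $$\mathbb{E}\#\mathcal{S}\{(\mathcal{E}_\alpha)^{\odot d},\mathcal{X};U\}=\sqrt d\;\mathbb{E}\#\mathcal{S}\{\mathcal{E}_\alpha,\mathcal{X};U\}.$$
   Context: $\mathcal{E}_\alpha(x)=\sum_{a\in A}\alpha_a\xi_ae^{\langle a,x\rangle}$ with $\xi_a$ i.i.d. standard real Gaussians. Given finite $A,B\subset\mathbb{R}^m$ and positive coefficients $\alpha\in\mathbb{R}_{>0}^A$, $\beta\in\mathbb{R}_{>0}^B$, the Aronszajn multiplication is $\mathcal{E}_\alpha\odot\mathcal{E}_\beta:=\mathcal{E}_{\alpha\odot\beta}$, the Gaussian exponential sum with support $A+B$ and coefficients $(\alpha\odot\beta)_c=\sqrt{\sum_{a+b=c}\alpha_a^2\beta_b^2}$ (an operation on laws). $(\mathcal{E}_\alpha)^{\odot d}$ is the $d$-th power for this operation. $\mathcal{S}\{f_1,\dots,f_k;U\}$ is the set of common zeros in $U$ and $\#$ is cardinality. A random field $\mathcal{X}\in C^\infty(M,\mathbb{R}^k)$ is admissible if there is a finite dimensional subspace $\mathscr{F}\subset C^\infty(M,\mathbb{R}^k)$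 with a scalar product such that $\mathcal{X}\in\mathscr{F}$ almost surely, (i) for all $x\in M$ the evaluation map $\mathscr{F}\to\mathbb{R}^k$, $f\mapsto f(x)$, is surjective, and (ii) $\mathcal{X}$ has a continuous density $\rho:\mathscr{F}\to[0,\infty)$ with $\rho(0)>0$ and $\rho(f)=O(\|f\|^{-\beta})$ as $\|f\|\to\infty$ for some $\beta>\dim\mathscr{F}$. If $m=1$, $\mathcal{X}$ is absent. *)

theory Defs
  imports "HOL-Probability.Probability" "HOL-Library.Function_Algebras"
begin

text \<open>
  Pointwise real vector space structure on functions, so that the library notions \<^const>\<open>subspace\<close>,
  \<^const>\<open>span\<close> and \<^const>\<open>dim\<close> apply to spaces of functions.
\<close>

instantiation "fun" :: (type, real_vector) real_vector
begin

definition scaleR_fun :: "real \<Rightarrow> ('a \<Rightarrow> 'b) \<Rightarrow> 'a \<Rightarrow> 'b"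
  where "scaleR_fun c f = (\<lambda>x. c *\<^sub>R f x)"

instance
  by standard (auto simp: scaleR_fun_def plus_fun_def fun_eq_iff algebra_simps)

end

subsection \<open>Gaussian exponential sums and Aronszajn multiplication\<close>

text \<open>
  The law of a Gaussian exponential sum is given by its support and its coefficients; values of the
  coefficient function outside the support are irrelevant.
\<close>

type_synonym 'a exp_data = "'a set \<times> ('a \<Rightarrow> real)"

definition aronszajn_mult :: "'a::real_vector exp_data \<Rightarrow> 'a exp_data \<Rightarrow> 'a exp_data"
  where "aronszajn_mult p q =
    ({a + b |a b. a \<in> fst p \<and> b \<in> fst q},
     \<lambda>c. sqrt (\<Sum>(a, b)\<in>{(a, b). a \<in> fst p \<and> b \<in> fst q \<and> a + b = c}. (snd p a)\<^sup>2 * (snd q b)\<^sup>2))"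

text \<open>For \<open>d \<ge> 1\<close> the product of \<open>d\<close> copies of \<open>p\<close>; the value at \<open>d = 0\<close> is not used.\<close>

definition aronszajn_power :: "'a::real_vector exp_data \<Rightarrow> nat \<Rightarrow> 'a exp_data"
  where "aronszajn_power p d = ((\<lambda>q. aronszajn_mult q p) ^^ (d - 1)) p"

definition exp_sum :: "'a::euclidean_space exp_data \<Rightarrow> ('a \<Rightarrow> real) \<Rightarrow> 'a \<Rightarrow> real"
  where "exp_sum p z x = (\<Sum>a\<in>fst p. snd p a * z a * exp (a \<bullet> x))"

definition gaussian_exp_sum ::
    "'w measure \<Rightarrow> 'a::euclidean_space exp_data \<Rightarrow> ('w \<Rightarrow> 'a \<Rightarrow> real) \<Rightarrow> bool"
  where "gaussian_exp_sum M p E \<longleftrightarrow>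
    (\<exists>\<xi>. prob_space.indep_vars M (\<lambda>_. borel) \<xi> (fst p) \<and>
         (\<forall>a\<in>fst p. distributed M lborel (\<xi> a) std_normal_density) \<and>
         (\<forall>\<omega>\<in>space M. E \<omega> = exp_sum p (\<lambda>a. \<xi> a \<omega>)))"

subsection \<open>Smooth fields\<close>

primrec C_k :: "nat \<Rightarrow> ('a::euclidean_space \<Rightarrow> real) \<Rightarrow> bool"
  where
    "C_k 0 f \<longleftrightarrow> continuous_on UNIV f"
  | "C_k (Suc n) f \<longleftrightarrow> f differentiable_on UNIV \<and>
       (\<forall>b\<in>Basis. C_k n (\<lambda>x. frechet_derivative f (at x) b))"

text \<open>
  A vector in \<open>\<real>\<^sup>k\<close> is a function on \<^typ>\<open>nat\<close> vanishing at all indices \<open>i \<ge> k\<close>. In contrast to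
  \<open>real ^ 'k\<close>, this covers \<open>k = 0\<close>, where the only field is \<open>0\<close>.
\<close>

type_synonym 'a field = "'a \<Rightarrow> nat \<Rightarrow> real"

definition Rk :: "nat \<Rightarrow> (nat \<Rightarrow> real) set"
  where "Rk k = {y. \<forall>i\<ge>k. y i = 0}"

definition C_infinity :: "nat \<Rightarrow> 'a::euclidean_space field set"
  where "C_infinity k = {f. (\<forall>x. f x \<in> Rk k) \<and> (\<forall>i<k. \<forall>n. C_k n (\<lambda>x. f x i))}"

text \<open>
  Random functions are measurable for the sigma-algebra generated by the point evaluations. On
  smooth functions it is the Borel sigma-algebra of the smooth topology, and on a finite
  dimensional space of functions it is the usual Borel sigma-algebra.
\<close>

abbreviation fun_sigma :: "('a \<Rightarrow> real) measure"
  where "fun_sigma \<equiv> PiM UNIV (\<lambda>_. borel)"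

abbreviation field_sigma :: "'a field measure"
  where "field_sigma \<equiv> PiM UNIV (\<lambda>_. PiM UNIV (\<lambda>_. borel))"

definition random_field :: "'w measure \<Rightarrow> nat \<Rightarrow> ('w \<Rightarrow> 'a::euclidean_space field) \<Rightarrow> bool"
  where "random_field M k X \<longleftrightarrow> X \<in> measurable M field_sigma \<and> (\<forall>\<omega>\<in>space M. X \<omega> \<in> C_infinity k)"

text \<open>
  Independence of two random elements, as in \<^const>\<open>prob_space.indep_var\<close>, which however requires
  both of them to take values in the same type.
\<close>

definition independent_elems ::
    "'w measure \<Rightarrow> 'b measure \<Rightarrow> ('w \<Rightarrow> 'b) \<Rightarrow> 'c measure \<Rightarrow> ('w \<Rightarrow> 'c) \<Rightarrow> bool"
  where "independent_elems M S X T Y \<longleftrightarrow>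
    X \<in> measurable M S \<and> Y \<in> measurable M T \<and>
    prob_space.indep_set M {X -` B \<inter> space M |B. B \<in> sets S} {Y -` C \<inter> space M |C. C \<in> sets T}"

subsection \<open>Admissible random fields\<close>

definition scalar_product_on :: "'v::real_vector set \<Rightarrow> ('v \<Rightarrow> 'v \<Rightarrow> real) \<Rightarrow> bool"
  where "scalar_product_on F ip \<longleftrightarrow>
    (\<forall>f\<in>F. \<forall>g\<in>F. ip f g = ip g f) \<and>
    (\<forall>f\<in>F. \<forall>g\<in>F. \<forall>h\<in>F. ip (f + g) h = ip f h + ip g h) \<and>
    (\<forall>c. \<forall>f\<in>F. \<forall>g\<in>F. ip (c *\<^sub>R f) g = c * ip f g) \<and>
    (\<forall>f\<in>F. f \<noteq> 0 \<longrightarrow> 0 < ip f f)"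

definition ip_norm :: "('v \<Rightarrow> 'v \<Rightarrow> real) \<Rightarrow> 'v \<Rightarrow> real"
  where "ip_norm ip f = sqrt (ip f f)"

definition orthonormal_basis_of ::
    "'v::real_vector set \<Rightarrow> ('v \<Rightarrow> 'v \<Rightarrow> real) \<Rightarrow> (nat \<Rightarrow> 'v) \<Rightarrow> bool"
  where "orthonormal_basis_of F ip e \<longleftrightarrow>
    F = span (e ` {..<dim F}) \<and>
    (\<forall>i<dim F. \<forall>j<dim F. ip (e i) (e j) = (if i = j then 1 else 0))"

text \<open>
  \<open>X\<close> has density \<open>\<rho>\<close> with respect to the Lebesgue measure of the Euclidean space \<open>(F, ip)\<close>. That
  measure is the image of the Lebesgue measure of \<open>\<real>\<^sup>n\<close>, \<open>n = dim F\<close>, under the coordinate map of an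
  orthonormal basis, and does not depend on the choice of the basis.
\<close>

definition has_density_on ::
    "'w measure \<Rightarrow> 'a field set \<Rightarrow> ('a field \<Rightarrow> 'a field \<Rightarrow> real) \<Rightarrow>
      ('a field \<Rightarrow> real) \<Rightarrow> ('w \<Rightarrow> 'a field) \<Rightarrow> bool"
  where "has_density_on M F ip \<rho> X \<longleftrightarrow>
    (\<exists>e. orthonormal_basis_of F ip e \<and>
      (let T = (\<lambda>c. \<Sum>i<dim F. c i *\<^sub>R e i) in
        distr M field_sigma X =
        distr (density (PiM {..<dim F} (\<lambda>_. lborel)) (\<lambda>c. ennreal (\<rho> (T c)))) field_sigma T))"

definition admissible :: "'w measure \<Rightarrow> nat \<Rightarrow> ('w \<Rightarrow> 'a::euclidean_space field) \<Rightarrow> bool"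
  where "admissible M k X \<longleftrightarrow>
    random_field M k X \<and>
    (\<exists>F ip.
      subspace F \<and> (\<exists>B. finite B \<and> F = span B) \<and> F \<subseteq> C_infinity k \<and>
      scalar_product_on F ip \<and>
      (AE \<omega> in M. X \<omega> \<in> F) \<and>
      (\<forall>x. (\<lambda>f. f x) ` F = Rk k) \<and>
      (\<exists>\<rho>.
        (\<forall>f\<in>F. 0 \<le> \<rho> f) \<and>
        (\<forall>f\<in>F. \<forall>\<epsilon>>0. \<exists>\<delta>>0. \<forall>g\<in>F. ip_norm ip (g - f) < \<delta> \<longrightarrow> \<bar>\<rho> g - \<rho> f\<bar> < \<epsilon>) \<and>
        has_density_on M F ip \<rho> X \<and>
        0 < \<rho> 0 \<and>
        (\<exists>\<beta>>real (dim F). \<exists>C R. \<forall>f\<in>F. R \<le> ip_norm ip f \<longrightarrow> \<rho> f \<le> C * ip_norm ip f powr (- \<beta>))))"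

subsection \<open>Zero sets\<close>

definition common_zeros :: "nat \<Rightarrow> ('a \<Rightarrow> real) \<Rightarrow> 'a field \<Rightarrow> 'a set \<Rightarrow> 'a set"
  where "common_zeros k f g U = {x \<in> U. f x = 0 \<and> (\<forall>i<k. g x i = 0)}"

text \<open>The cardinality is counted in \<open>[0, \<infinity>]\<close>: the counting measure of an infinite set is \<open>\<infinity>\<close>.\<close>

definition expected_zeros ::
    "'w measure \<Rightarrow> nat \<Rightarrow> ('w \<Rightarrow> 'a \<Rightarrow> real) \<Rightarrow> ('w \<Rightarrow> 'a field) \<Rightarrow> 'a set \<Rightarrow> ennreal"
  where "expected_zeros M k E X U =
    (\<integral>\<^sup>+\<omega>. emeasure (count_space UNIV) (common_zeros k (E \<omega>) (X \<omega>) U) \<partial>M)"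

end

theory Submission
  imports Defs
begin

text \<open>
  Freeze the field \<open>X\<close>, apart from \<open>m - 1\<close> coordinates on which the evaluation at nearby points is
  invertible, and freeze all but one Gaussian coefficient of the exponential sum. The remaining \<open>m\<close>
  coordinates are determined by the zero, so that the zeros become the fibres of a \<open>C\<^sup>1\<close> map
  between spaces of dimension \<open>m\<close> and the area formula applies. Integrating out the
  Gaussian coefficients at a fixed point \<open>x\<close> leaves \<open>\<surd>Var\<^sub>x(\<lambda>)\<close> up to a universal
  constant, where \<open>\<lambda>\<close> is a linear form that depends on \<open>X\<close> only and \<open>Var\<^sub>x\<close> is the variance under the
  weights \<open>\<alpha>\<^sub>a\<^sup>2 exp (2\<langle>a, x\<rangle>)\<close>. Aronszajn multiplication convolves these weights, so the variance is
  additive and the \<open>d\<close>-th power multiplies its square root by \<open>\<surd>d\<close>.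
\<close>

section \<open>Change of variables with multiplicity\<close>

text \<open>Why the variance appears: with weights w_a = \<alpha>_a^2 exp (2 <a,x>), the value of
  the sum at x is Gaussian of variance S0 = sum of w_a, so its density at 0 is 1 / sqrt (2 pi S0).
  For a linear form \<lambda>, \<lambda>(gradient) has variance S2 = sum of w_a \<lambda>(a)^2 and
  covariance S1 = sum of w_a \<lambda>(a) with the value. Given that the value vanishes, its
  variance is S2 - S1^2/S0, so density times conditional mean modulus is a constant times sqrt
  (S2/S0 - (S1/S0)^2), the standard deviation of \<lambda> under the normalised weights. The form
  \<lambda> is the Jacobian determinant as a function of the row reserved for the sum. Two obstacles
  shape the rest. Which coordinates of the field can be eliminated depends on the point, so the
  domain is cut into countably many pieces; F-sigma pieces are used because their continuous images
  are Borel. And no bound on the number of zeros is at hand, so every identity is proved in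
  [0,\<infinity>] with Tonelli, where measurability takes the place of integrability.\<close>

lemma emeasure_injective_image:
  fixes g :: "real^'n::{finite,wellorder} \<Rightarrow> real^'n::_"
  assumes S: "S \<in> sets borel" and gS: "g ` S \<in> sets borel"
    and der: "\<And>x. x \<in> S \<Longrightarrow> (g has_derivative g' x) (at x within S)"
    and inj: "inj_on g S"
    and meas: "(\<lambda>x. indicator S x * \<bar>det (matrix (g' x))\<bar>) \<in> borel_measurable borel"
  shows "emeasure lborel (g ` S) = (\<integral>\<^sup>+x. ennreal (indicator S x * \<bar>det (matrix (g' x))\<bar>) \<partial>lborel)"
proof -
  let ?D = "\<lambda>x. \<bar>det (matrix (g' x))\<bar>"
  have SL: "S \<in> sets lebesgue" using S by simp
  \<comment> \<open>The change of variables theorem is stated for vector-valued integrands; the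
    constant 1 in \<open>real^1\<close> is the simplest instance, and \<open>chv'\<close> carries it
    back to real values.\<close>
  have chv: "(\<lambda>x. ?D x *\<^sub>R (1::real^1)) absolutely_integrable_on S \<and> integral S (\<lambda>x. ?D x *\<^sub>R (1::real^1)) = b
     \<longleftrightarrow> (\<lambda>_. (1::real^1)) absolutely_integrable_on (g ` S) \<and> integral (g ` S) (\<lambda>_. (1::real^1)) = b" for b
    by (rule has_absolute_integral_change_of_variables[OF SL der inj])
  have chv': "?D absolutely_integrable_on S \<and> integral S ?D = r
     \<longleftrightarrow> (\<lambda>_. 1::real) absolutely_integrable_on (g ` S) \<and> integral (g ` S) (\<lambda>_. 1::real) = r" for r
    using chv[of "vec r"] unfolding absolutely_integrable_on_1_iff integral_on_1_eq
    by (simp add: o_def vec_eq_iff)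
  have nn: "?D absolutely_integrable_on S \<longleftrightarrow> ?D integrable_on S"
    "(\<lambda>_. 1::real) absolutely_integrable_on (g ` S) \<longleftrightarrow> (\<lambda>_. 1::real) integrable_on (g ` S)"
    by (auto intro!: absolutely_integrable_on_iff_nonneg)
  have iff: "(?D has_integral r) S \<longleftrightarrow> ((\<lambda>_. 1::real) has_integral r) (g ` S)" for r
    using chv'[of r] unfolding nn by (metis has_integral_integrable_integral)
  have D: "(?D has_integral r) S \<longleftrightarrow> (\<integral>\<^sup>+x. ennreal (indicator S x * ?D x) \<partial>lborel) = ennreal r" if "0 \<le> r" for r
  proof -
    have "(?D has_integral r) S \<longleftrightarrow> ((\<lambda>x. indicator S x * ?D x) has_integral r) UNIV"
    proof -
      have "(\<lambda>x. indicator S x * ?D x) = (\<lambda>x. if x \<in> S then ?D x else 0)"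
        by (auto simp: indicator_def)
      then show ?thesis by (simp only: has_integral_restrict_UNIV)
    qed
    also have "\<dots> \<longleftrightarrow> (\<integral>\<^sup>+x. ennreal (indicator S x * ?D x) \<partial>lborel) = ennreal r"
    proof
      assume "((\<lambda>x. indicator S x * ?D x) has_integral r) UNIV"
      then show "(\<integral>\<^sup>+x. ennreal (indicator S x * ?D x) \<partial>lborel) = ennreal r"
        by (intro nn_integral_has_integral_lborel meas) auto
    next
      assume "(\<integral>\<^sup>+x. ennreal (indicator S x * ?D x) \<partial>lborel) = ennreal r"
      then show "((\<lambda>x. indicator S x * ?D x) has_integral r) UNIV"
        by (intro nn_integral_has_integral meas that) auto
    qed
    finally show ?thesis .
  qed
  \<comment> \<open>Both sides are now compared with every finite \<open>r \<ge> 0\<close>. This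
    determines them in [0,\<infinity>]: if one of them equals no finite value, neither does the
    other, and both are infinite.\<close>
  have key: "(\<integral>\<^sup>+x. ennreal (indicator S x * ?D x) \<partial>lborel) = ennreal r \<longleftrightarrow> emeasure lborel (g ` S) = ennreal r"
    if "0 \<le> r" for r
    using D[OF that] iff[of r] has_integral_iff_emeasure_lborel[OF gS that] by simp
  show ?thesis
  proof (cases "emeasure lborel (g ` S)")
    case (real r)
    then show ?thesis using key[of r] by simp
  next
    case top
    then show ?thesis
      using key by (cases "\<integral>\<^sup>+x. ennreal (indicator S x * ?D x) \<partial>lborel") (auto simp: top_unique)
  qed
qed

text \<open>Two measures are compared: the image under \<open>g\<close> of the measure with density
  \<open>\<bar>det\<bar>\<close> on \<open>S\<close>, and Lebesgue measure on the image of
  \<open>S\<close>. They agree on a Borel set \<open>B\<close> because the set version applies to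
  the part of \<open>S\<close> that \<open>g\<close> maps into \<open>B\<close>; integrating
  \<open>\<phi>\<close> against both gives the formula.\<close>

lemma nn_integral_injective_image:
  fixes g :: "real^'n::{finite,wellorder} \<Rightarrow> real^'n::_"
  assumes S: "S \<in> sets borel"
    and gS: "g ` S \<in> sets borel"
    and der: "\<And>x. x \<in> S \<Longrightarrow> (g has_derivative g' x) (at x within S)"
    and inj: "inj_on g S"
    and meas: "(\<lambda>x. indicator S x * \<bar>det (matrix (g' x))\<bar>) \<in> borel_measurable borel"
    and \<phi>[measurable]: "\<phi> \<in> borel_measurable borel"
  shows "(\<integral>\<^sup>+y. \<phi> y * indicator (g ` S) y \<partial>lborel)
    = (\<integral>\<^sup>+x. ennreal (indicator S x * \<bar>det (matrix (g' x))\<bar>) * \<phi> (g x) \<partial>lborel)"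
proof -
  let ?D = "\<lambda>x. \<bar>det (matrix (g' x))\<bar>"
  note [measurable] = S gS meas
  have "continuous_on S g"
    using der by (auto simp: continuous_on_eq_continuous_within intro: has_derivative_continuous)
  then have gr[measurable]: "(\<lambda>x. if x \<in> S then g x else 0) \<in> borel_measurable borel"
    using S by (intro borel_measurable_continuous_on_if) auto
  \<comment> \<open>\<open>g\<close> is controlled only on \<open>S\<close>; extended by zero it is
    Borel everywhere, and the density vanishes wherever the extension differs from
    \<open>g\<close>.\<close>
  define G where "G = (\<lambda>x. if x \<in> S then g x else 0)"
  have [measurable]: "G \<in> borel_measurable borel" using gr by (simp add: G_def)
  have eq: "distr (density lborel (\<lambda>x. ennreal (indicator S x * ?D x))) borel G
    = density lborel (indicator (g ` S))" (is "?L = ?R")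
  proof (rule measure_eqI)
    show "sets ?L = sets ?R" by simp
    fix B assume "B \<in> sets ?L"
    then have B[measurable]: "B \<in> sets borel" by simp
    define T where "T = S \<inter> G -` B"
    have T[measurable]: "T \<in> sets borel"
      using measurable_sets[OF \<open>G \<in> borel_measurable borel\<close> B] by (simp add: T_def)
    have gT: "g ` T = g ` S \<inter> B" by (auto simp: T_def G_def)
    have ind: "indicator T x * ?D x = indicator T x * (indicator S x * ?D x)" for x
      by (auto simp: T_def indicator_def)
    have "emeasure ?L B = (\<integral>\<^sup>+x. ennreal (indicator S x * ?D x) * indicator (G -` B) x \<partial>lborel)"
      using measurable_sets[OF \<open>G \<in> borel_measurable borel\<close> B]
      by (subst emeasure_distr) (auto simp: emeasure_density)
    also have "\<dots> = (\<integral>\<^sup>+x. ennreal (indicator T x * ?D x) \<partial>lborel)"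
      by (intro nn_integral_cong) (auto simp: T_def indicator_def)
    also have "\<dots> = emeasure lborel (g ` T)"
    proof (rule emeasure_injective_image[symmetric])
      show "g ` T \<in> sets borel" by (simp add: gT)
      show "(g has_derivative g' x) (at x within T)" if "x \<in> T" for x
        using that der[of x] by (auto simp: T_def intro: has_derivative_subset)
      show "inj_on g T" using inj by (auto simp: T_def inj_on_def)
      show "(\<lambda>x. indicator T x * ?D x) \<in> borel_measurable borel"
        by (subst ind) measurable
    qed (rule T)
    also have "\<dots> = emeasure ?R B"
      using gS by (subst emeasure_density) (simp_all add: gT flip: indicator_inter_arith)
    finally show "emeasure ?L B = emeasure ?R B" .
  qed
  have "(\<integral>\<^sup>+y. \<phi> y * indicator (g ` S) y \<partial>lborel) = (\<integral>\<^sup>+y. \<phi> y \<partial>?R)"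
    by (simp add: nn_integral_density mult.commute)
  also have "\<dots> = (\<integral>\<^sup>+x. ennreal (indicator S x * ?D x) * \<phi> (G x) \<partial>lborel)"
    unfolding eq[symmetric] by (simp add: nn_integral_density nn_integral_distr)
  also have "\<dots> = (\<integral>\<^sup>+x. ennreal (indicator S x * ?D x) * \<phi> (g x) \<partial>lborel)"
    by (intro nn_integral_cong) (auto simp: G_def indicator_def)
  finally show ?thesis .
qed

text \<open>The change of variables theorems of the library ask for a well-ordered index type. Only the
  determinant sees the order, so a copy of the index type is ordered through an injection into the
  natural numbers.\<close>

datatype 'm ordered_copy = Copy (uncopy: 'm)

lemma bij_Copy: "bij Copy"
  by (intro bijI' exI[of _ "uncopy _"]) auto

instance ordered_copy :: (finite) finite
proof
  have "finite (Copy ` (UNIV :: 'a set))" by simp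
  then show "finite (UNIV :: 'a ordered_copy set)"
    by (metis bij_is_surj[OF bij_Copy])
qed

instantiation ordered_copy :: (finite) wellorder
begin

definition "x \<le> y \<longleftrightarrow> to_nat (uncopy x) \<le> to_nat (uncopy y)"
definition "x < y \<longleftrightarrow> to_nat (uncopy x) < to_nat (uncopy y)"

instance
proof
  fix P :: "'a ordered_copy \<Rightarrow> bool" and x :: "'a ordered_copy"
  assume "\<And>x. (\<And>y. y < x \<Longrightarrow> P y) \<Longrightarrow> P x"
  then show "P x"
    unfolding less_ordered_copy_def by (rule measure_induct_rule)
qed (auto simp: less_eq_ordered_copy_def less_ordered_copy_def ordered_copy.expand)

end

section \<open>Lebesgue measure under relabelling of coordinates\<close>

lemma distr_PiM_reindex_lborel:
  assumes "bij_betw f I K" "finite I"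
  shows "distr (PiM K (\<lambda>_. lborel :: real measure)) (PiM I (\<lambda>_. lborel)) (\<lambda>x. \<lambda>i\<in>I. x (f i))
    = PiM I (\<lambda>_. lborel)"
proof -
  have K: "finite K" and fI: "\<And>i. i \<in> I \<Longrightarrow> f i \<in> K"
    using assms bij_betw_finite bij_betwE by blast+
  interpret product_sigma_finite "\<lambda>_. lborel :: real measure" ..
  interpret I: finite_product_sigma_finite "\<lambda>_. lborel :: real measure" I
    by standard (rule assms)
  have meas: "(\<lambda>x. \<lambda>i\<in>I. x (f i)) \<in> measurable (PiM K (\<lambda>_. lborel :: real measure)) (PiM I (\<lambda>_. lborel))"
    by (intro measurable_restrict) (use fI in auto)
  show ?thesis
  proof (rule PiM_eqI[OF assms(2)])
    fix A :: "'a \<Rightarrow> real set" assume A: "\<And>i. i \<in> I \<Longrightarrow> A i \<in> sets lborel"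
    define B where "B k = A (the_inv_into I f k)" for k
    have inv: "the_inv_into I f (f i) = i" if "i \<in> I" for i
      using assms(1) that by (simp add: bij_betw_def the_inv_into_f_f)
    have B: "\<And>k. k \<in> K \<Longrightarrow> B k \<in> sets lborel"
      using A assms(1) bij_betw_the_inv_into bij_betwE unfolding B_def by blast
    have K_eq: "K = f ` I" using assms(1) by (simp add: bij_betw_def)
    have "(\<lambda>x. \<lambda>i\<in>I. x (f i)) -` Pi\<^sub>E I A \<inter> space (PiM K (\<lambda>_. lborel)) = Pi\<^sub>E K B"
      by (auto simp: space_PiM PiE_def Pi_def extensional_def K_eq B_def inv)
    then have "emeasure (distr (PiM K (\<lambda>_. lborel)) (PiM I (\<lambda>_. lborel)) (\<lambda>x. \<lambda>i\<in>I. x (f i))) (Pi\<^sub>E I A)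
      = emeasure (PiM K (\<lambda>_. lborel)) (Pi\<^sub>E K B)"
      using A by (subst emeasure_distr[OF meas]) (auto intro!: sets_PiM_I_finite assms(2))
    also have "\<dots> = (\<Prod>k\<in>K. emeasure lborel (B k))"
      using B by (rule emeasure_PiM[OF K])
    also have "\<dots> = (\<Prod>i\<in>I. emeasure lborel (A i))"
      by (subst prod.reindex_bij_betw[OF assms(1), symmetric]) (auto simp: B_def inv intro!: prod.cong)
    finally show "emeasure (distr (PiM K (\<lambda>_. lborel)) (PiM I (\<lambda>_. lborel)) (\<lambda>x. \<lambda>i\<in>I. x (f i))) (Pi\<^sub>E I A)
      = (\<Prod>i\<in>I. emeasure lborel (A i))" .
  qed simp
qed

lemma nn_integral_PiM_reindex_lborel:
  assumes "bij_betw f I K" "finite I" and [measurable]: "g \<in> borel_measurable (PiM I (\<lambda>_. lborel))"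
  shows "(\<integral>\<^sup>+x. g x \<partial>PiM I (\<lambda>_. lborel :: real measure))
    = (\<integral>\<^sup>+x. g (\<lambda>i\<in>I. x (f i)) \<partial>PiM K (\<lambda>_. lborel))"
proof -
  have [measurable]: "(\<lambda>x. \<lambda>i\<in>I. x (f i)) \<in> measurable (PiM K (\<lambda>_. lborel :: real measure)) (PiM I (\<lambda>_. lborel))"
    by (intro measurable_restrict measurable_component_singleton) (use assms(1) bij_betwE in blast)
  show ?thesis
    by (subst distr_PiM_reindex_lborel[OF assms(1,2), symmetric]) (simp add: nn_integral_distr)
qed

lemma nn_integral_lborel_vec:
  fixes g :: "real^'m \<Rightarrow> ennreal"
  assumes [measurable]: "g \<in> borel_measurable borel"
  shows "(\<integral>\<^sup>+x. g x \<partial>lborel) = (\<integral>\<^sup>+s. g (\<chi> i. s i) \<partial>PiM UNIV (\<lambda>_. lborel))"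
proof -
  have bij: "bij_betw (\<lambda>i. axis i (1::real)) (UNIV :: 'm set) Basis"
    by (auto simp: bij_betw_def inj_on_def axis_eq_axis Basis_vec_def)
  have vec: "(\<lambda>s. \<chi> i. s i) \<in> borel_measurable (PiM (UNIV :: 'm set) (\<lambda>_. lborel :: real measure))"
    by (rule borel_measurable_euclidean_space[THEN iffD2]) (auto simp: Basis_vec_def inner_axis)
  note [measurable] = vec
  have "(\<integral>\<^sup>+s. g (\<chi> i. s i) \<partial>PiM (UNIV :: 'm set) (\<lambda>_. lborel))
    = (\<integral>\<^sup>+s. g (\<chi> i. (\<lambda>i\<in>UNIV. s (axis i 1)) i) \<partial>PiM (Basis :: (real^'m) set) (\<lambda>_. lborel))"
    by (rule nn_integral_PiM_reindex_lborel[OF bij]) auto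
  also have "\<dots> = (\<integral>\<^sup>+s. g (\<Sum>b\<in>Basis. s b *\<^sub>R b) \<partial>PiM (Basis :: (real^'m) set) (\<lambda>_. lborel))"
  proof (intro nn_integral_cong arg_cong[where f=g])
    fix s :: "real^'m \<Rightarrow> real"
    show "(\<chi> i. (\<lambda>i\<in>UNIV. s (axis i 1)) i) = (\<Sum>b\<in>Basis. s b *\<^sub>R b)"
      by (subst sum.reindex_bij_betw[OF bij, symmetric])
         (simp add: vec_eq_iff axis_def if_distrib[of "\<lambda>x. _ * x"] cong: if_cong)
  qed
  also have "\<dots> = (\<integral>\<^sup>+x. g x \<partial>lborel)"
    by (simp add: lborel_eq_real lborel_def[where 'a="real^'m"] nn_integral_distr)
  finally show ?thesis by simp
qed

lemma nn_integral_ordered_copy: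
  fixes g :: "real^'m \<Rightarrow> ennreal"
  assumes [measurable]: "g \<in> borel_measurable borel"
  shows "(\<integral>\<^sup>+x. g x \<partial>lborel) = (\<integral>\<^sup>+y. g (\<chi> i. y $ Copy i) \<partial>lborel)"
proof -
  have vec: "(\<lambda>s. \<chi> i. s i) \<in> borel_measurable (PiM (UNIV :: 'm set) (\<lambda>_. lborel :: real measure))"
    by (rule borel_measurable_euclidean_space[THEN iffD2]) (auto simp: Basis_vec_def inner_axis)
  have vec': "(\<lambda>y. \<chi> i. y $ Copy i) \<in> borel_measurable (borel :: (real^'m ordered_copy) measure)"
    by (rule borel_measurable_euclidean_space[THEN iffD2]) (auto simp: Basis_vec_def inner_axis)
  note [measurable] = vec vec'
  have "(\<integral>\<^sup>+x. g x \<partial>lborel) = (\<integral>\<^sup>+s. g (\<chi> i. s i) \<partial>PiM UNIV (\<lambda>_. lborel))"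
    by (rule nn_integral_lborel_vec) simp
  also have "\<dots> = (\<integral>\<^sup>+s. g (\<chi> i. (\<lambda>i\<in>UNIV. s (Copy i)) i) \<partial>PiM UNIV (\<lambda>_. lborel))"
    by (rule nn_integral_PiM_reindex_lborel[OF bij_Copy]) auto
  also have "\<dots> = (\<integral>\<^sup>+y. g (\<chi> i. y $ Copy i) \<partial>lborel)"
    by (subst nn_integral_lborel_vec) (auto simp: restrict_UNIV)
  finally show ?thesis .
qed

section \<open>F-sigma sets: a class of Borel sets stable under continuous images\<close>

lemma fsigma_closed: "closed S \<Longrightarrow> fsigma S"
  using fsigma.intros[of "\<lambda>_. S"] by simp

lemma fsigma_open:
  fixes S :: "'a::euclidean_space set"
  assumes "open S"
  shows "fsigma S"
proof (cases "S = {}")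
  case False
  obtain D where D: "countable D" "\<And>X. X \<in> D \<Longrightarrow> \<exists>a b. X = cbox a b" "\<Union>D = S"
    using open_countable_Union_open_cbox[OF assms] by metis
  have "D \<noteq> {}" using D False by auto
  then have "S = (\<Union>n::nat. from_nat_into D n)" and "\<And>n. closed (from_nat_into D n)"
    using D from_nat_into[of D] by (auto simp: range_from_nat_into) (metis closed_cbox)
  then show ?thesis using fsigma.intros by metis
qed (simp add: fsigma_closed)

lemma fsigma_Int:
  assumes "fsigma S" "fsigma T"
  shows "fsigma (S \<inter> T)"
proof -
  obtain F G :: "nat \<Rightarrow> 'a set" where FG: "\<And>n. closed (F n)" "\<And>n. closed (G n)"
      "S = (\<Union>n. F n)" "T = (\<Union>n. G n)"
    using assms by (auto elim!: fsigma.cases)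
  have eq: "S \<inter> T = (\<Union>n. F (fst (prod_decode n)) \<inter> G (snd (prod_decode n)))"
  proof safe
    fix x assume "x \<in> S" "x \<in> T"
    then obtain i j where "x \<in> F i" "x \<in> G j" using FG by auto
    then show "x \<in> (\<Union>n. F (fst (prod_decode n)) \<inter> G (snd (prod_decode n)))"
      by (intro UN_I[of "prod_encode (i, j)"]) auto
  qed (auto simp: FG)
  show ?thesis unfolding eq by (rule fsigma.intros) (auto simp: FG)
qed

lemma fsigma_borel: "fsigma S \<Longrightarrow> S \<in> sets borel"
  by (auto elim!: fsigma.cases)

text \<open>In Euclidean space F-sigma sets are exactly the countable unions of compact sets, and
  compactness passes to images. For general Borel pieces, Borel images in the area formula would
  call for the Lusin-Souslin theorem.\<close>

lemma fsigma_continuous_image: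
  fixes f :: "'a::euclidean_space \<Rightarrow> 'b::euclidean_space"
  assumes "fsigma S" "continuous_on S f"
  shows "fsigma (f ` S)"
proof -
  obtain F :: "nat \<Rightarrow> 'a set" where F: "\<And>n. compact (F n)" "S = (\<Union>n. F n)"
    using assms(1) unfolding fsigma_Union_compact by (auto simp: subset_eq)
  have "compact (f ` F n)" for n
    using assms(2) F by (intro compact_continuous_image) (auto intro: continuous_on_subset)
  moreover have "f ` S = (\<Union>n. f ` F n)" using F by auto
  ultimately show ?thesis
    unfolding fsigma_Union_compact by (intro exI[of _ "\<lambda>n. f ` F n"]) auto
qed

text \<open>The injectivity half of the inverse function theorem: the derivative at \<open>x\<close>
  has a linear left inverse, and continuity of the matrix \<open>J\<close> gives continuity of the
  derivative in operator norm.\<close>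

lemma locally_injective_det:
  fixes H :: "real^'n \<Rightarrow> real^'n"
  assumes R: "open R" "x \<in> R"
    and der: "\<And>x. x \<in> R \<Longrightarrow> (H has_derivative (*v) (J x)) (at x)"
    and cont: "continuous_on R J"
    and det: "det (J x) \<noteq> 0"
  obtains r where "r > 0" "ball x r \<subseteq> R" "inj_on H (ball x r)"
proof -
  have lin: "linear ((*v) (J x))" by simp
  have "inj ((*v) (J x))"
    using det det_nz_iff_inj[OF lin] by (simp add: matrix_of_matrix_vector_mul)
  then obtain g where g: "linear g" "g \<circ> (*v) (J x) = id"
    using linear_injective_left_inverse[OF lin] by blast
  show ?thesis
  proof (rule has_derivative_locally_injective[OF R(2,1) _ g(2) der])
    show "bounded_linear g" using g(1) by (simp add: linear_conv_bounded_linear)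
    fix e :: real assume "e > 0"
    \<comment> \<open>The operator norm of an n by n matrix is at most n^2 times a bound on its
      entries; the summand 1 makes \<open>c > 0\<close> immediate.\<close>
    define c where "c = real CARD('n) * real CARD('n) + 1"
    have "c > 0" by (simp add: c_def add_nonneg_pos)
    have "isCont J x"
      using cont R by (simp add: continuous_on_eq_continuous_at)
    then obtain d where d: "d > 0" "\<And>y. dist y x < d \<Longrightarrow> dist (J y) (J x) < e / c"
      using \<open>e > 0\<close> \<open>c > 0\<close> unfolding continuous_at_eps_delta by (metis divide_pos_pos)
    have "onorm (\<lambda>v. J y *v v - J x *v v) < e" if "dist x y < d" for y
    proof -
      have nm: "norm (J y - J x) < e / c"
        using d(2)[of y] that by (metis dist_norm dist_commute)
      have "\<bar>(J y - J x) $ i $ j\<bar> \<le> norm (J y - J x)" for i j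
        by (metis Finite_Cartesian_Product.norm_nth_le order_trans real_norm_def)
      then have "onorm ((*v) (J y - J x)) \<le> real CARD('n) * real CARD('n) * norm (J y - J x)"
        by (rule onorm_le_matrix_component)
      also have "\<dots> \<le> c * norm (J y - J x)"
        by (intro mult_right_mono) (auto simp: c_def)
      also have "\<dots> < e"
        using nm \<open>c > 0\<close> by (simp add: field_simps)
      finally show ?thesis by (simp add: matrix_vector_mult_diff_rdistrib[symmetric])
    qed
    then show "\<exists>d>0. \<forall>y. dist x y < d \<longrightarrow> onorm (\<lambda>v. J y *v v - J x *v v) < e"
      using d(1) by blast
  qed (use that in auto)
qed

lemma emeasure_count_preimage:
  assumes "inj_on f P"
  shows "emeasure (count_space UNIV) {x \<in> P. f x = t} = indicator (f ` P) t"
proof (cases "t \<in> f ` P")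
  case True
  then obtain x where "x \<in> P" "t = f x" by auto
  then have "{x \<in> P. f x = t} = {x}" using assms by (auto simp: inj_on_def)
  then show ?thesis using True by simp
next
  case False
  then have "{x \<in> P. f x = t} = {}" by auto
  then show ?thesis using False by (simp only: emeasure_empty) simp
qed

text \<open>Away from critical points \<open>H\<close> is locally injective, so this part of
  \<open>V\<close> splits into countably many pieces on which the injective formula applies, and the
  indicators of their images add up to the number of preimages. Critical points have a null image by
  Sard and a vanishing determinant, so they count on neither side.\<close>

lemma area_formula_wellorder:
  fixes H :: "real^'n::{finite,wellorder} \<Rightarrow> real^'n::_"
  assumes W: "open W" and V: "fsigma V" "V \<subseteq> W"
    and der: "\<And>x. x \<in> W \<Longrightarrow> (H has_derivative (*v) (J x)) (at x)"
    and cont: "continuous_on W J"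
    and \<phi>[measurable]: "\<phi> \<in> borel_measurable borel"
  shows "(\<integral>\<^sup>+t. \<phi> t * emeasure (count_space UNIV) {x \<in> V. H x = t} \<partial>lborel)
    = (\<integral>\<^sup>+x. ennreal (indicator V x * \<bar>det (J x)\<bar>) * \<phi> (H x) \<partial>lborel)"
proof -
  define R where "R = {x \<in> W. det (J x) \<noteq> 0}"
  have detc: "continuous_on W (\<lambda>x. det (J x))"
    unfolding det_def by (intro continuous_intros cont)
  have "R = W \<inter> (\<lambda>x. det (J x)) -` (- {0})" by (auto simp: R_def)
  then have R: "open R"
    using continuous_on_open_vimage[OF W, THEN iffD1, OF detc, rule_format, of "-{0}"]
    by (simp add: Int_commute open_Compl)
  have RW: "R \<subseteq> W" by (auto simp: R_def)
  have "\<exists>r>0. ball x r \<subseteq> R \<and> inj_on H (ball x r)" if "x \<in> R" for x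
    using locally_injective_det[OF R that, of H J] der cont RW that
    by (metis (mono_tags, lifting) R_def continuous_on_subset mem_Collect_eq subsetD)
  then obtain r where r: "\<And>x. x \<in> R \<Longrightarrow> r x > 0 \<and> ball x (r x) \<subseteq> R \<and> inj_on H (ball x (r x))"
    by metis
  obtain \<F> where \<F>: "\<F> \<subseteq> (\<lambda>x. ball x (r x)) ` R" "countable \<F>" "\<Union>\<F> = \<Union>((\<lambda>x. ball x (r x)) ` R)"
    using Lindelof[of "(\<lambda>x. ball x (r x)) ` R"] by (metis (no_types, lifting) imageE open_ball)
  have UF: "\<Union>\<F> = R" using r unfolding \<F>(3) by fastforce
  \<comment> \<open>The empty set is added because \<open>from_nat_into\<close> enumerates nonempty
    sets only, and the cover is empty when every point of \<open>W\<close> is critical.\<close>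
  define B :: "nat \<Rightarrow> _" where "B = from_nat_into (insert {} \<F>)"
  have rB: "range B = insert {} \<F>"
    using \<F>(2) by (simp add: B_def range_from_nat_into)
  have UB: "(\<Union>n. B n) = R" using rB UF by auto
  have B: "open (B n) \<and> inj_on H (B n)" for n
  proof -
    have "B n \<in> insert {} \<F>" using rB by auto
    then show ?thesis using \<F>(1) r by auto
  qed
  define P where "P n = V \<inter> disjointed B n" for n
  have P_alt: "P n = V \<inter> (B n \<inter> - (\<Union>i<n. B i))" for n
    by (auto simp: P_def disjointed_def atLeast0LessThan)
  have Pf: "fsigma (P n)" for n
    unfolding P_alt
    by (intro fsigma_Int V fsigma_open fsigma_closed closed_Compl open_UN) (auto simp: B)
  have UP: "(\<Union>n. P n) = V \<inter> R"
    by (simp add: P_def UN_disjointed_eq UB flip: UN_extend_simps)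
  have disjP: "disjoint_family P"
    using disjoint_family_disjointed[of B] by (auto simp: P_def disjoint_family_on_def)
  have PW: "P n \<subseteq> W" for n using UP RW by auto
  have Pinj: "inj_on H (P n)" for n
    using B[of n] by (auto simp: P_alt inj_on_def)
  have Hc: "continuous_on W H"
    using der by (meson continuous_at_imp_continuous_on has_derivative_continuous)
  have HP[measurable]: "H ` P n \<in> sets borel" for n
    by (intro fsigma_borel fsigma_continuous_image Pf continuous_on_subset[OF Hc] PW)
  have [measurable]: "P n \<in> sets borel" "V \<in> sets borel" for n
    using Pf V fsigma_borel by auto
  have detm: "(\<lambda>x. indicator T x * \<bar>det (J x)\<bar>) \<in> borel_measurable borel"
    if [measurable]: "T \<in> sets borel" and "T \<subseteq> W" for T
  proof -
    have "(\<lambda>x. if x \<in> T then \<bar>det (J x)\<bar> else 0) \<in> borel_measurable borel"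
      by (intro borel_measurable_continuous_on_if continuous_on_rabs continuous_on_subset[OF detc] that continuous_on_const)
    moreover have "(\<lambda>x. indicator T x * \<bar>det (J x)\<bar>) = (\<lambda>x. if x \<in> T then \<bar>det (J x)\<bar> else 0)"
      by (auto simp: indicator_def)
    ultimately show ?thesis by simp
  qed
  have piece: "(\<integral>\<^sup>+t. \<phi> t * indicator (H ` P n) t \<partial>lborel)
    = (\<integral>\<^sup>+x. ennreal (indicator (P n) x * \<bar>det (J x)\<bar>) * \<phi> (H x) \<partial>lborel)" for n
  proof -
    have "(H has_derivative (*v) (J x)) (at x within P n)" if "x \<in> P n" for x
      using der[of x] that PW[of n] by (blast intro: has_derivative_at_withinI)
    moreover have "(\<lambda>x. indicator (P n) x * \<bar>det (matrix ((*v) (J x)))\<bar>) \<in> borel_measurable borel"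
      using detm[OF _ PW[of n]] by (simp add: matrix_of_matrix_vector_mul)
    ultimately show ?thesis
      using nn_integral_injective_image[of "P n" H "\<lambda>x. (*v) (J x)" \<phi>] Pinj[of n]
      by (simp add: matrix_of_matrix_vector_mul)
  qed
  define Z where "Z = V - R"
  have "negligible (H ` Z)"
  proof (rule baby_Sard)
    fix x assume "x \<in> Z"
    then have x: "x \<in> W" "det (J x) = 0" using V by (auto simp: Z_def R_def)
    show "(H has_derivative (*v) (J x)) (at x within Z)"
      using der[OF x(1)] by (rule has_derivative_at_withinI)
    show "rank (matrix ((*v) (J x))) < CARD('n)"
      using x det_nz_iff_inj[of "(*v) (J x)"] by (simp add: less_rank_noninjective matrix_of_matrix_vector_mul)
  qed simp
  then have "AE t in lebesgue. t \<notin> H ` Z"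
    by (simp add: negligible_iff_null_sets AE_not_in)
  then have ae: "AE t in lborel. t \<notin> H ` Z"
    by (simp add: AE_completion_iff)
  have "(\<integral>\<^sup>+t. \<phi> t * emeasure (count_space UNIV) {x \<in> V. H x = t} \<partial>lborel)
    = (\<integral>\<^sup>+t. (\<Sum>n. \<phi> t * indicator (H ` P n) t) \<partial>lborel)"
  proof (rule nn_integral_cong_AE, use ae in eventually_elim)
    case (elim t)
    have "{x \<in> V. H x = t} = (\<Union>n. {x \<in> P n. H x = t})"
      using elim UP by (auto simp: Z_def)
    then have "emeasure (count_space UNIV) {x \<in> V. H x = t}
      = (\<Sum>n. emeasure (count_space UNIV) {x \<in> P n. H x = t})"
      using disjP by (subst suminf_emeasure) (auto simp: disjoint_family_on_def)
    then show ?case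
      by (simp add: emeasure_count_preimage[OF Pinj])
  qed
  also have "\<dots> = (\<Sum>n. \<integral>\<^sup>+x. ennreal (indicator (P n) x * \<bar>det (J x)\<bar>) * \<phi> (H x) \<partial>lborel)"
    by (subst nn_integral_suminf) (auto simp: piece)
  also have "\<dots> = (\<integral>\<^sup>+x. (\<Sum>n. ennreal (indicator (P n) x * \<bar>det (J x)\<bar>) * \<phi> (H x)) \<partial>lborel)"
  proof (rule nn_integral_suminf[symmetric])
    fix n
    have *: "(\<lambda>x. if x \<in> P n then H x else 0) \<in> borel_measurable borel"
      by (intro borel_measurable_continuous_on_if continuous_on_subset[OF Hc] PW continuous_on_const) simp
    have "(\<lambda>x. ennreal (indicator (P n) x * \<bar>det (J x)\<bar>) * \<phi> (H x))
      = (\<lambda>x. ennreal (indicator (P n) x * \<bar>det (J x)\<bar>) * \<phi> (if x \<in> P n then H x else 0))"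
      by (auto simp: indicator_def)
    then show "(\<lambda>x. ennreal (indicator (P n) x * \<bar>det (J x)\<bar>) * \<phi> (H x)) \<in> borel_measurable lborel"
      using * detm[of "P n", OF _ PW] by simp
  qed
  also have "\<dots> = (\<integral>\<^sup>+x. ennreal (indicator V x * \<bar>det (J x)\<bar>) * \<phi> (H x) \<partial>lborel)"
  proof (rule nn_integral_cong)
    fix x
    show "(\<Sum>n. ennreal (indicator (P n) x * \<bar>det (J x)\<bar>) * \<phi> (H x))
      = ennreal (indicator V x * \<bar>det (J x)\<bar>) * \<phi> (H x)"
    proof (cases "x \<in> V \<inter> R")
      case True
      have "(\<Sum>n. ennreal (indicator (P n) x * \<bar>det (J x)\<bar>) * \<phi> (H x))
        = (\<Sum>n. indicator (P n) x * (ennreal \<bar>det (J x)\<bar> * \<phi> (H x)))"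
        by (intro suminf_cong) (auto simp: indicator_def)
      also have "\<dots> = indicator (\<Union>n. P n) x * (ennreal \<bar>det (J x)\<bar> * \<phi> (H x))"
        by (simp add: suminf_indicator[OF disjP])
      finally show ?thesis using True UP by auto
    next
      case False
      then have "\<And>n. x \<notin> P n" using UP by auto
      moreover have "indicator V x * \<bar>det (J x)\<bar> = 0"
        using False V by (auto simp: R_def indicator_def)
      ultimately show ?thesis by simp
    qed
  qed
  finally show ?thesis .
qed

section \<open>Measurability of the number of zeros\<close>

text \<open>On a compact set the infimum of \<open>\<bar>h\<bar>\<close> is attained, so values
  arbitrarily close to 0 force a zero. With \<open>D\<close> countable this replaces an uncountable
  existential by countably many conditions on values of \<open>h\<close>.\<close>

lemma exists_zero_iff_dense:
  fixes h :: "'a::metric_space \<Rightarrow> real"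
  assumes K: "compact K" "continuous_on K h" and D: "D \<subseteq> K" "K \<subseteq> closure D"
  shows "(\<exists>x\<in>K. h x = 0) \<longleftrightarrow> (\<forall>n. \<exists>x\<in>D. \<bar>h x\<bar> < 1 / real (Suc n))"
proof
  assume "\<exists>x\<in>K. h x = 0"
  then obtain x where x: "x \<in> K" "h x = 0" by auto
  show "\<forall>n. \<exists>x\<in>D. \<bar>h x\<bar> < 1 / real (Suc n)"
  proof
    fix n
    have "0 < 1 / real (Suc n)" by simp
    then obtain d where d: "d > 0" "\<And>y. y \<in> K \<Longrightarrow> dist y x < d \<Longrightarrow> dist (h y) (h x) < 1 / real (Suc n)"
      using K(2) x(1) unfolding continuous_on_iff by blast
    obtain y where "y \<in> D" "dist y x < d"
      using subsetD[OF D(2) x(1)] d(1) unfolding closure_approachable by blast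
    then show "\<exists>x\<in>D. \<bar>h x\<bar> < 1 / real (Suc n)"
      using d(2)[of y] D(1) x(2) by (auto simp: dist_real_def)
  qed
next
  assume *: "\<forall>n. \<exists>x\<in>D. \<bar>h x\<bar> < 1 / real (Suc n)"
  then have "K \<noteq> {}" using D by blast
  then obtain x where x: "x \<in> K" "\<And>y. y \<in> K \<Longrightarrow> \<bar>h x\<bar> \<le> \<bar>h y\<bar>"
    using continuous_attains_inf[OF K(1), of "\<lambda>x. \<bar>h x\<bar>"] K(2) by (auto intro: continuous_on_rabs)
  have "\<bar>h x\<bar> < 1 / real (Suc n)" for n
    using * x(2) D(1) by (meson order_le_less_trans subsetD)
  then have "h x = 0"
    by (metis nat_approx_posE not_less_iff_gr_or_eq zero_less_abs_iff)
  then show "\<exists>x\<in>K. h x = 0" using x(1) by auto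
qed

lemma finite_separated:
  fixes Z :: "'a::metric_space set"
  assumes "finite Z"
  obtains \<delta> where "\<delta> > 0" "\<And>x y. x \<in> Z \<Longrightarrow> y \<in> Z \<Longrightarrow> x \<noteq> y \<Longrightarrow> \<delta> \<le> dist x y"
proof -
  \<comment> \<open>The element 1 serves sets with fewer than two points, where there is no distance
    to minimise.\<close>
  define S where "S = insert 1 {dist x y |x y. x \<in> Z \<and> y \<in> Z \<and> x \<noteq> y}"
  have "S \<subseteq> insert 1 ((\<lambda>(x, y). dist x y) ` (Z \<times> Z))" by (auto simp: S_def)
  then have fin: "finite S" using assms finite_subset by blast
  have "Min S \<in> S" using fin by (intro Min_in) (auto simp: S_def)
  then have "Min S > 0" by (auto simp: S_def)
  moreover have "Min S \<le> dist x y" if "x \<in> Z" "y \<in> Z" "x \<noteq> y" for x y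
    using that fin by (intro Min_le) (auto simp: S_def)
  ultimately show ?thesis using that by blast
qed

text \<open>The pieces are the compact layers of \<open>V\<close> cut by closed balls of radius
  \<open>1 / real (Suc k)\<close> whose centres run through a countable dense subset of the whole
  space.\<close>

lemma fsigma_compact_pieces:
  fixes V :: "'a::euclidean_space set"
  assumes "fsigma V"
  obtains \<K> where "countable \<K>" "\<And>K. K \<in> \<K> \<Longrightarrow> compact K \<and> K \<subseteq> V"
    "\<And>z \<epsilon>. z \<in> V \<Longrightarrow> \<epsilon> > 0 \<Longrightarrow> \<exists>K\<in>\<K>. z \<in> K \<and> K \<subseteq> ball z \<epsilon>"
proof -
  obtain C :: "nat \<Rightarrow> 'a set" where C: "\<And>n. compact (C n)" "V = (\<Union>n. C n)"
    using assms unfolding fsigma_Union_compact by (auto simp: subset_eq)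
  obtain D :: "'a set" where D: "countable D" "UNIV \<subseteq> closure D"
    using separable[of "UNIV :: 'a set"] by metis
  define \<K> where "\<K> = (\<lambda>(n, q, k). C n \<inter> cball q (1 / real (Suc k))) ` (UNIV \<times> D \<times> UNIV)"
  show ?thesis
  proof
    show "countable \<K>" unfolding \<K>_def using D by auto
    show "compact K \<and> K \<subseteq> V" if "K \<in> \<K>" for K
      using that C by (auto simp: \<K>_def intro: compact_Int_closed)
    fix z \<epsilon> assume "z \<in> V" "(\<epsilon>::real) > 0"
    then obtain n where n: "z \<in> C n" using C by auto
    obtain k where k: "1 / real (Suc k) < \<epsilon> / 2"
      using nat_approx_posE[of "\<epsilon> / 2"] \<open>\<epsilon> > 0\<close> by auto
    obtain q where q: "q \<in> D" "dist q z < 1 / real (Suc k)"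
      using D(2) unfolding closure_approachable by (metis UNIV_I closure_approachable of_nat_0_less_iff subsetD zero_less_Suc zero_less_divide_1_iff)
    have "cball q (1 / real (Suc k)) \<subseteq> ball z \<epsilon>"
    proof
      fix y assume "y \<in> cball q (1 / real (Suc k))"
      then have "dist z y \<le> dist q z + 1 / real (Suc k)"
        using dist_triangle[of z y q] by (simp add: dist_commute)
      then show "y \<in> ball z \<epsilon>" using q(2) k by simp
    qed
    then show "\<exists>K\<in>\<K>. z \<in> K \<and> K \<subseteq> ball z \<epsilon>"
      using n q unfolding \<K>_def by (intro bexI[of _ "C n \<inter> cball q (1 / real (Suc k))"]) auto
  qed
qed

text \<open>The number of points of \<open>Z\<close> is the largest number of disjoint compact pieces that meet \<open>Z\<close>. For
  the zero set of a continuous function, whether a compact piece is met is decided by the values on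
  a countable dense subset, so that the number of zeros is measurable.\<close>

lemma emeasure_count_eq_SUP:
  fixes Z V :: "'a::metric_space set"
  assumes Z: "Z \<subseteq> V"
    and \<K>: "\<And>z \<epsilon>. z \<in> V \<Longrightarrow> \<epsilon> > 0 \<Longrightarrow> \<exists>K\<in>\<K>. z \<in> K \<and> K \<subseteq> ball z \<epsilon>"
  shows "emeasure (count_space UNIV) Z
    = (SUP \<P>\<in>{\<P>. finite \<P> \<and> \<P> \<subseteq> \<K> \<and> disjoint \<P>}. \<Sum>K\<in>\<P>. of_bool (Z \<inter> K \<noteq> {}))" (is "_ = ?S")
proof (rule antisym)
  have fin: "of_nat (card F) \<le> ?S" if F: "finite F" "F \<subseteq> Z" for F
  proof -
    obtain \<delta> where \<delta>: "\<delta> > 0" "\<And>x y. x \<in> F \<Longrightarrow> y \<in> F \<Longrightarrow> x \<noteq> y \<Longrightarrow> \<delta> \<le> dist x y"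
      using finite_separated[OF F(1)] by metis
    \<comment> \<open>Half the minimal distance: pieces inside such balls around different points of
      \<open>F\<close> cannot meet.\<close>
    have "\<exists>K\<in>\<K>. z \<in> K \<and> K \<subseteq> ball z (\<delta> / 2)" if "z \<in> F" for z
      using \<K>[of z "\<delta> / 2"] that F Z \<delta>(1) by auto
    then obtain k where k: "\<And>z. z \<in> F \<Longrightarrow> k z \<in> \<K> \<and> z \<in> k z \<and> k z \<subseteq> ball z (\<delta> / 2)"
      by metis
    have disj: "k x \<inter> k y = {}" if "x \<in> F" "y \<in> F" "x \<noteq> y" for x y
    proof (rule ccontr)
      assume "k x \<inter> k y \<noteq> {}"
      then obtain w where "w \<in> k x" "w \<in> k y" by auto
      then have "dist x w < \<delta> / 2" "dist y w < \<delta> / 2"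
        using k[OF that(1)] k[OF that(2)] by (auto simp: subset_eq)
      then have "dist x y < \<delta>" using dist_triangle2[of x y w] by simp
      then show False using \<delta>(2)[OF that] by simp
    qed
    have inj: "inj_on k F"
      using disj k by (intro inj_onI) (metis Int_iff empty_iff)
    have "(of_nat (card F) :: ennreal) = (\<Sum>K\<in>k ` F. of_bool (Z \<inter> K \<noteq> {}))"
    proof -
      have "(\<Sum>K\<in>k ` F. of_bool (Z \<inter> K \<noteq> {}) :: ennreal) = (\<Sum>z\<in>F. of_bool (Z \<inter> k z \<noteq> {}))"
        by (simp add: sum.reindex[OF inj])
      also have "\<dots> = (\<Sum>z\<in>F. 1)"
        using k F by (intro sum.cong) auto
      finally show ?thesis by simp
    qed
    also have "\<dots> \<le> ?S"
    proof (rule SUP_upper)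
      have "disjoint (k ` F)"
        by (intro pairwiseI) (metis disj disjnt_def imageE)
      then show "k ` F \<in> {\<P>. finite \<P> \<and> \<P> \<subseteq> \<K> \<and> disjoint \<P>}"
        using F(1) k by auto
    qed
    finally show ?thesis .
  qed
  show "emeasure (count_space UNIV) Z \<le> ?S"
  proof (cases "finite Z")
    case True
    then show ?thesis using fin[of Z] by (simp add: emeasure_count_space)
  next
    case False
    have le: "of_nat n \<le> ?S" for n
    proof -
      obtain F where "finite F" "card F = n" "F \<subseteq> Z"
        using infinite_arbitrarily_large[OF False] by blast
      then show ?thesis using fin[of F] by simp
    qed
    have "?S = \<top>"
    proof (rule ccontr)
      assume "?S \<noteq> \<top>"
      then obtain n where "?S < of_nat n"
        using ennreal_Ex_less_of_nat top.not_eq_extremum by blast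
      then show False using le[of n] by (simp only: leD)
    qed
    then show ?thesis by (simp only: top_greatest)
  qed
  show "?S \<le> emeasure (count_space UNIV) Z"
  proof (rule SUP_least)
    fix \<P> assume "\<P> \<in> {\<P>. finite \<P> \<and> \<P> \<subseteq> \<K> \<and> disjoint \<P>}"
    then have P: "finite \<P>" "disjoint \<P>" by auto
    define Q where "Q = {K \<in> \<P>. Z \<inter> K \<noteq> {}}"
    have fQ: "finite Q" using P by (simp add: Q_def)
    have "\<forall>K\<in>Q. \<exists>z. z \<in> Z \<inter> K" by (auto simp: Q_def)
    \<comment> \<open>One point of \<open>Z\<close> is picked from each piece that is met. Disjoint
      pieces give different points, so no disjoint family detects more points than \<open>Z\<close>
      has.\<close>
    then obtain f where f: "\<And>K. K \<in> Q \<Longrightarrow> f K \<in> Z \<inter> K" by metis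
    have "inj_on f Q"
    proof (rule inj_onI, rule ccontr)
      fix K L assume KL: "K \<in> Q" "L \<in> Q" "f K = f L" "K \<noteq> L"
      then have "K \<inter> L = {}"
        using P(2) by (auto simp: Q_def pairwise_def disjnt_def)
      then show False using f[OF KL(1)] f[OF KL(2)] KL(3) by auto
    qed
    then have card: "card (f ` Q) = card Q" by (rule card_image)
    have "(\<Sum>K\<in>\<P>. of_bool (Z \<inter> K \<noteq> {}) :: ennreal) = of_nat (card Q)"
      using P(1) by (simp add: Q_def sum.If_cases of_bool_def Int_def)
    also have "\<dots> = emeasure (count_space UNIV) (f ` Q)"
      using fQ card by (simp add: emeasure_count_space)
    also have "\<dots> \<le> emeasure (count_space UNIV) Z"
      using f by (intro emeasure_mono) auto
    finally show "(\<Sum>K\<in>\<P>. of_bool (Z \<inter> K \<noteq> {})) \<le> emeasure (count_space UNIV) Z" .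
  qed
qed

text \<open>The count becomes one measurable functional on the space of all real functions on
  \<open>V\<close>, correct at the continuous ones. As a functional of the function alone it allows
  an expected count to be computed from a joint law, and every parametrised family inherits
  measurability from it.\<close>

lemma zero_count_functional:
  fixes V :: "'a::euclidean_space set"
  assumes "fsigma V"
  obtains cnt :: "('a \<Rightarrow> real) \<Rightarrow> ennreal"
  where "cnt \<in> borel_measurable (PiM V (\<lambda>_. borel))"
    "\<And>h. continuous_on V h \<Longrightarrow> cnt (restrict h V) = emeasure (count_space UNIV) {x \<in> V. h x = 0}"
proof -
  obtain \<K> where \<K>: "countable \<K>" "\<And>K. K \<in> \<K> \<Longrightarrow> compact K \<and> K \<subseteq> V"
    "\<And>z \<epsilon>. z \<in> V \<Longrightarrow> \<epsilon> > 0 \<Longrightarrow> \<exists>K\<in>\<K>. z \<in> K \<and> K \<subseteq> ball z \<epsilon>"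
    using fsigma_compact_pieces[OF assms] by metis
  have "\<exists>D. countable D \<and> D \<subseteq> K \<and> K \<subseteq> closure D" for K :: "'a set"
    using separable[of K] by metis
  then obtain D where D: "\<And>K :: 'a set. countable (D K) \<and> D K \<subseteq> K \<and> K \<subseteq> closure (D K)"
    by metis
  define \<Q> where "\<Q> = {\<P>. finite \<P> \<and> \<P> \<subseteq> \<K> \<and> disjoint \<P>}"
  \<comment> \<open>For continuous \<open>h\<close> this says that \<open>h\<close> has a zero in
    \<open>K\<close>, yet it reads \<open>h\<close> only at the countably many points of
    \<open>D K\<close> and so is measurable for arbitrary \<open>h\<close>.\<close>
  define hit where "hit K h \<longleftrightarrow> (\<forall>n. \<exists>x\<in>D K. \<bar>h x\<bar> < 1 / real (Suc n))" for K and h :: "'a \<Rightarrow> real"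
  define cnt where "cnt h = (SUP \<P>\<in>\<Q>. \<Sum>K\<in>\<P>. of_bool (hit K h) :: ennreal)" for h
  have cQ: "countable \<Q>"
  proof -
    have "\<Q> \<subseteq> {\<P>. \<P> \<subseteq> \<K> \<and> finite \<P>}" by (auto simp: \<Q>_def)
    then show ?thesis using countable_Collect_finite_subset[OF \<K>(1)] countable_subset by (metis (no_types, lifting) Collect_cong)
  qed
  show ?thesis
  proof
    have hit: "Measurable.pred (PiM V (\<lambda>_. borel)) (hit K)" if "K \<in> \<K>" for K
    proof -
      have "(\<lambda>h. h x) \<in> borel_measurable (PiM V (\<lambda>_. borel :: real measure))" if "x \<in> D K" for x
        using that D \<K>(2)[OF \<open>K \<in> \<K>\<close>] by (intro measurable_component_singleton) auto
      then show ?thesis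
        unfolding hit_def using D
        by (intro pred_intros_countable pred_intros_countable_bounded) auto
    qed
    show "cnt \<in> borel_measurable (PiM V (\<lambda>_. borel))"
      unfolding cnt_def
    proof (rule borel_measurable_SUP[OF cQ])
      fix \<P> assume P: "\<P> \<in> \<Q>"
      show "(\<lambda>h. \<Sum>K\<in>\<P>. of_bool (hit K h) :: ennreal) \<in> borel_measurable (PiM V (\<lambda>_. borel))"
      proof (rule borel_measurable_sum)
        fix K assume "K \<in> \<P>"
        then have [measurable]: "Measurable.pred (PiM V (\<lambda>_. borel)) (hit K)"
          using P hit by (auto simp: \<Q>_def)
        show "(\<lambda>h. of_bool (hit K h) :: ennreal) \<in> borel_measurable (PiM V (\<lambda>_. borel))"
          unfolding of_bool_def by measurable
      qed
    qed
    fix h :: "'a \<Rightarrow> real" assume h: "continuous_on V h"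
    have "hit K (restrict h V) \<longleftrightarrow> {x \<in> V. h x = 0} \<inter> K \<noteq> {}" if "K \<in> \<K>" for K
    proof -
      have K: "compact K" "K \<subseteq> V" using \<K>(2) that by auto
      have "hit K (restrict h V) \<longleftrightarrow> hit K h"
        unfolding hit_def using D[of K] K by (metis restrict_apply subsetD)
      also have "\<dots> \<longleftrightarrow> (\<exists>x\<in>K. h x = 0)"
        unfolding hit_def using D[of K] K h
        by (intro exists_zero_iff_dense[symmetric]) (auto intro: continuous_on_subset)
      also have "\<dots> \<longleftrightarrow> {x \<in> V. h x = 0} \<inter> K \<noteq> {}" using K by auto
      finally show ?thesis .
    qed
    then have "cnt (restrict h V) = (SUP \<P>\<in>\<Q>. \<Sum>K\<in>\<P>. of_bool ({x \<in> V. h x = 0} \<inter> K \<noteq> {}))"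
      unfolding cnt_def by (intro SUP_cong sum.cong arg_cong[where f=of_bool] refl) (auto simp: \<Q>_def)
    also have "\<dots> = emeasure (count_space UNIV) {x \<in> V. h x = 0}"
      unfolding \<Q>_def by (intro emeasure_count_eq_SUP[symmetric] \<K>(3)) auto
    finally show "cnt (restrict h V) = emeasure (count_space UNIV) {x \<in> V. h x = 0}" .
  qed
qed

lemma measurable_zero_count:
  fixes G :: "'w \<Rightarrow> 'a::euclidean_space \<Rightarrow> real"
  assumes V: "fsigma V" and meas: "\<And>x. x \<in> V \<Longrightarrow> (\<lambda>w. G w x) \<in> borel_measurable N"
    and cont: "\<And>w. w \<in> space N \<Longrightarrow> continuous_on V (G w)"
  shows "(\<lambda>w. emeasure (count_space UNIV) {x \<in> V. G w x = 0}) \<in> borel_measurable N"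
proof -
  obtain cnt :: "('a \<Rightarrow> real) \<Rightarrow> ennreal"
    where [measurable]: "cnt \<in> borel_measurable (PiM V (\<lambda>_. borel))"
    and cnt: "\<And>h. continuous_on V h \<Longrightarrow> cnt (restrict h V) = emeasure (count_space UNIV) {x \<in> V. h x = 0}"
    using zero_count_functional[OF V] by metis
  have [measurable]: "(\<lambda>w. \<lambda>x\<in>V. G w x) \<in> measurable N (PiM V (\<lambda>_. borel))"
    by (intro measurable_restrict meas)
  have "(\<lambda>w. cnt (\<lambda>x\<in>V. G w x)) \<in> borel_measurable N" by measurable
  then show ?thesis
    by (subst measurable_cong[where g="\<lambda>w. cnt (\<lambda>x\<in>V. G w x)"]) (auto simp: cnt cont)
qed

section \<open>The area formula\<close>

text \<open>The rows are gradients, and the index is moved to the ordered copy so that the value is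
  literally the determinant that the well-ordered area formula produces.\<close>

definition jac_det :: "('m::finite \<Rightarrow> real^'m) \<Rightarrow> real"
  where "jac_det g = det (\<chi> i j. g (uncopy i) $ uncopy j :: real^'m ordered_copy^'m ordered_copy)"

lemma emeasure_count_image:
  assumes "inj_on f S"
  shows "emeasure (count_space UNIV) (f ` S) = emeasure (count_space UNIV) S"
  using assms by (simp add: emeasure_count_space finite_image_iff card_image)

text \<open>\<open>Q\<close> and \<open>R\<close> relabel coordinates between \<open>'m\<close> and
  its ordered copy. Lebesgue measure and the number of preimages do not notice, so the well-ordered
  case carries over. Derivatives are given row by row because \<open>H\<close> will be glued
  together from unrelated components.\<close>

lemma area_formula:
  fixes H :: "real^'m \<Rightarrow> real^'m" and g :: "'m \<Rightarrow> real^'m \<Rightarrow> real^'m"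
  assumes W: "open W" and V: "fsigma V" "V \<subseteq> W"
    and der: "\<And>x l. x \<in> W \<Longrightarrow> ((\<lambda>x. H x $ l) has_derivative (\<lambda>v. g l x \<bullet> v)) (at x)"
    and cont: "\<And>l. continuous_on W (g l)"
    and \<phi>[measurable]: "\<phi> \<in> borel_measurable borel"
  shows "(\<integral>\<^sup>+t. \<phi> t * emeasure (count_space UNIV) {x \<in> V. H x = t} \<partial>lborel)
    = (\<integral>\<^sup>+x. indicator V x * (ennreal \<bar>jac_det (\<lambda>l. g l x)\<bar> * \<phi> (H x)) \<partial>lborel)"
proof -
  define R :: "real^'m ordered_copy \<Rightarrow> real^'m" where "R y = (\<chi> i. y $ Copy i)" for y
  define Q :: "real^'m \<Rightarrow> real^'m ordered_copy" where "Q x = (\<chi> i. x $ uncopy i)" for x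
  have RQ[simp]: "R (Q x) = x" and QR[simp]: "Q (R y) = y" for x y
    by (simp_all add: R_def Q_def vec_eq_iff)
  have linR: "linear R" and linQ: "linear Q"
    by (auto intro!: linearI simp: R_def Q_def vec_eq_iff)
  note derR = linear_imp_has_derivative[OF linR]
  have contR: "continuous_on S R" and contQ: "continuous_on T Q" for S T
    using linR linQ by (auto intro: linear_continuous_on simp: linear_conv_bounded_linear)
  have injQ: "inj Q" by (metis injI RQ)
  define H' where "H' y = Q (H (R y))" for y
  define J where "J y = (\<chi> i j. g (uncopy i) (R y) $ uncopy j)" for y
  have W': "open (R -` W)" using open_vimage[OF W contR] .
  have QV: "Q ` V = R -` V" by (force simp: image_iff)
  have V': "fsigma (R -` V)" "R -` V \<subseteq> R -` W"
    using fsigma_continuous_image[OF V(1) contQ] V(2) unfolding QV by auto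
  have Hc: "continuous_on W H"
  proof -
    have "continuous_on W (\<lambda>x. \<chi> l. H x $ l)"
      using der by (intro continuous_on_vec_lambda)
        (meson continuous_at_imp_continuous_on has_derivative_continuous)
    then show ?thesis by simp
  qed
  have [measurable]: "V \<in> sets borel" "W \<in> sets borel"
    using V W fsigma_borel by auto
  have der': "(H' has_derivative (*v) (J y)) (at y)" if "y \<in> R -` W" for y
  proof -
    have "((\<lambda>y. H' y $ i) has_derivative (\<lambda>v. (J y *v v) $ i)) (at y)" for i
    proof -
      have "((\<lambda>y. H (R y) $ uncopy i) has_derivative (\<lambda>v. g (uncopy i) (R y) \<bullet> R v)) (at y)"
        using has_derivative_compose[OF derR der[of "R y" "uncopy i"], of UNIV] that by simp
      moreover have "g (uncopy i) (R y) \<bullet> R v = (J y *v v) $ i" for v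
      proof -
        have "(\<Sum>j\<in>UNIV. g (uncopy i) (R y) $ uncopy j * v $ j)
          = (\<Sum>j\<in>UNIV. g (uncopy i) (R y) $ j * v $ Copy j)"
          by (subst sum.reindex_bij_betw[OF bij_Copy, symmetric]) simp
        then show ?thesis
          by (simp add: matrix_vector_mult_def J_def R_def inner_vec_def)
      qed
      ultimately show ?thesis by (simp add: H'_def Q_def)
    qed
    then show ?thesis
      by (subst has_derivative_componentwise_within) (auto simp: Basis_vec_def inner_axis)
  qed
  have cont': "continuous_on (R -` W) J"
    unfolding J_def
    by (intro continuous_on_vec_lambda continuous_intros continuous_on_compose2[OF cont contR]) auto
  let ?cnt = "\<lambda>t. emeasure (count_space UNIV) {x \<in> V. H x = t}"
  have cnt_eq: "?cnt (R s) = emeasure (count_space UNIV) {y \<in> R -` V. H' y = s}" for s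
  proof -
    have "{y \<in> R -` V. H' y = s} = Q ` {x \<in> V. H x = R s}"
    proof safe
      fix y assume "R y \<in> V" "s = H' y"
      then show "y \<in> Q ` {x \<in> V. H x = R (H' y)}"
        by (intro image_eqI[of _ _ "R y"]) (auto simp: H'_def)
    qed (auto simp: H'_def)
    then show ?thesis
      using emeasure_count_image[OF inj_on_subset[OF injQ subset_UNIV], of "{x \<in> V. H x = R s}"] by simp
  qed
  have [measurable]: "?cnt \<in> borel_measurable borel"
  proof -
    have "?cnt = (\<lambda>t. emeasure (count_space UNIV) {x \<in> V. norm (H x - t) = 0})" by simp
    also have "\<dots> \<in> borel_measurable borel"
      using continuous_on_subset[OF Hc V(2)]
      by (intro measurable_zero_count V) (auto intro!: continuous_intros)
    finally show ?thesis .
  qed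
  have [measurable]: "R \<in> borel_measurable borel" "Q \<in> borel_measurable borel"
    using contR contQ by (auto intro: borel_measurable_continuous_onI)
  have "(\<integral>\<^sup>+t. \<phi> t * ?cnt t \<partial>lborel) = (\<integral>\<^sup>+s. \<phi> (R s) * ?cnt (R s) \<partial>lborel)"
    unfolding R_def by (rule nn_integral_ordered_copy) measurable
  also have "\<dots> = (\<integral>\<^sup>+y. ennreal (indicator (R -` V) y * \<bar>det (J y)\<bar>) * \<phi> (R (H' y)) \<partial>lborel)"
    unfolding cnt_eq by (rule area_formula_wellorder[OF W' V' der' cont']) auto
  also have "\<dots> = (\<integral>\<^sup>+y. indicator V (R y) * (ennreal \<bar>jac_det (\<lambda>l. g l (R y))\<bar> * \<phi> (H (R y))) \<partial>lborel)"
    by (intro nn_integral_cong) (auto simp: H'_def jac_det_def J_def indicator_def)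
  also have "\<dots> = (\<integral>\<^sup>+x. indicator V x * (ennreal \<bar>jac_det (\<lambda>l. g l x)\<bar> * \<phi> (H x)) \<partial>lborel)"
  proof -
    \<comment> \<open>The gradients and \<open>H\<close> are continuous only on \<open>W\<close>;
      extended by zero they are Borel everywhere, and \<open>indicator V x\<close> hides the
      change.\<close>
    define G where "G l x = (if x \<in> W then g l x else 0)" for l x
    define K where "K x = (if x \<in> W then H x else 0)" for x
    have [measurable]: "G l \<in> borel_measurable borel" "K \<in> borel_measurable borel" for l
      unfolding G_def K_def by (intro borel_measurable_continuous_on_if cont Hc continuous_on_const; simp)+
    have [measurable]: "(\<lambda>x. G l x $ j) \<in> borel_measurable borel" for l j
    proof -
      have "(\<lambda>x. G l x \<bullet> axis j 1) \<in> borel_measurable borel" by measurable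
      then show ?thesis by (simp add: inner_axis)
    qed
    have "(\<lambda>x. indicator V x * (ennreal \<bar>jac_det (\<lambda>l. g l x)\<bar> * \<phi> (H x)))
      = (\<lambda>x. indicator V x * (ennreal \<bar>jac_det (\<lambda>l. G l x)\<bar> * \<phi> (K x)))"
    proof
      fix x
      have "G l x = g l x" "K x = H x" if "x \<in> V" for l
        using that V(2) by (auto simp: G_def K_def)
      then show "indicator V x * (ennreal \<bar>jac_det (\<lambda>l. g l x)\<bar> * \<phi> (H x))
        = indicator V x * (ennreal \<bar>jac_det (\<lambda>l. G l x)\<bar> * \<phi> (K x))"
        by (cases "x \<in> V") auto
    qed
    also have "\<dots> \<in> borel_measurable borel"
      unfolding jac_det_def det_def vec_lambda_beta by measurable
    finally show ?thesis
      unfolding R_def by (rule nn_integral_ordered_copy[symmetric])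
  qed
  finally show ?thesis .
qed

section \<open>Pairs of linear forms in independent Gaussians\<close>

abbreviation std_gauss :: "real measure"
  where "std_gauss \<equiv> density lborel (\<lambda>x. ennreal (std_normal_density x))"

lemma prob_space_std_gauss: "prob_space std_gauss"
  using prob_space_normal_density[of 1 0] by simp

lemma product_sigma_finite_std_gauss: "product_sigma_finite (\<lambda>_. std_gauss)"
  by (intro product_sigma_finite.intro prob_space_imp_sigma_finite prob_space_std_gauss)

lemma pair_sigma_finite_std_gauss: "pair_sigma_finite std_gauss std_gauss"
  by (intro pair_sigma_finite.intro prob_space_imp_sigma_finite prob_space_std_gauss)

lemma std_normal_density_mult:
  "std_normal_density s * std_normal_density t = 1 / (2 * pi) * exp (- (s\<^sup>2 + t\<^sup>2) / 2)"
proof -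
  have "sqrt (2 * pi) * sqrt (2 * pi) = 2 * pi" by simp
  then have "1 / sqrt (2 * pi) * (1 / sqrt (2 * pi)) = 1 / (2 * pi)"
    by (metis mult_1 times_divide_times_eq)
  moreover have "exp (- s\<^sup>2 / 2) * exp (- t\<^sup>2 / 2) = exp (- (s\<^sup>2 + t\<^sup>2) / 2)"
    by (simp add: exp_add[symmetric] add_divide_distrib diff_divide_distrib)
  moreover have "std_normal_density s * std_normal_density t
    = (1 / sqrt (2 * pi) * (1 / sqrt (2 * pi))) * (exp (- s\<^sup>2 / 2) * exp (- t\<^sup>2 / 2))"
    unfolding std_normal_density_def by (simp only: ac_simps)
  ultimately show ?thesis by (simp only:)
qed

lemma nn_integral_std_gauss:
  assumes [measurable]: "f \<in> borel_measurable borel"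
  shows "(\<integral>\<^sup>+x. f x \<partial>std_gauss) = (\<integral>\<^sup>+x. ennreal (std_normal_density x) * f x \<partial>lborel)"
  by (simp add: nn_integral_density)

text \<open>The Gaussian density depends only on s^2 + t^2, so rotation invariance of Lebesgue
  measure in the plane is what remains. It is reduced to affine substitutions in one variable: for
  fixed t replace s by c s - \<sigma> t, then replace t, with factors |c| and 1/|c| that cancel. For
  c = 0 the first substitution degenerates, but then the rotation only swaps the coordinates up to
  sign.\<close>

lemma std_gauss_rotation:
  fixes f :: "real \<Rightarrow> real \<Rightarrow> ennreal"
  assumes cs: "c\<^sup>2 + \<sigma>\<^sup>2 = 1"
    and f[measurable]: "case_prod f \<in> borel_measurable (borel \<Otimes>\<^sub>M borel)"
  shows "(\<integral>\<^sup>+s. \<integral>\<^sup>+t. f (c * s - \<sigma> * t) (\<sigma> * s + c * t) \<partial>std_gauss \<partial>std_gauss)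
    = (\<integral>\<^sup>+s. \<integral>\<^sup>+t. f s t \<partial>std_gauss \<partial>std_gauss)"
proof -
  define F where "F x y = ennreal (std_normal_density x * std_normal_density y) * f x y" for x y
  have F[measurable]: "case_prod F \<in> borel_measurable (borel \<Otimes>\<^sub>M borel)"
    unfolding F_def by measurable
  have sq: "(c * s - \<sigma> * t)\<^sup>2 + (\<sigma> * s + c * t)\<^sup>2 = s\<^sup>2 + t\<^sup>2" for s t
  proof -
    have "(c * s - \<sigma> * t)\<^sup>2 + (\<sigma> * s + c * t)\<^sup>2 = (c\<^sup>2 + \<sigma>\<^sup>2) * (s\<^sup>2 + t\<^sup>2)" by algebra
    then show ?thesis using cs by simp
  qed
  have L: "(\<integral>\<^sup>+s. \<integral>\<^sup>+t. f (c * s - \<sigma> * t) (\<sigma> * s + c * t) \<partial>std_gauss \<partial>std_gauss)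
    = (\<integral>\<^sup>+s. \<integral>\<^sup>+t. F (c * s - \<sigma> * t) (\<sigma> * s + c * t) \<partial>lborel \<partial>lborel)"
    by (simp add: nn_integral_std_gauss F_def std_normal_density_mult sq nn_integral_cmult[symmetric]
        mult.assoc[symmetric] ennreal_mult[symmetric])
  have R: "(\<integral>\<^sup>+s. \<integral>\<^sup>+t. f s t \<partial>std_gauss \<partial>std_gauss) = (\<integral>\<^sup>+s. \<integral>\<^sup>+t. F s t \<partial>lborel \<partial>lborel)"
    by (simp add: nn_integral_std_gauss F_def nn_integral_cmult[symmetric]
        mult.assoc[symmetric] ennreal_mult[symmetric])
  have "(\<integral>\<^sup>+s. \<integral>\<^sup>+t. F (c * s - \<sigma> * t) (\<sigma> * s + c * t) \<partial>lborel \<partial>lborel)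
    = (\<integral>\<^sup>+s. \<integral>\<^sup>+t. F s t \<partial>lborel \<partial>lborel)" (is "?l = ?r")
  proof (cases "c = 0")
    case True
    then have \<sigma>: "\<sigma> \<noteq> 0" "\<bar>\<sigma>\<bar> = 1" using cs by (auto simp: abs_square_eq_1)
    have "?l = (\<integral>\<^sup>+s. \<integral>\<^sup>+x. F x (\<sigma> * s) \<partial>lborel \<partial>lborel)"
    proof (rule nn_integral_cong)
      fix s
      show "(\<integral>\<^sup>+t. F (c * s - \<sigma> * t) (\<sigma> * s + c * t) \<partial>lborel) = (\<integral>\<^sup>+x. F x (\<sigma> * s) \<partial>lborel)"
        using nn_integral_real_affine[of "\<lambda>x. F x (\<sigma> * s)" "- \<sigma>" 0] True \<sigma> by simp
    qed
    also have "\<dots> = (\<integral>\<^sup>+y. \<integral>\<^sup>+x. F x y \<partial>lborel \<partial>lborel)"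
      using nn_integral_real_affine[of "\<lambda>y. \<integral>\<^sup>+x. F x y \<partial>lborel" "\<sigma>" 0] \<sigma> by simp
    also have "\<dots> = ?r" by (rule lborel_pair.Fubini') measurable
    finally show ?thesis .
  next
    case False
    have "\<bar>c\<bar> * ?l = \<bar>c\<bar> * (\<integral>\<^sup>+t. \<integral>\<^sup>+s. F (c * s - \<sigma> * t) (\<sigma> * s + c * t) \<partial>lborel \<partial>lborel)"
      by (subst lborel_pair.Fubini') auto
    also have "\<dots> = (\<integral>\<^sup>+t. \<bar>c\<bar> * (\<integral>\<^sup>+s. F (c * s - \<sigma> * t) (\<sigma> * s + c * t) \<partial>lborel) \<partial>lborel)"
      by (simp add: nn_integral_cmult)
    also have "\<dots> = (\<integral>\<^sup>+t. \<integral>\<^sup>+x. F x (\<sigma> * x / c + t / c) \<partial>lborel \<partial>lborel)"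
    proof (rule nn_integral_cong)
      fix t
      have "\<sigma> * (c * s - \<sigma> * t) / c + t / c = \<sigma> * s + c * t" for s
      proof -
        have "\<sigma> * (c * s - \<sigma> * t) + t = c * (\<sigma> * s + c * t)" using cs by algebra
        then show ?thesis using False by (simp add: field_simps)
      qed
      then show "\<bar>c\<bar> * (\<integral>\<^sup>+s. F (c * s - \<sigma> * t) (\<sigma> * s + c * t) \<partial>lborel)
        = (\<integral>\<^sup>+x. F x (\<sigma> * x / c + t / c) \<partial>lborel)"
        using nn_integral_real_affine[of "\<lambda>x. F x (\<sigma> * x / c + t / c)" c "- \<sigma> * t"] False by simp
    qed
    also have "\<dots> = (\<integral>\<^sup>+x. \<integral>\<^sup>+t. F x (\<sigma> * x / c + t / c) \<partial>lborel \<partial>lborel)"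
      by (rule lborel_pair.Fubini') measurable
    also have "\<dots> = (\<integral>\<^sup>+x. \<bar>c\<bar> * (\<integral>\<^sup>+y. F x y \<partial>lborel) \<partial>lborel)"
    proof (rule nn_integral_cong)
      fix x
      have "(\<integral>\<^sup>+y. F x y \<partial>lborel) = \<bar>1 / c\<bar> * (\<integral>\<^sup>+t. F x (\<sigma> * x / c + t / c) \<partial>lborel)"
        using nn_integral_real_affine[of "\<lambda>y. F x y" "1 / c" "\<sigma> * x / c"] False by simp
      then show "(\<integral>\<^sup>+t. F x (\<sigma> * x / c + t / c) \<partial>lborel) = \<bar>c\<bar> * (\<integral>\<^sup>+y. F x y \<partial>lborel)"
        using False by (simp add: mult.assoc[symmetric] ennreal_mult[symmetric])
    qed
    also have "\<dots> = \<bar>c\<bar> * ?r" by (simp add: nn_integral_cmult)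
    finally show ?thesis using False by (simp add: ennreal_mult_cancel_left)
  qed
  then show ?thesis unfolding L R .
qed

text \<open>A rotation taking the direction of (a, b) to the second axis leaves a function of one
  coordinate; the other one integrates to 1.\<close>

lemma std_gauss_sum2:
  fixes h :: "real \<Rightarrow> ennreal"
  assumes [measurable]: "h \<in> borel_measurable borel"
  shows "(\<integral>\<^sup>+s. \<integral>\<^sup>+t. h (a * s + b * t) \<partial>std_gauss \<partial>std_gauss)
    = (\<integral>\<^sup>+t. h (sqrt (a\<^sup>2 + b\<^sup>2) * t) \<partial>std_gauss)"
proof (cases "a = 0 \<and> b = 0")
  case True
  then show ?thesis using prob_space.emeasure_space_1[OF prob_space_std_gauss] by simp
next
  case False
  define w where "w = sqrt (a\<^sup>2 + b\<^sup>2)"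
  have w: "w \<noteq> 0" "w\<^sup>2 = a\<^sup>2 + b\<^sup>2" using False by (auto simp: w_def add_nonneg_eq_0_iff)
  have "(b / w)\<^sup>2 + (a / w)\<^sup>2 = 1"
    using w False by (simp add: power_divide add_divide_distrib[symmetric] add.commute)
  from std_gauss_rotation[OF this, of "\<lambda>x y. h (w * y)"]
  have "(\<integral>\<^sup>+s. \<integral>\<^sup>+t. h (a * s + b * t) \<partial>std_gauss \<partial>std_gauss)
    = (\<integral>\<^sup>+s. \<integral>\<^sup>+t. h (w * t) \<partial>std_gauss \<partial>std_gauss)"
    using w by (simp add: distrib_left)
  also have "\<dots> = (\<integral>\<^sup>+t. h (w * t) \<partial>std_gauss)"
    using prob_space.emeasure_space_1[OF prob_space_std_gauss] by simp
  finally show ?thesis unfolding w_def .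
qed

text \<open>A rotation taking the direction of (a, b) to the first axis makes the first form depend
  on one coordinate only: a triangular factorisation of the 2 by 2 coefficient matrix. The three
  equations say that the Gram matrix is preserved.\<close>

lemma std_gauss_pair2:
  obtains p q w where "p\<^sup>2 = a\<^sup>2 + b\<^sup>2" "p * q = a * c + b * d" "q\<^sup>2 + w\<^sup>2 = c\<^sup>2 + d\<^sup>2"
    "\<And>f :: real \<Rightarrow> real \<Rightarrow> ennreal. case_prod f \<in> borel_measurable (borel \<Otimes>\<^sub>M borel) \<Longrightarrow>
      (\<integral>\<^sup>+s. \<integral>\<^sup>+t. f (a * s + b * t) (c * s + d * t) \<partial>std_gauss \<partial>std_gauss)
      = (\<integral>\<^sup>+s. \<integral>\<^sup>+t. f (p * s) (q * s + w * t) \<partial>std_gauss \<partial>std_gauss)"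
proof (cases "a = 0 \<and> b = 0")
  case True
  have "(\<integral>\<^sup>+s. \<integral>\<^sup>+t. f (a * s + b * t) (c * s + d * t) \<partial>std_gauss \<partial>std_gauss)
      = (\<integral>\<^sup>+s. \<integral>\<^sup>+t. f (0 * s) (0 * s + sqrt (c\<^sup>2 + d\<^sup>2) * t) \<partial>std_gauss \<partial>std_gauss)"
    if [measurable]: "case_prod f \<in> borel_measurable (borel \<Otimes>\<^sub>M borel)" for f :: "real \<Rightarrow> real \<Rightarrow> ennreal"
    using std_gauss_sum2[of "f 0" c d] True prob_space.emeasure_space_1[OF prob_space_std_gauss] by simp
  with True show ?thesis by (intro that[of 0 0 "sqrt (c\<^sup>2 + d\<^sup>2)"]) auto
next
  case False
  define p where "p = sqrt (a\<^sup>2 + b\<^sup>2)"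
  have p: "p \<noteq> 0" "p\<^sup>2 = a\<^sup>2 + b\<^sup>2" using False by (auto simp: p_def add_nonneg_eq_0_iff)
  define q where "q = (a * c + b * d) / p"
  \<comment> \<open>A rotation preserves the determinant of the coefficient matrix, which is
    \<open>p * w\<close> in triangular form.\<close>
  define w where "w = (a * d - b * c) / p"
  have 1: "(a / p)\<^sup>2 + (- b / p)\<^sup>2 = 1"
    using p False by (simp add: power_divide add_divide_distrib[symmetric])
  have 2: "q\<^sup>2 + w\<^sup>2 = c\<^sup>2 + d\<^sup>2"
  proof -
    have "(a * c + b * d)\<^sup>2 + (a * d - b * c)\<^sup>2 = p\<^sup>2 * (c\<^sup>2 + d\<^sup>2)" unfolding p(2) by algebra
    then show ?thesis
      using p(1) by (simp add: q_def w_def power_divide add_divide_distrib[symmetric])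
  qed
  have lin: "q * (a / p * s - - b / p * t) + w * (- b / p * s + a / p * t) = c * s + d * t" for s t
  proof -
    define A B where "A = a / p" and "B = b / p"
    have "A\<^sup>2 + B\<^sup>2 = 1" using 1 by (simp add: A_def B_def)
    then have "(A * c + B * d) * (A * s + B * t) + (A * d - B * c) * (- B * s + A * t) = c * s + d * t"
      by algebra
    moreover have "q = A * c + B * d" "w = A * d - B * c"
      by (simp_all add: q_def w_def A_def B_def add_divide_distrib diff_divide_distrib)
    ultimately show ?thesis by (simp add: A_def B_def)
  qed
  have "(\<integral>\<^sup>+s. \<integral>\<^sup>+t. f (a * s + b * t) (c * s + d * t) \<partial>std_gauss \<partial>std_gauss)
      = (\<integral>\<^sup>+s. \<integral>\<^sup>+t. f (p * s) (q * s + w * t) \<partial>std_gauss \<partial>std_gauss)"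
    if [measurable]: "case_prod f \<in> borel_measurable (borel \<Otimes>\<^sub>M borel)" for f :: "real \<Rightarrow> real \<Rightarrow> ennreal"
  proof -
    have lin': "p * (a / p * s - - b / p * t) = a * s + b * t" for s t
      using p(1) by (simp add: field_simps)
    have m: "(\<lambda>(x, y). f (p * x) (q * x + w * y)) \<in> borel_measurable (borel \<Otimes>\<^sub>M borel)"
      by measurable
    show ?thesis using std_gauss_rotation[OF 1 m] unfolding lin lin' .
  qed
  with p 2 show ?thesis by (intro that[of p q w]) (auto simp: q_def)
qed

text \<open>The joint law of two linear forms in independent standard Gaussians depends only on the Gram
  matrix of the two forms: it is read off the triangular normal form.\<close>

lemma std_gauss_linear_pair:
  assumes "finite A"
  shows "\<exists>p q r. p\<^sup>2 = (\<Sum>a\<in>A. (u a)\<^sup>2) \<and> p * q = (\<Sum>a\<in>A. u a * v a) \<and> q\<^sup>2 + r\<^sup>2 = (\<Sum>a\<in>A. (v a)\<^sup>2) \<and>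
    (\<forall>f :: real \<Rightarrow> real \<Rightarrow> ennreal. case_prod f \<in> borel_measurable (borel \<Otimes>\<^sub>M borel) \<longrightarrow>
      (\<integral>\<^sup>+z. f (\<Sum>a\<in>A. u a * z a) (\<Sum>a\<in>A. v a * z a) \<partial>PiM A (\<lambda>_. std_gauss))
      = (\<integral>\<^sup>+s. \<integral>\<^sup>+t. f (p * s) (q * s + r * t) \<partial>std_gauss \<partial>std_gauss))"
  using assms
proof (induction A rule: finite_induct)
  case empty
  interpret product_sigma_finite "\<lambda>_. std_gauss" by (rule product_sigma_finite_std_gauss)
  show ?case
    using prob_space.emeasure_space_1[OF prob_space_std_gauss]
    by (intro exI[of _ 0]) (simp add: nn_integral_empty PiM_empty)
next
  case (insert i A)
  interpret product_sigma_finite "\<lambda>_. std_gauss" by (rule product_sigma_finite_std_gauss)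
  interpret sigma_finite_measure std_gauss
    by (intro prob_space_imp_sigma_finite prob_space_std_gauss)
  interpret P: pair_sigma_finite std_gauss std_gauss by (rule pair_sigma_finite_std_gauss)
  obtain p q r where pqr: "p\<^sup>2 = (\<Sum>a\<in>A. (u a)\<^sup>2)" "p * q = (\<Sum>a\<in>A. u a * v a)" "q\<^sup>2 + r\<^sup>2 = (\<Sum>a\<in>A. (v a)\<^sup>2)"
    "\<And>f :: real \<Rightarrow> real \<Rightarrow> ennreal. case_prod f \<in> borel_measurable (borel \<Otimes>\<^sub>M borel) \<Longrightarrow>
      (\<integral>\<^sup>+z. f (\<Sum>a\<in>A. u a * z a) (\<Sum>a\<in>A. v a * z a) \<partial>PiM A (\<lambda>_. std_gauss))
      = (\<integral>\<^sup>+s. \<integral>\<^sup>+t. f (p * s) (q * s + r * t) \<partial>std_gauss \<partial>std_gauss)"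
    using insert.IH by blast
  obtain p' q' w where p': "p'\<^sup>2 = p\<^sup>2 + (u i)\<^sup>2" "p' * q' = p * q + u i * v i" "q'\<^sup>2 + w\<^sup>2 = q\<^sup>2 + (v i)\<^sup>2"
    "\<And>f :: real \<Rightarrow> real \<Rightarrow> ennreal. case_prod f \<in> borel_measurable (borel \<Otimes>\<^sub>M borel) \<Longrightarrow>
      (\<integral>\<^sup>+s. \<integral>\<^sup>+t. f (p * s + u i * t) (q * s + v i * t) \<partial>std_gauss \<partial>std_gauss)
      = (\<integral>\<^sup>+s. \<integral>\<^sup>+t. f (p' * s) (q' * s + w * t) \<partial>std_gauss \<partial>std_gauss)"
    by (rule std_gauss_pair2[of p "u i" q "v i"]) blast
  \<comment> \<open>Absorbing the new coordinate into the first Gaussian leaves two independent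
    contributions of sizes \<open>w\<close> and \<open>r\<close> in the second form; they combine
    into a single one.\<close>
  define r' where "r' = sqrt (w\<^sup>2 + r\<^sup>2)"
  show ?case
  proof (rule exI[of _ p'], rule exI[of _ q'], rule exI[of _ r'], intro conjI allI impI)
    show "p'\<^sup>2 = (\<Sum>a\<in>insert i A. (u a)\<^sup>2)" "p' * q' = (\<Sum>a\<in>insert i A. u a * v a)"
      "q'\<^sup>2 + r'\<^sup>2 = (\<Sum>a\<in>insert i A. (v a)\<^sup>2)"
      using insert.hyps pqr p' by (auto simp: r'_def)
    fix f :: "real \<Rightarrow> real \<Rightarrow> ennreal"
    assume f[measurable]: "case_prod f \<in> borel_measurable (borel \<Otimes>\<^sub>M borel)"
    have "(\<integral>\<^sup>+z. f (\<Sum>a\<in>insert i A. u a * z a) (\<Sum>a\<in>insert i A. v a * z a) \<partial>PiM (insert i A) (\<lambda>_. std_gauss))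
      = (\<integral>\<^sup>+z. \<integral>\<^sup>+y. f (\<Sum>a\<in>insert i A. u a * (z(i := y)) a) (\<Sum>a\<in>insert i A. v a * (z(i := y)) a)
          \<partial>std_gauss \<partial>PiM A (\<lambda>_. std_gauss))"
      by (rule product_nn_integral_insert[OF insert.hyps]) measurable
    also have "\<dots> = (\<integral>\<^sup>+z. \<integral>\<^sup>+y. f ((\<Sum>a\<in>A. u a * z a) + u i * y) ((\<Sum>a\<in>A. v a * z a) + v i * y)
          \<partial>std_gauss \<partial>PiM A (\<lambda>_. std_gauss))"
    proof -
      have eq: "(\<Sum>a\<in>insert i A. c a * (z(i := y)) a) = (\<Sum>a\<in>A. c a * z a) + c i * y" for c z y
      proof -
        have "(\<Sum>a\<in>A. c a * (z(i := y)) a) = (\<Sum>a\<in>A. c a * z a)"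
          using insert.hyps by (intro sum.cong) auto
        then show ?thesis using insert.hyps by (simp add: add.commute)
      qed
      show ?thesis by (intro nn_integral_cong arg_cong2[where f=f] eq)
    qed
    also have "\<dots> = (\<integral>\<^sup>+s. \<integral>\<^sup>+t. \<integral>\<^sup>+y. f (p * s + u i * y) (q * s + r * t + v i * y) \<partial>std_gauss \<partial>std_gauss \<partial>std_gauss)"
      by (rule pqr(4)[of "\<lambda>x x'. \<integral>\<^sup>+y. f (x + u i * y) (x' + v i * y) \<partial>std_gauss"]) measurable
    also have "\<dots> = (\<integral>\<^sup>+s. \<integral>\<^sup>+y. \<integral>\<^sup>+t. f (p * s + u i * y) (q * s + v i * y + r * t) \<partial>std_gauss \<partial>std_gauss \<partial>std_gauss)"
      by (subst P.Fubini'[symmetric]) (auto simp: ac_simps)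
    also have "\<dots> = (\<integral>\<^sup>+s. \<integral>\<^sup>+y. \<integral>\<^sup>+t. f (p' * s) (q' * s + w * y + r * t) \<partial>std_gauss \<partial>std_gauss \<partial>std_gauss)"
      by (rule p'(4)[of "\<lambda>x y. \<integral>\<^sup>+t. f x (y + r * t) \<partial>std_gauss"]) measurable
    also have "\<dots> = (\<integral>\<^sup>+s. \<integral>\<^sup>+t. f (p' * s) (q' * s + r' * t) \<partial>std_gauss \<partial>std_gauss)"
    proof (rule nn_integral_cong)
      fix s
      show "(\<integral>\<^sup>+y. \<integral>\<^sup>+t. f (p' * s) (q' * s + w * y + r * t) \<partial>std_gauss \<partial>std_gauss)
        = (\<integral>\<^sup>+t. f (p' * s) (q' * s + r' * t) \<partial>std_gauss)"
        using std_gauss_sum2[of "\<lambda>x. f (p' * s) (q' * s + x)" w r] by (simp add: r'_def add.assoc)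
    qed
    finally show "(\<integral>\<^sup>+z. f (\<Sum>a\<in>insert i A. u a * z a) (\<Sum>a\<in>insert i A. v a * z a) \<partial>PiM (insert i A) (\<lambda>_. std_gauss))
      = (\<integral>\<^sup>+s. \<integral>\<^sup>+t. f (p' * s) (q' * s + r' * t) \<partial>std_gauss \<partial>std_gauss)" .
  qed
qed

text \<open>The standard Gaussian density at 0 times the mean modulus of a standard Gaussian,
  numerically sqrt (2/pi) / sqrt (2 pi) = 1/pi. The same factor occurs for every exponential
  sum.\<close>

definition kac_rice_const :: ennreal
  where "kac_rice_const = ennreal (1 / sqrt (2 * pi)) * (\<integral>\<^sup>+t. ennreal \<bar>t\<bar> \<partial>std_gauss)"

text \<open>The density factor conditions one further standard Gaussian y on being equal to the form
  \<open>u\<close>. The difference of the two has variance 1 + U, and given that it vanishes the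
  form \<open>v\<close> has variance V - C^2/(1 + U); density at 0 times conditional standard
  deviation gives the right side. The radicand is the Gram determinant of the coefficient vectors
  (1, -u) and (0, v).\<close>

lemma std_gauss_hyperplane:
  fixes u v :: "'b \<Rightarrow> real"
  assumes "finite A"
  defines "U \<equiv> \<Sum>a\<in>A. (u a)\<^sup>2" and "V \<equiv> \<Sum>a\<in>A. (v a)\<^sup>2" and "C \<equiv> \<Sum>a\<in>A. u a * v a"
  shows "(\<integral>\<^sup>+z. ennreal \<bar>\<Sum>a\<in>A. v a * z a\<bar> * ennreal (std_normal_density (\<Sum>a\<in>A. u a * z a)) \<partial>PiM A (\<lambda>_. std_gauss))
    = kac_rice_const * ennreal (sqrt ((1 + U) * V - C\<^sup>2) / (1 + U))"
proof -
  obtain p q r where pqr: "p\<^sup>2 = U" "p * q = C" "q\<^sup>2 + r\<^sup>2 = V"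
    "\<And>f :: real \<Rightarrow> real \<Rightarrow> ennreal. case_prod f \<in> borel_measurable (borel \<Otimes>\<^sub>M borel) \<Longrightarrow>
      (\<integral>\<^sup>+z. f (\<Sum>a\<in>A. u a * z a) (\<Sum>a\<in>A. v a * z a) \<partial>PiM A (\<lambda>_. std_gauss))
      = (\<integral>\<^sup>+s. \<integral>\<^sup>+t. f (p * s) (q * s + r * t) \<partial>std_gauss \<partial>std_gauss)"
    using std_gauss_linear_pair[OF assms(1), of u v] unfolding U_def V_def C_def by blast
  \<comment> \<open>The product of the densities at \<open>s\<close> and \<open>p * s\<close> is a
    multiple of the density at \<open>b * s\<close>, so rescaling by \<open>b\<close> restores a
    standard Gaussian at the price of a factor \<open>1 / b\<close>.\<close>
  define b where "b = sqrt (1 + p\<^sup>2)"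
  have b: "b > 0" "b\<^sup>2 = 1 + p\<^sup>2" by (auto simp: b_def add_pos_nonneg)
  have dens: "std_normal_density s * std_normal_density (p * s) = 1 / sqrt (2 * pi) * std_normal_density (b * s)" for s
  proof -
    have "s\<^sup>2 + (p * s)\<^sup>2 = (b * s)\<^sup>2" using b by (simp add: power_mult_distrib algebra_simps)
    then show ?thesis
      unfolding std_normal_density_mult std_normal_density_def[of "b * s"]
      by (simp add: real_sqrt_mult_self power2_eq_square[symmetric])
  qed
  interpret sigma_finite_measure std_gauss
    by (intro prob_space_imp_sigma_finite prob_space_std_gauss)
  define G where "G x = (\<integral>\<^sup>+t. ennreal \<bar>x + r * t\<bar> \<partial>std_gauss)" for x
  have G[measurable]: "G \<in> borel_measurable borel"
    unfolding G_def by measurable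
  have "(\<integral>\<^sup>+z. ennreal \<bar>\<Sum>a\<in>A. v a * z a\<bar> * ennreal (std_normal_density (\<Sum>a\<in>A. u a * z a)) \<partial>PiM A (\<lambda>_. std_gauss))
    = (\<integral>\<^sup>+s. \<integral>\<^sup>+t. ennreal \<bar>q * s + r * t\<bar> * ennreal (std_normal_density (p * s)) \<partial>std_gauss \<partial>std_gauss)"
    by (rule pqr(4)[of "\<lambda>x y. ennreal \<bar>y\<bar> * ennreal (std_normal_density x)"]) measurable
  also have "\<dots> = (\<integral>\<^sup>+s. G (q * s) * ennreal (std_normal_density (p * s)) \<partial>std_gauss)"
    by (simp add: G_def nn_integral_multc)
  also have "\<dots> = (\<integral>\<^sup>+s. ennreal (1 / sqrt (2 * pi)) * (ennreal (std_normal_density (b * s)) * G (q * s)) \<partial>lborel)"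
  proof (subst nn_integral_std_gauss)
    show "(\<integral>\<^sup>+s. ennreal (std_normal_density s) * (G (q * s) * ennreal (std_normal_density (p * s))) \<partial>lborel)
      = (\<integral>\<^sup>+s. ennreal (1 / sqrt (2 * pi)) * (ennreal (std_normal_density (b * s)) * G (q * s)) \<partial>lborel)"
    proof (intro nn_integral_cong)
      fix s
      have "ennreal (std_normal_density s) * (G (q * s) * ennreal (std_normal_density (p * s)))
        = ennreal (std_normal_density s * std_normal_density (p * s)) * G (q * s)"
        by (simp add: ennreal_mult ac_simps)
      also have "\<dots> = ennreal (1 / sqrt (2 * pi)) * (ennreal (std_normal_density (b * s)) * G (q * s))"
        unfolding dens by (subst ennreal_mult) (auto simp: ac_simps)
      finally show "ennreal (std_normal_density s) * (G (q * s) * ennreal (std_normal_density (p * s)))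
        = ennreal (1 / sqrt (2 * pi)) * (ennreal (std_normal_density (b * s)) * G (q * s))" .
    qed
  qed measurable
  also have "\<dots> = ennreal (1 / sqrt (2 * pi)) * (\<integral>\<^sup>+s. ennreal (std_normal_density (b * s)) * G (q * s) \<partial>lborel)"
    by (rule nn_integral_cmult) measurable
  also have "(\<integral>\<^sup>+s. ennreal (std_normal_density (b * s)) * G (q * s) \<partial>lborel)
    = ennreal (1 / b) * (\<integral>\<^sup>+x. G (q / b * x) \<partial>std_gauss)"
  proof -
    have "(\<integral>\<^sup>+x. G (q / b * x) \<partial>std_gauss) = ennreal b * (\<integral>\<^sup>+s. ennreal (std_normal_density (b * s)) * G (q * s) \<partial>lborel)"
      using nn_integral_real_affine[of "\<lambda>x. ennreal (std_normal_density x) * G (q / b * x)" b 0] b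
      by (simp add: nn_integral_std_gauss)
    then show ?thesis
      using b by (simp add: mult.assoc[symmetric] ennreal_mult[symmetric])
  qed
  also have "(\<integral>\<^sup>+x. G (q / b * x) \<partial>std_gauss) = (\<integral>\<^sup>+t. ennreal \<bar>sqrt ((q / b)\<^sup>2 + r\<^sup>2) * t\<bar> \<partial>std_gauss)"
    unfolding G_def by (rule std_gauss_sum2[of "\<lambda>x. ennreal \<bar>x\<bar>"]) measurable
  also have "\<dots> = ennreal (sqrt ((q / b)\<^sup>2 + r\<^sup>2)) * (\<integral>\<^sup>+t. ennreal \<bar>t\<bar> \<partial>std_gauss)"
    by (subst nn_integral_cmult[symmetric]) (auto simp: abs_mult ennreal_mult)
  finally have eq: "(\<integral>\<^sup>+z. ennreal \<bar>\<Sum>a\<in>A. v a * z a\<bar> * ennreal (std_normal_density (\<Sum>a\<in>A. u a * z a)) \<partial>PiM A (\<lambda>_. std_gauss))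
    = kac_rice_const * (ennreal (1 / b) * ennreal (sqrt ((q / b)\<^sup>2 + r\<^sup>2)))"
    by (simp add: kac_rice_const_def ac_simps)
  have "1 / b * sqrt ((q / b)\<^sup>2 + r\<^sup>2) = sqrt (q\<^sup>2 + r\<^sup>2 * b\<^sup>2) / b\<^sup>2"
  proof -
    have "(q / b)\<^sup>2 + r\<^sup>2 = (q\<^sup>2 + r\<^sup>2 * b\<^sup>2) / b\<^sup>2"
      using b(1) by (simp add: power_divide add_divide_distrib)
    then have "sqrt ((q / b)\<^sup>2 + r\<^sup>2) = sqrt (q\<^sup>2 + r\<^sup>2 * b\<^sup>2) / b"
      using b(1) by (simp add: real_sqrt_divide)
    then show ?thesis by (simp add: power2_eq_square)
  qed
  also have "q\<^sup>2 + r\<^sup>2 * b\<^sup>2 = (1 + U) * V - C\<^sup>2"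
    unfolding b(2) pqr(1-3)[symmetric] by algebra
  also have "b\<^sup>2 = 1 + U" using b pqr by simp
  finally show ?thesis
    unfolding eq using b by (subst ennreal_mult[symmetric]) auto
qed

section \<open>Weights and variances of exponential sums\<close>

definition weighted_variance :: "'b set \<Rightarrow> ('b \<Rightarrow> real) \<Rightarrow> ('b \<Rightarrow> real) \<Rightarrow> real"
  where "weighted_variance A w f
    = (\<Sum>a\<in>A. w a * (f a)\<^sup>2) / (\<Sum>a\<in>A. w a) - ((\<Sum>a\<in>A. w a * f a) / (\<Sum>a\<in>A. w a))\<^sup>2"

text \<open>A variance does not change under recentring. With \<open>b\<close> the value of
  \<open>f\<close> at one support point, that point drops out of the two sums involving
  \<open>f\<close>, and the numerator becomes the Gram determinant left by integrating over the
  other coefficients.\<close>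

lemma weighted_variance_shift:
  assumes "(\<Sum>a\<in>A. w a) \<noteq> 0"
  shows "weighted_variance A w f = ((\<Sum>a\<in>A. w a) * (\<Sum>a\<in>A. w a * (f a - b)\<^sup>2)
    - (\<Sum>a\<in>A. w a * (f a - b))\<^sup>2) / (\<Sum>a\<in>A. w a)\<^sup>2"
proof -
  define S0 S1 S2 where "S0 = (\<Sum>a\<in>A. w a)" and "S1 = (\<Sum>a\<in>A. w a * f a)"
    and "S2 = (\<Sum>a\<in>A. w a * (f a)\<^sup>2)"
  have "(\<Sum>a\<in>A. w a * (f a - b)\<^sup>2) = S2 - 2 * b * S1 + b\<^sup>2 * S0"
  proof -
    have "(\<Sum>a\<in>A. w a * (f a - b)\<^sup>2) = (\<Sum>a\<in>A. w a * (f a)\<^sup>2 - 2 * b * (w a * f a) + b\<^sup>2 * w a)"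
      by (intro sum.cong refl) (simp add: power2_diff algebra_simps)
    then show ?thesis
      by (simp add: S0_def S1_def S2_def sum.distrib sum_subtractf sum_distrib_left)
  qed
  moreover have "(\<Sum>a\<in>A. w a * (f a - b)) = S1 - b * S0"
    by (simp add: S0_def S1_def sum_subtractf sum_distrib_left algebra_simps)
  moreover have "S0 * (S2 - 2 * b * S1 + b\<^sup>2 * S0) - (S1 - b * S0)\<^sup>2 = S0 * S2 - S1\<^sup>2" by algebra
  moreover have "(S0 * S2 - S1\<^sup>2) / S0\<^sup>2 = S2 / S0 - (S1 / S0)\<^sup>2"
    using assms by (simp add: S0_def diff_divide_distrib power_divide power2_eq_square)
  ultimately show ?thesis
    by (simp add: weighted_variance_def flip: S0_def S1_def S2_def)
qed

lemma weighted_variance_scale: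
  assumes "c \<noteq> 0"
  shows "weighted_variance A (\<lambda>a. c * w a) f = weighted_variance A w f"
  using assms by (simp add: weighted_variance_def mult.assoc flip: sum_distrib_left)

definition exp_weight :: "'a::euclidean_space exp_data \<Rightarrow> 'a \<Rightarrow> 'a \<Rightarrow> real"
  where "exp_weight p x a = (snd p a)\<^sup>2 * exp (2 * (a \<bullet> x))"

definition exp_variance :: "'a::euclidean_space exp_data \<Rightarrow> 'a \<Rightarrow> ('a \<Rightarrow> real) \<Rightarrow> real"
  where "exp_variance p x = weighted_variance (fst p) (exp_weight p x)"

definition positive_data :: "'a exp_data \<Rightarrow> bool"
  where "positive_data p \<longleftrightarrow> finite (fst p) \<and> fst p \<noteq> {} \<and> (\<forall>a\<in>fst p. 0 < snd p a)"

text \<open>Squaring removes the root from the product coefficients and the exponential turns sums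
  into products, so the weights of the product are the image of the product weights under addition.
  The test function delivers all moments at once.\<close>

lemma aronszajn_mult_sum:
  assumes "finite (fst p)" "finite (fst q)"
  shows "(\<Sum>c\<in>fst (aronszajn_mult p q). exp_weight (aronszajn_mult p q) x c * f c)
    = (\<Sum>a\<in>fst p. \<Sum>b\<in>fst q. exp_weight p x a * exp_weight q x b * f (a + b))"
proof -
  let ?S = "fst p \<times> fst q"
  have S: "finite ?S" using assms by simp
  have supp: "fst (aronszajn_mult p q) = (\<lambda>(a, b). a + b) ` ?S"
    by (auto simp: aronszajn_mult_def)
  have w: "exp_weight (aronszajn_mult p q) x c * f c
    = (\<Sum>(a, b)\<in>{z \<in> ?S. (case z of (a, b) \<Rightarrow> a + b) = c}. exp_weight p x a * exp_weight q x b * f (a + b))" for c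
  proof -
    have set: "{z \<in> ?S. (case z of (a, b) \<Rightarrow> a + b) = c} = {(a, b). a \<in> fst p \<and> b \<in> fst q \<and> a + b = c}"
      by auto
    have "0 \<le> (\<Sum>(a, b)\<in>{(a, b). a \<in> fst p \<and> b \<in> fst q \<and> a + b = c}. (snd p a)\<^sup>2 * (snd q b)\<^sup>2)"
      by (intro sum_nonneg) auto
    then have "exp_weight (aronszajn_mult p q) x c * f c
      = (\<Sum>(a, b)\<in>{(a, b). a \<in> fst p \<and> b \<in> fst q \<and> a + b = c}. (snd p a)\<^sup>2 * (snd q b)\<^sup>2) * (exp (2 * (c \<bullet> x)) * f c)"
      by (simp add: exp_weight_def aronszajn_mult_def mult.assoc)
    also have "\<dots> = (\<Sum>(a, b)\<in>{(a, b). a \<in> fst p \<and> b \<in> fst q \<and> a + b = c}. exp_weight p x a * exp_weight q x b * f (a + b))"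
      unfolding sum_distrib_right
      by (intro sum.cong refl)
         (auto simp: exp_weight_def inner_add_left distrib_left exp_add)
    finally show ?thesis unfolding set .
  qed
  have "(\<Sum>c\<in>fst (aronszajn_mult p q). exp_weight (aronszajn_mult p q) x c * f c)
    = (\<Sum>(a, b)\<in>?S. exp_weight p x a * exp_weight q x b * f (a + b))"
    unfolding supp w by (rule sum.image_gen[OF S, symmetric])
  then show ?thesis by (simp add: sum.cartesian_product)
qed

lemma positive_data_aronszajn_mult:
  assumes "positive_data p" "positive_data q"
  shows "positive_data (aronszajn_mult p q)"
proof -
  have supp: "fst (aronszajn_mult p q) = (\<lambda>(a, b). a + b) ` (fst p \<times> fst q)"
    by (auto simp: aronszajn_mult_def)
  have "0 < snd (aronszajn_mult p q) c" if c: "c \<in> fst (aronszajn_mult p q)" for c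
  proof -
    let ?T = "{(a, b). a \<in> fst p \<and> b \<in> fst q \<and> a + b = c}"
    have "?T \<subseteq> fst p \<times> fst q" by auto
    then have "finite ?T"
      using assms finite_subset[of ?T "fst p \<times> fst q"] by (auto simp: positive_data_def)
    moreover have "?T \<noteq> {}" using c unfolding supp by auto
    ultimately have "0 < (\<Sum>(a, b)\<in>?T. (snd p a)\<^sup>2 * (snd q b)\<^sup>2)"
      using assms by (intro sum_pos) (auto simp: positive_data_def intro!: mult_pos_pos)
    then show ?thesis by (simp add: aronszajn_mult_def)
  qed
  moreover have "finite (fst (aronszajn_mult p q))" "fst (aronszajn_mult p q) \<noteq> {}"
    using assms unfolding supp positive_data_def by auto
  ultimately show ?thesis by (simp add: positive_data_def)
qed

lemma exp_weight_sum_pos: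
  assumes "positive_data p"
  shows "0 < (\<Sum>a\<in>fst p. exp_weight p x a)"
  using assms by (intro sum_pos) (auto simp: positive_data_def exp_weight_def)

text \<open>The squared coefficients of the product, tilted by \<open>exp (2 \<langle>a, x\<rangle>)\<close>, are a convolution, and
  the variance of a sum of independent variables is additive.\<close>

lemma exp_variance_aronszajn_mult:
  assumes p: "positive_data p" and q: "positive_data q" and f: "linear f"
  shows "exp_variance (aronszajn_mult p q) x f = exp_variance p x f + exp_variance q x f"
proof -
  have fin: "finite (fst p)" "finite (fst q)" using p q by (auto simp: positive_data_def)
  note sums = aronszajn_mult_sum[OF fin, of x]
  define P0 P1 P2 Q0 Q1 Q2 where
    "P0 = (\<Sum>a\<in>fst p. exp_weight p x a)" and "P1 = (\<Sum>a\<in>fst p. exp_weight p x a * f a)"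
    and "P2 = (\<Sum>a\<in>fst p. exp_weight p x a * (f a)\<^sup>2)"
    and "Q0 = (\<Sum>a\<in>fst q. exp_weight q x a)" and "Q1 = (\<Sum>a\<in>fst q. exp_weight q x a * f a)"
    and "Q2 = (\<Sum>a\<in>fst q. exp_weight q x a * (f a)\<^sup>2)"
  let ?pq = "aronszajn_mult p q"
  have 0: "(\<Sum>c\<in>fst ?pq. exp_weight ?pq x c) = P0 * Q0"
    using sums[of "\<lambda>_. 1"] by (simp add: P0_def Q0_def sum_product)
  have 1: "(\<Sum>c\<in>fst ?pq. exp_weight ?pq x c * f c) = P1 * Q0 + P0 * Q1"
    unfolding sums P0_def Q0_def P1_def Q1_def sum_product linear_add[OF f]
    by (simp add: distrib_left sum.distrib mult_ac)
  \<comment> \<open>The cross term \<open>2 * P1 * Q1\<close> reflects independence of the two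
    summands; it is matched by the cross term in the square of the mean.\<close>
  have 2: "(\<Sum>c\<in>fst ?pq. exp_weight ?pq x c * (f c)\<^sup>2) = P2 * Q0 + 2 * P1 * Q1 + P0 * Q2"
  proof -
    have "(\<Sum>c\<in>fst ?pq. exp_weight ?pq x c * (f c)\<^sup>2)
      = (\<Sum>a\<in>fst p. \<Sum>b\<in>fst q. (exp_weight p x a * (f a)\<^sup>2) * exp_weight q x b
          + 2 * ((exp_weight p x a * f a) * (exp_weight q x b * f b))
          + exp_weight p x a * (exp_weight q x b * (f b)\<^sup>2))"
      unfolding sums by (intro sum.cong refl) (simp add: linear_add[OF f] power2_sum algebra_simps)
    also have "\<dots> = P2 * Q0 + 2 * (P1 * Q1) + P0 * Q2"
      unfolding P0_def Q0_def P1_def Q1_def P2_def Q2_def sum_product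
      by (simp add: sum.distrib sum_distrib_left)
    finally show ?thesis by simp
  qed
  have "P0 \<noteq> 0" "Q0 \<noteq> 0"
    using exp_weight_sum_pos[OF p, of x] exp_weight_sum_pos[OF q, of x] by (auto simp: P0_def Q0_def)
  then have "(P2 * Q0 + 2 * P1 * Q1 + P0 * Q2) / (P0 * Q0) - ((P1 * Q0 + P0 * Q1) / (P0 * Q0))\<^sup>2
    = P2 / P0 - (P1 / P0)\<^sup>2 + (Q2 / Q0 - (Q1 / Q0)\<^sup>2)"
  proof -
    have "(P2 * Q0 + 2 * P1 * Q1 + P0 * Q2) / (P0 * Q0) = P2 / P0 + 2 * (P1 / P0) * (Q1 / Q0) + Q2 / Q0"
      using \<open>P0 \<noteq> 0\<close> \<open>Q0 \<noteq> 0\<close> by (simp add: add_divide_distrib)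
    moreover have "(P1 * Q0 + P0 * Q1) / (P0 * Q0) = P1 / P0 + Q1 / Q0"
      using \<open>P0 \<noteq> 0\<close> \<open>Q0 \<noteq> 0\<close> by (simp add: add_divide_distrib)
    ultimately show ?thesis by algebra
  qed
  then show ?thesis
    unfolding exp_variance_def weighted_variance_def 0 1 2
    by (simp only: P0_def P1_def P2_def Q0_def Q1_def Q2_def)
qed

lemma aronszajn_power_variance:
  assumes p: "positive_data p" and "0 < d"
  shows "positive_data (aronszajn_power p d)
    \<and> (\<forall>x f. linear f \<longrightarrow> exp_variance (aronszajn_power p d) x f = real d * exp_variance p x f)"
proof -
  \<comment> \<open>Starting from \<open>p\<close>, \<open>n\<close> multiplications give n + 1
    copies; hence \<open>Suc n\<close> here and the instance \<open>d - 1\<close> below.\<close>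
  have "positive_data (((\<lambda>q. aronszajn_mult q p) ^^ n) p)
    \<and> (\<forall>x f. linear f \<longrightarrow> exp_variance (((\<lambda>q. aronszajn_mult q p) ^^ n) p) x f = real (Suc n) * exp_variance p x f)" for n
    using p by (induction n)
      (auto simp: positive_data_aronszajn_mult exp_variance_aronszajn_mult algebra_simps)
  from this[of "d - 1"] show ?thesis using \<open>0 < d\<close> by (simp add: aronszajn_power_def)
qed

section \<open>Integrating out the Gaussian coefficients\<close>

text \<open>A determinant is linear in each row. Row \<open>k\<close> is reserved for the
  exponential sum and the other rows come from the field, so this map is the linear form whose
  variance is taken.\<close>

lemma jac_det_linear:
  fixes g :: "'m::finite \<Rightarrow> real^'m"
  shows "linear (\<lambda>y. jac_det (g(k := y)))"
proof -
  let ?r = "\<lambda>y :: real^'m. \<chi> j. y $ uncopy j :: real^'m ordered_copy"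
  have eq: "jac_det (g(k := y)) = det (\<chi> i. if i = Copy k then ?r y else ?r (g (uncopy i)))" for y
  proof -
    have "(\<chi> i j. (g(k := y)) (uncopy i) $ uncopy j :: real^'m ordered_copy^'m ordered_copy)
      = (\<chi> i. if i = Copy k then ?r y else ?r (g (uncopy i)))"
      by (auto simp: vec_eq_iff)
    then show ?thesis by (simp add: jac_det_def)
  qed
  have "?r (x + y) = ?r x + ?r y" "?r (c *\<^sub>R x) = c *s ?r x" for x y c
    by (simp_all add: vec_eq_iff)
  then show ?thesis
    unfolding eq by (intro linearI) (simp_all only: det_row_add det_row_mul real_scaleR_def)
qed

lemma nn_integral_lborel_split:
  fixes f :: "real^'m \<Rightarrow> ennreal"
  assumes [measurable]: "f \<in> borel_measurable borel"
  shows "(\<integral>\<^sup>+y. \<integral>\<^sup>+s. f (\<chi> l. if l = k then y else s l) \<partial>PiM (- {k}) (\<lambda>_. lborel) \<partial>lborel) = (\<integral>\<^sup>+t. f t \<partial>lborel)"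
proof -
  interpret product_sigma_finite "\<lambda>_. lborel :: real measure" ..
  have vec[measurable]: "(\<lambda>s. \<chi> i. s i) \<in> borel_measurable (PiM (UNIV :: 'm set) (\<lambda>_. lborel :: real measure))"
    by (rule borel_measurable_euclidean_space[THEN iffD2]) (auto simp: Basis_vec_def inner_axis)
  have U: "insert k (- {k}) = UNIV" by auto
  have "(\<integral>\<^sup>+t. f t \<partial>lborel) = (\<integral>\<^sup>+s. f (\<chi> l. s l) \<partial>PiM (insert k (- {k})) (\<lambda>_. lborel))"
    unfolding U by (rule nn_integral_lborel_vec) simp
  also have "\<dots> = (\<integral>\<^sup>+y. \<integral>\<^sup>+s. f (\<chi> l. (s(k := y)) l) \<partial>PiM (- {k}) (\<lambda>_. lborel) \<partial>lborel)"
    by (rule product_nn_integral_insert_rev) (simp_all add: U)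
  finally show ?thesis by (simp add: fun_upd_def)
qed

text \<open>With the other Gaussian coefficients fixed, each \<open>x\<close> is a zero for exactly
  one choice of the free coefficient and of \<open>s\<close>. The zeros are thus fibres of a map,
  and the area formula turns their weighted count into an integral over \<open>x\<close>. Its
  Jacobian is a linear form in the fixed coefficients, so the hyperplane integral applies at each
  \<open>x\<close>, while \<open>w\<close> depends on \<open>x\<close> alone.\<close>

lemma gaussian_slice:
  fixes p :: "(real^'m) exp_data" and C :: "'m \<Rightarrow> real^'m \<Rightarrow> real"
    and g :: "'m \<Rightarrow> real^'m \<Rightarrow> real^'m" and k :: 'm and w :: "('m \<Rightarrow> real) \<Rightarrow> ennreal"
  assumes p: "positive_data p"
    and W: "open W" and V: "fsigma V" "V \<subseteq> W"
    and der: "\<And>l x. l \<noteq> k \<Longrightarrow> x \<in> W \<Longrightarrow> (C l has_derivative (\<lambda>v. g l x \<bullet> v)) (at x)"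
    and cont: "\<And>l. l \<noteq> k \<Longrightarrow> continuous_on W (g l)"
    and w[measurable]: "w \<in> borel_measurable (PiM (- {k}) (\<lambda>_. lborel))"
  shows "(\<integral>\<^sup>+z. \<integral>\<^sup>+s. w s * emeasure (count_space UNIV) {x \<in> V. exp_sum p z x = 0 \<and> (\<forall>l\<in>- {k}. s l = C l x)}
      \<partial>PiM (- {k}) (\<lambda>_. lborel) \<partial>PiM (fst p) (\<lambda>_. std_gauss))
    = (\<integral>\<^sup>+x. indicator V x * (w (\<lambda>l\<in>- {k}. C l x) *
        (kac_rice_const * ennreal (sqrt (exp_variance p x (\<lambda>y. jac_det ((\<lambda>l. g l x)(k := y))))))) \<partial>lborel)"
proof -
  let ?L = "PiM (- {k}) (\<lambda>_. lborel :: real measure)"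
  obtain a0 where a0: "a0 \<in> fst p" using p by (auto simp: positive_data_def)
  define A where "A = fst p - {a0}"
  have A: "finite A" "a0 \<notin> A" "fst p = insert a0 A"
    using p a0 by (auto simp: A_def positive_data_def)
  have \<alpha>0: "snd p a0 > 0" using p a0 by (simp add: positive_data_def)
  interpret L: product_sigma_finite "\<lambda>_. lborel :: real measure" ..
  interpret Lf: finite_product_sigma_finite "\<lambda>_. lborel :: real measure" "- {k}" by standard simp
  interpret G: product_sigma_finite "\<lambda>_. std_gauss" by (rule product_sigma_finite_std_gauss)
  interpret Gf: finite_product_sigma_finite "\<lambda>_. std_gauss" A by standard (rule A)
  have [measurable]: "V \<in> sets borel" using V(1) by (rule fsigma_borel)
  \<comment> \<open>Normalised so that the exponential sum equals
    \<open>snd p a0 * exp (a0 \<bullet> x) * (z a0 - h z x)\<close>; in particular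
    \<open>u a0 x = - 1\<close>.\<close>
  define u where "u a x = - (snd p a / snd p a0) * exp ((a - a0) \<bullet> x)" for a x
  define h where "h z x = (\<Sum>a\<in>A. u a x * z a)" for z x
  \<comment> \<open>This is the gradient of \<open>h z\<close> at \<open>x\<close>, since
    \<open>u a\<close> has gradient \<open>u a x *\<^sub>R (a - a0)\<close>.\<close>
  define gh where "gh z x = (\<Sum>a\<in>A. (u a x * z a) *\<^sub>R (a - a0))" for z and x :: "real^'m"
  define F where "F x = (\<lambda>y. jac_det ((\<lambda>l. g l x)(k := y)))" for x
  have linF: "linear (F x)" for x unfolding F_def by (rule jac_det_linear)
  define v where "v a x = u a x * F x (a - a0)" for a x
  have u_cont[continuous_intros]: "continuous_on S (u a)" for S a
    unfolding u_def by (intro continuous_intros)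
  have C_cont: "continuous_on V (C l)" if "l \<noteq> k" for l
    using der[OF that] V(2) by (meson continuous_at_imp_continuous_on has_derivative_continuous subsetD)
  have zero_iff: "exp_sum p z x = 0 \<longleftrightarrow> z a0 = h z x" for z x
  proof -
    have "exp_sum p z x = snd p a0 * exp (a0 \<bullet> x) * (z a0 - h z x)"
    proof -
      have "snd p a * z a * exp (a \<bullet> x) = - (snd p a0 * exp (a0 \<bullet> x) * (u a x * z a))" for a
        using \<alpha>0 by (simp add: u_def inner_diff_left exp_diff)
      moreover have "u a0 x = - 1" using \<alpha>0 by (simp add: u_def)
      ultimately show ?thesis
        using A by (simp add: exp_sum_def h_def right_diff_distrib sum_distrib_left sum_negf)
    qed
    then show ?thesis using \<alpha>0 by simp
  qed
  have h_upd: "h (z(a0 := y)) x = h z x" for z y x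
    unfolding h_def using A by (intro sum.cong) auto
  define cnt where "cnt z s = emeasure (count_space UNIV) {x \<in> V. exp_sum p z x = 0 \<and> (\<forall>l\<in>- {k}. s l = C l x)}" for z s
  have cnt_meas[measurable]: "case_prod cnt \<in> borel_measurable (PiM (insert a0 A) (\<lambda>_. std_gauss) \<Otimes>\<^sub>M ?L)"
  proof -
    have eq: "case_prod cnt = (\<lambda>zs. emeasure (count_space UNIV)
      {x \<in> V. \<bar>exp_sum p (fst zs) x\<bar> + (\<Sum>l\<in>- {k}. \<bar>snd zs l - C l x\<bar>) = 0})"
      by (auto simp: cnt_def fun_eq_iff add_nonneg_eq_0_iff sum_nonneg sum_nonneg_eq_0_iff intro!: arg_cong[where f="emeasure _"])
    show ?thesis
      unfolding eq
    proof (rule measurable_zero_count[OF V(1)])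
      fix zs :: "(real^'m \<Rightarrow> real) \<times> ('m \<Rightarrow> real)"
      show "continuous_on V (\<lambda>x. \<bar>exp_sum p (fst zs) x\<bar> + (\<Sum>l\<in>- {k}. \<bar>snd zs l - C l x\<bar>))"
        unfolding exp_sum_def using C_cont by (intro continuous_intros) auto
    next
      fix x
      show "(\<lambda>zs. \<bar>exp_sum p (fst zs) x\<bar> + (\<Sum>l\<in>- {k}. \<bar>snd zs l - C l x\<bar>))
        \<in> borel_measurable (PiM (insert a0 A) (\<lambda>_. std_gauss) \<Otimes>\<^sub>M ?L)"
        unfolding exp_sum_def A(3) by measurable
    qed
  qed
  \<comment> \<open>\<open>H z\<close> sends a point to the unique free coefficient (in slot
    \<open>k\<close>) and free field coordinates for which the point is a zero.\<close>
  define H where "H z x = (\<chi> l. if l = k then h z x else C l x)" for z x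
  have area: "(\<integral>\<^sup>+y. \<integral>\<^sup>+s. w s * cnt (z(a0 := y)) s \<partial>?L \<partial>std_gauss)
    = (\<integral>\<^sup>+x. indicator V x * (ennreal \<bar>\<Sum>a\<in>A. v a x * z a\<bar> *
        (ennreal (std_normal_density (\<Sum>a\<in>A. u a x * z a)) * w (\<lambda>l\<in>- {k}. C l x))) \<partial>lborel)"
    if z: "z \<in> space (PiM A (\<lambda>_. std_gauss))" for z
  proof -
    define \<phi> where "\<phi> t = ennreal (std_normal_density (t $ k)) * w (\<lambda>l\<in>- {k}. t $ l)" for t :: "real^'m"
    have [measurable]: "(\<lambda>t. t $ l) \<in> borel_measurable (borel :: (real^'m) measure)" for l
      by (intro borel_measurable_continuous_onI continuous_intros)
    have \<phi>[measurable]: "\<phi> \<in> borel_measurable borel" unfolding \<phi>_def by measurable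
    have Hder: "((\<lambda>x. H z x $ l) has_derivative (\<lambda>y. (if l = k then gh z x else g l x) \<bullet> y)) (at x)"
      if "x \<in> W" for x l
    proof (cases "l = k")
      case True
      have "(h z has_derivative (\<lambda>y. gh z x \<bullet> y)) (at x)"
        unfolding h_def gh_def u_def
        using \<alpha>0 by (auto intro!: derivative_eq_intros simp: fun_eq_iff inner_sum_left mult_ac intro!: sum.cong)
      then show ?thesis using True by (simp add: H_def)
    qed (use der[OF _ that] in \<open>simp add: H_def\<close>)
    have Hcont: "continuous_on W (\<lambda>x. if l = k then gh z x else g l x)" for l
      using cont[of l] by (cases "l = k") (auto simp: gh_def intro!: continuous_intros)
    have Hc: "continuous_on V (H z)"
      unfolding H_def
    proof (rule continuous_on_vec_lambda)
      fix l
      show "continuous_on V (\<lambda>x. if l = k then h z x else C l x)"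
        using C_cont[of l] by (cases "l = k") (auto simp: h_def intro!: continuous_intros)
    qed
    let ?N = "\<lambda>t. emeasure (count_space UNIV) {x \<in> V. H z x = t}"
    have [measurable]: "?N \<in> borel_measurable borel"
    proof -
      have "?N = (\<lambda>t. emeasure (count_space UNIV) {x \<in> V. norm (H z x - t) = 0})" by simp
      also have "\<dots> \<in> borel_measurable borel"
        using Hc by (intro measurable_zero_count V) (auto intro!: continuous_intros)
      finally show ?thesis .
    qed
    have [measurable]: "(\<lambda>y. \<integral>\<^sup>+s. w s * cnt (z(a0 := y)) s \<partial>?L) \<in> borel_measurable borel"
    proof -
      have [measurable]: "(\<lambda>y. z(a0 := y)) \<in> measurable borel (PiM (insert a0 A) (\<lambda>_. std_gauss))"
        using measurable_component_update[OF z A(2)] by simp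
      show ?thesis by measurable
    qed
    have slice: "ennreal (std_normal_density y) * (w s * cnt (z(a0 := y)) s)
      = \<phi> (\<chi> l. if l = k then y else s l) * ?N (\<chi> l. if l = k then y else s l)"
      if "s \<in> space ?L" for y s
    proof -
      have "(\<lambda>l\<in>- {k}. (\<chi> l. if l = k then y else s l) $ l) = s"
        using that by (auto simp: space_PiM PiE_def extensional_def fun_eq_iff)
      moreover have "{x \<in> V. exp_sum p (z(a0 := y)) x = 0 \<and> (\<forall>l\<in>- {k}. s l = C l x)}
        = {x \<in> V. H z x = (\<chi> l. if l = k then y else s l)}"
      proof -
        have "H z x = (\<chi> l. if l = k then y else s l) \<longleftrightarrow> y = h z x \<and> (\<forall>l\<in>- {k}. s l = C l x)" for x
        proof
          assume "H z x = (\<chi> l. if l = k then y else s l)"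
          then have *: "(if i = k then h z x else C i x) = (if i = k then y else s i)" for i
            by (simp add: H_def vec_eq_iff)
          show "y = h z x \<and> (\<forall>l\<in>- {k}. s l = C l x)"
          proof (intro conjI ballI)
            show "y = h z x" using *[of k] by simp
            show "s l = C l x" if "l \<in> - {k}" for l using *[of l] that by simp
          qed
        qed (auto simp: H_def vec_eq_iff)
        then show ?thesis by (simp add: zero_iff h_upd)
      qed
      ultimately show ?thesis by (simp add: \<phi>_def cnt_def mult.assoc)
    qed
    have "(\<integral>\<^sup>+y. \<integral>\<^sup>+s. w s * cnt (z(a0 := y)) s \<partial>?L \<partial>std_gauss)
      = (\<integral>\<^sup>+y. ennreal (std_normal_density y) * (\<integral>\<^sup>+s. w s * cnt (z(a0 := y)) s \<partial>?L) \<partial>lborel)"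
      by (rule nn_integral_std_gauss) measurable
    also have "\<dots> = (\<integral>\<^sup>+y. \<integral>\<^sup>+s. ennreal (std_normal_density y) * (w s * cnt (z(a0 := y)) s) \<partial>?L \<partial>lborel)"
    proof (intro nn_integral_cong nn_integral_cmult[symmetric])
      fix y
      have "z(a0 := y) \<in> space (PiM (insert a0 A) (\<lambda>_. std_gauss))"
        using z by (auto simp: space_PiM PiE_def extensional_def)
      then have [measurable]: "cnt (z(a0 := y)) \<in> borel_measurable ?L"
        using measurable_Pair2[OF cnt_meas] by simp
      show "(\<lambda>s. w s * cnt (z(a0 := y)) s) \<in> borel_measurable ?L" by measurable
    qed
    also have "\<dots> = (\<integral>\<^sup>+y. \<integral>\<^sup>+s. \<phi> (\<chi> l. if l = k then y else s l) * ?N (\<chi> l. if l = k then y else s l) \<partial>?L \<partial>lborel)"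
      by (intro nn_integral_cong slice)
    also have "\<dots> = (\<integral>\<^sup>+t. \<phi> t * ?N t \<partial>lborel)"
      by (rule nn_integral_lborel_split) measurable
    also have "\<dots> = (\<integral>\<^sup>+x. indicator V x * (ennreal \<bar>jac_det (\<lambda>l. if l = k then gh z x else g l x)\<bar> * \<phi> (H z x)) \<partial>lborel)"
      by (rule area_formula[OF W V Hder Hcont \<phi>])
    also have "\<dots> = (\<integral>\<^sup>+x. indicator V x * (ennreal \<bar>\<Sum>a\<in>A. v a x * z a\<bar> *
        (ennreal (std_normal_density (\<Sum>a\<in>A. u a x * z a)) * w (\<lambda>l\<in>- {k}. C l x))) \<partial>lborel)"
    proof (rule nn_integral_cong)
      fix x
      have "jac_det (\<lambda>l. if l = k then gh z x else g l x) = F x (gh z x)"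
        by (simp add: F_def fun_upd_def)
      also have "\<dots> = (\<Sum>a\<in>A. v a x * z a)"
        using linF[of x] by (simp add: gh_def linear_sum linear_cmul v_def mult_ac)
      finally show "indicator V x * (ennreal \<bar>jac_det (\<lambda>l. if l = k then gh z x else g l x)\<bar> * \<phi> (H z x))
        = indicator V x * (ennreal \<bar>\<Sum>a\<in>A. v a x * z a\<bar> *
        (ennreal (std_normal_density (\<Sum>a\<in>A. u a x * z a)) * w (\<lambda>l\<in>- {k}. C l x)))"
        by (simp add: \<phi>_def H_def h_def cong: restrict_cong)
    qed
    finally show ?thesis .
  qed
  \<comment> \<open>Exchanging the integrals requires joint measurability on the whole space, but
    \<open>C\<close> and \<open>g\<close> are controlled only on \<open>W\<close>; hence the cut-off
    versions \<open>Cw\<close> and \<open>v'\<close>.\<close>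
  define Cw where "Cw x = w (\<lambda>l\<in>- {k}. if x \<in> V then C l x else 0)" for x
  have [measurable]: "Cw \<in> borel_measurable borel"
  proof -
    have "(\<lambda>x. if x \<in> V then C l x else 0) \<in> measurable borel lborel" if "l \<in> - {k}" for l
      unfolding measurable_lborel1 using that by (intro borel_measurable_continuous_on_if C_cont continuous_on_const) auto
    then show ?thesis
      unfolding Cw_def by (intro measurable_compose[OF measurable_restrict w])
  qed
  define v' where "v' a x = (if x \<in> V then v a x else 0)" for a x
  have [measurable]: "v' a \<in> borel_measurable borel" for a
  proof -
    define G where "G l x = (if x \<in> V then ((\<lambda>l. g l x)(k := a - a0)) l else 0)" for l x
    have "continuous_on V (\<lambda>x. ((\<lambda>l. g l x)(k := a - a0)) l)" for l
      using continuous_on_subset[OF cont V(2), of l] by (cases "l = k") simp_all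
    then have "G l \<in> borel_measurable borel" for l
      unfolding G_def by (intro borel_measurable_continuous_on_if continuous_on_const) auto
    then have "(\<lambda>x. G l x \<bullet> axis j 1) \<in> borel_measurable borel" for l j by measurable
    then have [measurable]: "(\<lambda>x. G l x $ j) \<in> borel_measurable borel" for l j
      by (simp add: inner_axis)
    have [measurable]: "u a \<in> borel_measurable borel"
      by (intro borel_measurable_continuous_onI u_cont)
    have "v' a = (\<lambda>x. if x \<in> V then u a x * jac_det (\<lambda>l. G l x) else 0)"
      by (auto simp: v'_def v_def F_def G_def fun_eq_iff fun_upd_def)
    also have "\<dots> \<in> borel_measurable borel"
      unfolding jac_det_def det_def vec_lambda_beta by measurable
    finally show ?thesis .
  qed
  have [measurable]: "u a \<in> borel_measurable borel" for a
    by (intro borel_measurable_continuous_onI u_cont)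
  let ?K = "\<lambda>z x. indicator V x * (ennreal \<bar>\<Sum>a\<in>A. v' a x * z a\<bar> *
    (ennreal (std_normal_density (\<Sum>a\<in>A. u a x * z a)) * Cw x))"
  have "(\<integral>\<^sup>+z. \<integral>\<^sup>+s. w s * cnt z s \<partial>?L \<partial>PiM (fst p) (\<lambda>_. std_gauss))
    = (\<integral>\<^sup>+z. \<integral>\<^sup>+y. \<integral>\<^sup>+s. w s * cnt (z(a0 := y)) s \<partial>?L \<partial>std_gauss \<partial>PiM A (\<lambda>_. std_gauss))"
    unfolding A(3) by (rule G.product_nn_integral_insert[OF A(1,2)]) measurable
  also have "\<dots> = (\<integral>\<^sup>+z. \<integral>\<^sup>+x. ?K z x \<partial>lborel \<partial>PiM A (\<lambda>_. std_gauss))"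
    by (intro nn_integral_cong) (auto simp: area Cw_def v'_def indicator_def intro!: nn_integral_cong)
  also have "\<dots> = (\<integral>\<^sup>+x. \<integral>\<^sup>+z. ?K z x \<partial>PiM A (\<lambda>_. std_gauss) \<partial>lborel)"
  proof -
    interpret P: pair_sigma_finite "PiM A (\<lambda>_. std_gauss)" "lborel :: (real^'m) measure" ..
    show ?thesis by (rule P.Fubini'[symmetric]) measurable
  qed
  also have "\<dots> = (\<integral>\<^sup>+x. indicator V x * (w (\<lambda>l\<in>- {k}. C l x) *
        (kac_rice_const * ennreal (sqrt (exp_variance p x (F x))))) \<partial>lborel)"
  proof (rule nn_integral_cong)
    fix x
    show "(\<integral>\<^sup>+z. ?K z x \<partial>PiM A (\<lambda>_. std_gauss)) = indicator V x * (w (\<lambda>l\<in>- {k}. C l x) *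
        (kac_rice_const * ennreal (sqrt (exp_variance p x (F x)))))"
    proof (cases "x \<in> V")
      case False
      then show ?thesis by simp
    next
      case True
      define r where "r a = (u a x)\<^sup>2" for a
      define U where "U = (\<Sum>a\<in>A. (u a x)\<^sup>2)"
      have f0: "F x (a - a0) = F x a - F x a0" for a using linF by (rule linear_diff)
      \<comment> \<open>Relative to the weight at \<open>a0\<close>, the weights are the squares
        \<open>(u a x)\<^sup>2\<close>, with value 1 at \<open>a0\<close>. A common factor does not
        affect the variance, and the total becomes the \<open>1 + U\<close> of the hyperplane
        integral.\<close>
      have rw: "exp_weight p x = (\<lambda>a. exp_weight p x a0 * r a)"
      proof
        fix a
        have "exp (2 * (a \<bullet> x)) = exp (2 * (a0 \<bullet> x)) * (exp ((a - a0) \<bullet> x))\<^sup>2"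
          by (simp add: exp_double[symmetric] exp_add[symmetric] inner_diff_left algebra_simps)
        then show "exp_weight p x a = exp_weight p x a0 * r a"
          using \<alpha>0 by (simp add: exp_weight_def r_def u_def power_mult_distrib power_divide)
      qed
      have r0: "r a0 = 1" using \<alpha>0 by (simp add: r_def u_def)
      have S0: "(\<Sum>a\<in>fst p. r a) = 1 + U"
        using A r0 by (simp add: U_def r_def)
      have "U \<ge> 0" unfolding U_def by (intro sum_nonneg) auto
      have S1: "(\<Sum>a\<in>fst p. r a * (F x a - F x a0)) = (\<Sum>a\<in>A. u a x * v a x)"
        using A by (simp add: v_def f0 r_def power2_eq_square mult.assoc)
      have S2: "(\<Sum>a\<in>fst p. r a * (F x a - F x a0)\<^sup>2) = (\<Sum>a\<in>A. (v a x)\<^sup>2)"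
        using A by (simp add: v_def f0 r_def power_mult_distrib)
      have "exp_variance p x (F x) = weighted_variance (fst p) r (F x)"
        unfolding exp_variance_def
        by (subst rw, rule weighted_variance_scale) (use \<alpha>0 in \<open>simp add: exp_weight_def\<close>)
      also have "\<dots> = ((1 + U) * (\<Sum>a\<in>A. (v a x)\<^sup>2) - (\<Sum>a\<in>A. u a x * v a x)\<^sup>2) / (1 + U)\<^sup>2"
        using weighted_variance_shift[where A="fst p" and w=r and f="F x" and b="F x a0"] \<open>U \<ge> 0\<close>
        unfolding S0 S1 S2 by simp
      finally have var: "sqrt (exp_variance p x (F x))
        = sqrt ((1 + U) * (\<Sum>a\<in>A. (v a x)\<^sup>2) - (\<Sum>a\<in>A. u a x * v a x)\<^sup>2) / (1 + U)"
        using \<open>U \<ge> 0\<close> by (simp add: real_sqrt_divide)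
      have "(\<integral>\<^sup>+z. ?K z x \<partial>PiM A (\<lambda>_. std_gauss))
        = (\<integral>\<^sup>+z. ennreal \<bar>\<Sum>a\<in>A. v a x * z a\<bar> * ennreal (std_normal_density (\<Sum>a\<in>A. u a x * z a))
            * w (\<lambda>l\<in>- {k}. C l x) \<partial>PiM A (\<lambda>_. std_gauss))"
        using True by (intro nn_integral_cong) (simp add: v'_def Cw_def mult.assoc)
      also have "\<dots> = (\<integral>\<^sup>+z. ennreal \<bar>\<Sum>a\<in>A. v a x * z a\<bar> * ennreal (std_normal_density (\<Sum>a\<in>A. u a x * z a))
            \<partial>PiM A (\<lambda>_. std_gauss)) * w (\<lambda>l\<in>- {k}. C l x)"
        by (rule nn_integral_multc) measurable
      finally show ?thesis
        unfolding std_gauss_hyperplane[OF A(1)] U_def[symmetric] var[symmetric]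
        using True by (simp add: mult_ac)
    qed
  qed
  finally show ?thesis unfolding cnt_def F_def .
qed

section \<open>Eliminating coordinates of the field\<close>

definition C1_on :: "(real^'m) set \<Rightarrow> (real^'m \<Rightarrow> real) \<Rightarrow> bool"
  where "C1_on W f \<longleftrightarrow>
    (\<exists>g. continuous_on W g \<and> (\<forall>x\<in>W. (f has_derivative (\<lambda>v. g x \<bullet> v)) (at x)))"

lemma C1_on_continuous: "C1_on W f \<Longrightarrow> continuous_on W f"
  unfolding C1_on_def by (meson continuous_at_imp_continuous_on has_derivative_continuous)

lemma C1_on_const: "C1_on W (\<lambda>_. c)"
  unfolding C1_on_def
  by (rule exI[of _ "\<lambda>_. 0"])
     (auto intro!: has_derivative_eq_rhs[OF has_derivative_const] simp: fun_eq_iff)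

lemma C1_on_add:
  assumes "C1_on W f" "C1_on W g"
  shows "C1_on W (\<lambda>x. f x + g x)"
proof -
  obtain f' g' where *: "continuous_on W f'" "continuous_on W g'"
    "\<And>x. x \<in> W \<Longrightarrow> (f has_derivative (\<lambda>v. f' x \<bullet> v)) (at x)"
    "\<And>x. x \<in> W \<Longrightarrow> (g has_derivative (\<lambda>v. g' x \<bullet> v)) (at x)"
    using assms unfolding C1_on_def by blast
  have "((\<lambda>x. f x + g x) has_derivative (\<lambda>v. (f' x + g' x) \<bullet> v)) (at x)" if "x \<in> W" for x
    by (rule has_derivative_eq_rhs[OF has_derivative_add[OF *(3,4)[OF that]]])
       (simp add: fun_eq_iff inner_add_left)
  then show ?thesis
    unfolding C1_on_def using *
    by (intro exI[of _ "\<lambda>x. f' x + g' x"] conjI continuous_on_add) auto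
qed

lemma C1_on_mult:
  assumes "C1_on W f" "C1_on W g"
  shows "C1_on W (\<lambda>x. f x * g x)"
proof -
  obtain f' g' where *: "continuous_on W f'" "continuous_on W g'"
    "\<And>x. x \<in> W \<Longrightarrow> (f has_derivative (\<lambda>v. f' x \<bullet> v)) (at x)"
    "\<And>x. x \<in> W \<Longrightarrow> (g has_derivative (\<lambda>v. g' x \<bullet> v)) (at x)"
    using assms unfolding C1_on_def by blast
  have "((\<lambda>x. f x * g x) has_derivative (\<lambda>v. (f x *\<^sub>R g' x + g x *\<^sub>R f' x) \<bullet> v)) (at x)" if "x \<in> W" for x
    by (rule has_derivative_eq_rhs[OF has_derivative_mult[OF *(3,4)[OF that]]])
       (simp add: fun_eq_iff inner_add_left mult.commute)
  then show ?thesis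
    unfolding C1_on_def
    by (intro exI[of _ "\<lambda>x. f x *\<^sub>R g' x + g x *\<^sub>R f' x"] conjI continuous_intros * C1_on_continuous assms) auto
qed

lemma C1_on_inverse:
  assumes "C1_on W f" "\<And>x. x \<in> W \<Longrightarrow> f x \<noteq> 0"
  shows "C1_on W (\<lambda>x. inverse (f x))"
proof -
  obtain f' where *: "continuous_on W f'"
    "\<And>x. x \<in> W \<Longrightarrow> (f has_derivative (\<lambda>v. f' x \<bullet> v)) (at x)"
    using assms unfolding C1_on_def by blast
  have "((\<lambda>x. inverse (f x)) has_derivative (\<lambda>v. (- (inverse (f x))\<^sup>2 *\<^sub>R f' x) \<bullet> v)) (at x)" if "x \<in> W" for x
    by (rule has_derivative_eq_rhs[OF Deriv.has_derivative_inverse[OF assms(2)[OF that] *(2)[OF that]]])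
       (simp add: fun_eq_iff power2_eq_square mult_ac)
  then have "\<forall>x\<in>W. ((\<lambda>x. inverse (f x)) has_derivative (\<lambda>v. (- (inverse (f x))\<^sup>2 *\<^sub>R f' x) \<bullet> v)) (at x)"
    by (rule ballI)
  moreover have "continuous_on W (\<lambda>x. - (inverse (f x))\<^sup>2 *\<^sub>R f' x)"
    using assms by (intro continuous_intros * C1_on_continuous) auto
  ultimately show ?thesis unfolding C1_on_def by blast
qed

lemma C1_on_sum: "(\<And>i. i \<in> I \<Longrightarrow> C1_on W (f i)) \<Longrightarrow> C1_on W (\<lambda>x. \<Sum>i\<in>I. f i x)"
  by (induction I rule: infinite_finite_induct) (auto intro: C1_on_const C1_on_add)

lemma C1_on_prod: "(\<And>i. i \<in> I \<Longrightarrow> C1_on W (f i)) \<Longrightarrow> C1_on W (\<lambda>x. \<Prod>i\<in>I. f i x)"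
  by (induction I rule: infinite_finite_induct) (auto intro: C1_on_const C1_on_mult)

lemma C1_on_det:
  fixes A :: "real^'m \<Rightarrow> real^'n^'n"
  assumes "\<And>i j. C1_on W (\<lambda>x. A x $ i $ j)"
  shows "C1_on W (\<lambda>x. det (A x))"
  unfolding det_def by (intro C1_on_sum C1_on_mult C1_on_const C1_on_prod assms)

text \<open>The gradient is assembled from the partial derivatives, which \<open>C_k\<close> at
  order 1 makes continuous.\<close>

lemma C1_on_C_infinity:
  fixes f :: "(real^'m) field"
  assumes "f \<in> C_infinity k" "i < k"
  shows "C1_on W (\<lambda>x. f x i)"
proof -
  let ?f = "\<lambda>x. f x i"
  have "C_k (Suc 0) ?f" using assms unfolding C_infinity_def by blast
  then have d: "?f differentiable_on UNIV"
    and c: "\<And>b. b \<in> Basis \<Longrightarrow> continuous_on UNIV (\<lambda>x. frechet_derivative ?f (at x) b)"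
    unfolding C_k.simps by blast+
  have "(?f has_derivative (\<lambda>v. (\<Sum>b\<in>Basis. frechet_derivative ?f (at x) b *\<^sub>R b) \<bullet> v)) (at x)" for x
  proof -
    have D: "(?f has_derivative frechet_derivative ?f (at x)) (at x)"
      using d by (simp add: differentiable_on_def frechet_derivative_works)
    have lin: "linear (frechet_derivative ?f (at x))"
      using D by (rule has_derivative_linear)
    have "frechet_derivative ?f (at x) v = (\<Sum>b\<in>Basis. frechet_derivative ?f (at x) b *\<^sub>R b) \<bullet> v" for v
    proof -
      have "frechet_derivative ?f (at x) v = frechet_derivative ?f (at x) (\<Sum>b\<in>Basis. (v \<bullet> b) *\<^sub>R b)"
        by (simp add: euclidean_representation)
      also have "\<dots> = (\<Sum>b\<in>Basis. (v \<bullet> b) * frechet_derivative ?f (at x) b)"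
        using lin by (simp add: linear_sum linear_cmul)
      finally show ?thesis by (simp add: inner_sum_left inner_sum_right inner_commute mult.commute)
    qed
    then have "frechet_derivative ?f (at x) = (\<lambda>v. (\<Sum>b\<in>Basis. frechet_derivative ?f (at x) b *\<^sub>R b) \<bullet> v)"
      by (rule ext)
    then show ?thesis using D by simp
  qed
  moreover have "continuous_on W (\<lambda>x. \<Sum>b\<in>Basis. frechet_derivative ?f (at x) b *\<^sub>R b)"
    by (intro continuous_intros continuous_on_subset[OF c]) auto
  ultimately show ?thesis unfolding C1_on_def by blast
qed

text \<open>A positive finite factor can be undone: one inequality comes from the simple functions
  below the integrand, the other from the same inequality with \<open>1 / c\<close>. So
  \<open>f\<close> may be any function. This matters later, when gradients are chosen separately for
  each frozen coordinate vector, with no control on how the choice varies.\<close>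

lemma nn_integral_cmult_real:
  assumes "0 < c"
  shows "(\<integral>\<^sup>+x. ennreal c * f x \<partial>M) = ennreal c * (\<integral>\<^sup>+x. f x \<partial>M)"
proof -
  have le: "(\<integral>\<^sup>+x. ennreal c * f x \<partial>M) \<le> ennreal c * (\<integral>\<^sup>+x. f x \<partial>M)" if "0 < c" for c f
  proof -
    have inv: "ennreal c * (ennreal (1 / c) * y) = y" "ennreal (1 / c) * (ennreal c * y) = y" for y
      using that by (simp_all add: mult.assoc[symmetric] ennreal_mult[symmetric])
    show ?thesis
      unfolding nn_integral_def[of _ "\<lambda>x. ennreal c * f x"]
    proof (rule SUP_least)
      fix g assume "g \<in> {g. simple_function M g \<and> g \<le> (\<lambda>x. ennreal c * f x)}"
      then have g[measurable]: "simple_function M g" and gf: "\<And>x. g x \<le> ennreal c * f x"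
        by (auto simp: le_fun_def)
      have g': "g \<in> borel_measurable M" using g by (rule borel_measurable_simple_function)
      have "integral\<^sup>S M g = (\<integral>\<^sup>+x. g x \<partial>M)" using g by (simp add: nn_integral_eq_simple_integral)
      also have "\<dots> = (\<integral>\<^sup>+x. ennreal c * (ennreal (1 / c) * g x) \<partial>M)" by (simp add: inv)
      also have "\<dots> = ennreal c * (\<integral>\<^sup>+x. ennreal (1 / c) * g x \<partial>M)"
        using g' by (intro nn_integral_cmult) measurable
      also have "\<dots> \<le> ennreal c * (\<integral>\<^sup>+x. f x \<partial>M)"
      proof (intro mult_left_mono nn_integral_mono)
        fix x
        show "ennreal (1 / c) * g x \<le> f x"
          using mult_left_mono[OF gf[of x], of "ennreal (1 / c)"] by (simp add: inv)
      qed simp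
      finally show "integral\<^sup>S M g \<le> ennreal c * (\<integral>\<^sup>+x. f x \<partial>M)" .
    qed
  qed
  have inv: "ennreal c * (ennreal (1 / c) * y) = y" "ennreal (1 / c) * (ennreal c * y) = y" for y
    using assms by (simp_all add: mult.assoc[symmetric] ennreal_mult[symmetric])
  have "(\<integral>\<^sup>+x. f x \<partial>M) \<le> ennreal (1 / c) * (\<integral>\<^sup>+x. ennreal c * f x \<partial>M)"
    using le[of "1 / c" "\<lambda>x. ennreal c * f x"] assms by (simp add: inv)
  from mult_left_mono[OF this, of "ennreal c"]
  have "ennreal c * (\<integral>\<^sup>+x. f x \<partial>M) \<le> (\<integral>\<^sup>+x. ennreal c * f x \<partial>M)"
    by (simp add: inv)
  with le[OF assms] show ?thesis by (rule antisym)
qed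

text \<open>\<open>e\<close> lists a spanning family for the field. The index type \<open>'m\<close>
  has one element more than the field has components: \<open>k\<close> is set aside for the
  exponential sum, and \<open>\<beta>\<close> matches the remaining indices with the m - 1
  components. For m = 1 both of these sets are empty.\<close>

locale evaluation_basis =
  fixes e :: "nat \<Rightarrow> (real^'m) field" and n :: nat and k :: 'm and \<beta> :: "'m \<Rightarrow> nat"
  assumes bij: "bij_betw \<beta> (- {k}) {..<CARD('m) - 1}"
    and smooth: "j < n \<Longrightarrow> e j \<in> C_infinity (CARD('m) - 1)"
    and surj: "y \<in> Rk (CARD('m) - 1) \<Longrightarrow> \<exists>f\<in>span (e ` {..<n}). f x = y"
begin

text \<open>The (m - 1) by (m - 1) minor of the evaluation at \<open>x\<close> whose columns are the
  selected fields, bordered by a unit row and column at \<open>k\<close>. The border leaves the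
  determinant unchanged and keeps the matrix on the index type \<open>'m\<close>, also for m =
  1.\<close>

definition minor_mat :: "('m \<Rightarrow> nat) \<Rightarrow> real^'m \<Rightarrow> real^'m^'m"
  where "minor_mat \<iota> x = (\<chi> i l. if l = k then (if i = k then 1 else 0)
    else if i = k then 0 else e (\<iota> l) x (\<beta> i))"

definition minor_set :: "('m \<Rightarrow> nat) \<Rightarrow> (real^'m) set"
  where "minor_set \<iota> = {x. inj_on \<iota> (- {k}) \<and> \<iota> ` (- {k}) \<subseteq> {..<n} \<and> det (minor_mat \<iota> x) \<noteq> 0}"

lemma \<beta>_less: "l \<noteq> k \<Longrightarrow> \<beta> l < CARD('m) - 1"
  using bij by (auto simp: bij_betw_def)

lemma C1_entry: "j < n \<Longrightarrow> l \<noteq> k \<Longrightarrow> C1_on W (\<lambda>x. e j x (\<beta> l))"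
  using C1_on_C_infinity[OF smooth \<beta>_less] .

lemma C1_minor_mat:
  assumes "\<iota> ` (- {k}) \<subseteq> {..<n}"
  shows "C1_on W (\<lambda>x. minor_mat \<iota> x $ i $ j)"
  using assms by (cases "i = k"; cases "j = k") (auto simp: minor_mat_def intro!: C1_on_const C1_entry)

lemma open_minor_set: "open (minor_set \<iota>)"
proof (cases "inj_on \<iota> (- {k}) \<and> \<iota> ` (- {k}) \<subseteq> {..<n}")
  case True
  then have "continuous_on UNIV (\<lambda>x. det (minor_mat \<iota> x))"
    by (intro C1_on_continuous C1_on_det C1_minor_mat) auto
  then have "open ((\<lambda>x. det (minor_mat \<iota> x)) -` (- {0}))"
    by (intro open_vimage) auto
  also have "(\<lambda>x. det (minor_mat \<iota> x)) -` (- {0}) = minor_set \<iota>"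
    using True by (auto simp: minor_set_def)
  finally show ?thesis .
next
  case False
  then have "minor_set \<iota> = {}" by (auto simp: minor_set_def)
  then show ?thesis by simp
qed

text \<open>Surjectivity of the evaluation means that the columns \<open>T (e j)\<close> span the
  hyperplane orthogonal to \<open>axis k 1\<close>. Extending \<open>axis k 1\<close> by some of
  them to a basis selects m - 1 independent columns, hence a nonzero minor.\<close>

lemma minor_set_cover: "\<exists>\<iota>. x \<in> minor_set \<iota>"
proof -
  define T :: "(real^'m) field \<Rightarrow> real^'m" where "T f = (\<chi> i. if i = k then 0 else f x (\<beta> i))" for f
  have linT: "linear T"
    by (rule linearI) (auto simp: T_def vec_eq_iff plus_fun_def scaleR_fun_def)
  let ?a = "axis k 1 :: real^'m"
  define S where "S = insert ?a (T ` e ` {..<n})"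
  have span_S: "span S = UNIV"
  proof -
    have "y \<in> span S" for y
    proof -
      define t where "t i = (if i < CARD('m) - 1 then y $ (the_inv_into (- {k}) \<beta> i) else 0)" for i
      have "t \<in> Rk (CARD('m) - 1)" by (auto simp: Rk_def t_def)
      then obtain f where f: "f \<in> span (e ` {..<n})" "f x = t" using surj by metis
      have "T f = y - (y $ k) *\<^sub>R ?a"
      proof -
        have "t (\<beta> i) = y $ i" if "i \<noteq> k" for i
          using that bij \<beta>_less[OF that] by (simp add: t_def bij_betw_def the_inv_into_f_f)
        then show ?thesis
          by (auto simp: T_def f vec_eq_iff axis_def)
      qed
      moreover have "T f \<in> span (T ` e ` {..<n})"
        using f(1) linear_span_image[OF linT] by blast
      moreover have "span (T ` e ` {..<n}) \<subseteq> span S" by (intro span_mono) (auto simp: S_def)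
      moreover have "(y $ k) *\<^sub>R ?a \<in> span S" by (intro span_mul span_base) (simp add: S_def)
      ultimately have "(y - (y $ k) *\<^sub>R ?a) + (y $ k) *\<^sub>R ?a \<in> span S"
        by (intro span_add) auto
      then show ?thesis by simp
    qed
    then show ?thesis by auto
  qed
  have "independent {?a}" by (auto simp: axis_eq_0_iff)
  moreover have "{?a} \<subseteq> S" by (simp add: S_def)
  ultimately obtain B where B: "{?a} \<subseteq> B" "B \<subseteq> S" "independent B" "S \<subseteq> span B"
    using maximal_independent_subset_extend[of "{?a}" S] by metis
  have spanB: "span B = UNIV"
    using B(4) span_S by (metis span_mono span_span top.extremum_uniqueI)
  have finB: "finite B" using B(3) by (rule independent_imp_finite)
  have cardB: "card B = CARD('m)"
    using dim_eq_card_independent[OF B(3)] dim_span[of B] spanB by (simp add: dim_UNIV)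
  have "card (B - {?a}) = card (- {k})"
    using B(1) finB cardB by (simp add: Compl_eq_Diff_UNIV card_Diff_singleton)
  then obtain \<sigma> where \<sigma>: "bij_betw \<sigma> (- {k}) (B - {?a})"
    using finite_same_card_bij finB by (metis finite finite_Diff)
  have "\<exists>j<n. T (e j) = \<sigma> l" if "l \<noteq> k" for l
  proof -
    have "\<sigma> l \<in> B - {?a}" using \<sigma> that by (auto simp: bij_betw_def)
    then have "\<sigma> l \<in> T ` e ` {..<n}" using B(2) by (auto simp: S_def)
    then obtain j where "j < n" "\<sigma> l = T (e j)" by auto
    then show ?thesis by metis
  qed
  then obtain \<iota> where \<iota>: "\<And>l. l \<noteq> k \<Longrightarrow> \<iota> l < n \<and> T (e (\<iota> l)) = \<sigma> l" by metis
  have "inj_on \<iota> (- {k})"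
    using \<iota> \<sigma> by (metis (no_types, lifting) ComplD bij_betw_def inj_on_def singletonI)
  moreover have "\<iota> ` (- {k}) \<subseteq> {..<n}" using \<iota> by auto
  moreover have "det (minor_mat \<iota> x) \<noteq> 0"
  proof -
    have col: "column l (minor_mat \<iota> x) = (if l = k then ?a else \<sigma> l)" for l
      using \<iota>[of l] by (auto simp: column_def minor_mat_def vec_eq_iff axis_def T_def)
    have "columns (minor_mat \<iota> x) = insert ?a (\<sigma> ` (- {k}))"
      unfolding columns_def col by auto
    also have "\<dots> = B" using \<sigma> B(1) by (auto simp: bij_betw_def)
    finally have "span (columns (minor_mat \<iota> x)) = UNIV" using spanB by simp
    then have "\<exists>A. minor_mat \<iota> x ** A = mat 1"
      unfolding matrix_right_invertible_span_columns by (simp add: span_vec_eq)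
    then show ?thesis by (simp add: invertible_det_nz[symmetric] invertible_right_inverse)
  qed
  ultimately show ?thesis unfolding minor_set_def by blast
qed

definition rhs_vec :: "('m \<Rightarrow> nat) \<Rightarrow> (nat \<Rightarrow> real) \<Rightarrow> real^'m \<Rightarrow> real^'m"
  where "rhs_vec \<iota> c x = (\<chi> i. if i = k then 0 else - (\<Sum>j\<in>{..<n} - \<iota> ` (- {k}). c j * e j x (\<beta> i)))"

text \<open>The value that coordinate \<open>\<iota> l\<close> must take for the field to vanish at
  \<open>x\<close>, given the coordinates outside the selection, whose contribution
  \<open>rhs_vec\<close> moves to the right. Cramer's rule makes it a rational expression in the
  entries, from which C1 regularity is read off.\<close>

definition cramer_sol :: "('m \<Rightarrow> nat) \<Rightarrow> (nat \<Rightarrow> real) \<Rightarrow> 'm \<Rightarrow> real^'m \<Rightarrow> real"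
  where "cramer_sol \<iota> c l x = det (\<chi> i j. if j = l then rhs_vec \<iota> c x $ i else minor_mat \<iota> x $ i $ j)
    * inverse (det (minor_mat \<iota> x))"

lemma C1_cramer_sol: "C1_on (minor_set \<iota>) (cramer_sol \<iota> c l)"
proof (cases "\<iota> ` (- {k}) \<subseteq> {..<n}")
  case True
  have rhs: "C1_on W (\<lambda>x. rhs_vec \<iota> c x $ i)" for W i
  proof -
    have "C1_on W (\<lambda>x. - 1 * (\<Sum>j\<in>{..<n} - \<iota> ` (- {k}). c j * e j x (\<beta> i)))" if "i \<noteq> k"
      using that by (intro C1_on_sum C1_on_mult C1_on_const C1_entry) auto
    then show ?thesis by (cases "i = k") (simp_all add: rhs_vec_def C1_on_const)
  qed
  show ?thesis
    unfolding cramer_sol_def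
  proof (intro C1_on_mult C1_on_inverse C1_on_det C1_minor_mat True)
    fix i j
    show "C1_on (minor_set \<iota>) (\<lambda>x. (\<chi> i j. if j = l then rhs_vec \<iota> c x $ i else minor_mat \<iota> x $ i $ j) $ i $ j)"
      using rhs C1_minor_mat[OF True] by (cases "j = l") simp_all
  qed (auto simp: minor_set_def)
next
  case False
  then have "minor_set \<iota> = {}" by (auto simp: minor_set_def)
  then show ?thesis by (simp add: C1_on_def)
qed

lemma zero_iff_cramer_sol:
  assumes x: "x \<in> minor_set \<iota>"
  shows "(\<forall>i<CARD('m) - 1. (\<Sum>j<n. c j * e j x i) = 0) \<longleftrightarrow> (\<forall>l\<in>- {k}. c (\<iota> l) = cramer_sol \<iota> c l x)"
proof -
  have inj: "inj_on \<iota> (- {k})" and sub: "\<iota> ` (- {k}) \<subseteq> {..<n}" and det: "det (minor_mat \<iota> x) \<noteq> 0"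
    using x by (auto simp: minor_set_def)
  define y :: "real^'m" where "y = (\<chi> l. if l = k then 0 else c (\<iota> l))"
  have Uk: "UNIV = insert k (- {k})" by auto
  have My: "(minor_mat \<iota> x *v y) $ i = (if i = k then 0 else \<Sum>l\<in>- {k}. c (\<iota> l) * e (\<iota> l) x (\<beta> i))" for i
  proof -
    have "(minor_mat \<iota> x *v y) $ i = (\<Sum>l\<in>insert k (- {k}). minor_mat \<iota> x $ i $ l * y $ l)"
      by (simp add: matrix_vector_mult_def flip: Uk)
    also have "\<dots> = (\<Sum>l\<in>- {k}. minor_mat \<iota> x $ i $ l * y $ l)"
      by (subst sum.insert) (auto simp: y_def)
    also have "\<dots> = (\<Sum>l\<in>- {k}. if i = k then 0 else c (\<iota> l) * e (\<iota> l) x (\<beta> i))"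
      by (intro sum.cong refl) (auto simp: minor_mat_def y_def)
    finally show ?thesis by (cases "i = k") simp_all
  qed
  have split: "(\<Sum>j<n. c j * e j x i)
    = (\<Sum>l\<in>- {k}. c (\<iota> l) * e (\<iota> l) x i) + (\<Sum>j\<in>{..<n} - \<iota> ` (- {k}). c j * e j x i)" for i
    using sum.subset_diff[OF sub, of "\<lambda>j. c j * e j x i"] by (simp add: sum.reindex[OF inj] add.commute)
  have "(\<forall>i<CARD('m) - 1. (\<Sum>j<n. c j * e j x i) = 0) \<longleftrightarrow> (\<forall>i\<in>- {k}. (\<Sum>j<n. c j * e j x (\<beta> i)) = 0)"
  proof -
    have "{..<CARD('m) - 1} = \<beta> ` (- {k})" using bij by (simp add: bij_betw_def)
    then have "(\<forall>i\<in>{..<CARD('m) - 1}. (\<Sum>j<n. c j * e j x i) = 0)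
      \<longleftrightarrow> (\<forall>i\<in>\<beta> ` (- {k}). (\<Sum>j<n. c j * e j x i) = 0)" by (simp only:)
    then show ?thesis by (simp only: ball_simps lessThan_iff Ball_def) blast
  qed
  also have "\<dots> \<longleftrightarrow> minor_mat \<iota> x *v y = rhs_vec \<iota> c x"
  proof -
    have "(minor_mat \<iota> x *v y) $ i = rhs_vec \<iota> c x $ i \<longleftrightarrow> i = k \<or> (\<Sum>j<n. c j * e j x (\<beta> i)) = 0" for i
    proof (cases "i = k")
      case False
      then show ?thesis
        unfolding My split by (simp only: rhs_vec_def vec_lambda_beta if_False eq_neg_iff_add_eq_0) simp
    qed (simp add: My rhs_vec_def)
    then show ?thesis unfolding vec_eq_iff by auto
  qed
  also have "\<dots> \<longleftrightarrow> y = (\<chi> l. cramer_sol \<iota> c l x)"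
    unfolding cramer[OF det] by (simp add: cramer_sol_def divide_inverse)
  also have "\<dots> \<longleftrightarrow> (\<forall>l\<in>- {k}. c (\<iota> l) = cramer_sol \<iota> c l x)"
  proof
    assume *: "\<forall>l\<in>- {k}. c (\<iota> l) = cramer_sol \<iota> c l x"
    \<comment> \<open>Replacing column \<open>k\<close> by \<open>rhs_vec\<close> destroys the
      border: row \<open>k\<close> becomes zero, so the auxiliary unknown at \<open>k\<close> is 0,
      in agreement with \<open>y\<close>.\<close>
    have "cramer_sol \<iota> c k x = 0"
    proof -
      have "row k (\<chi> i j. if j = k then rhs_vec \<iota> c x $ i else minor_mat \<iota> x $ i $ j) = 0"
        by (auto simp: row_def vec_eq_iff rhs_vec_def minor_mat_def)
      then show ?thesis unfolding cramer_sol_def by (simp only: det_zero_row(2) mult_zero_left)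
    qed
    with * show "y = (\<chi> l. cramer_sol \<iota> c l x)" by (auto simp: y_def vec_eq_iff)
  next
    assume "y = (\<chi> l. cramer_sol \<iota> c l x)"
    then have "y $ l = cramer_sol \<iota> c l x" for l by (simp add: vec_eq_iff)
    then have "(if l = k then 0 else c (\<iota> l)) = cramer_sol \<iota> c l x" for l by (simp add: y_def)
    then show "\<forall>l\<in>- {k}. c (\<iota> l) = cramer_sol \<iota> c l x" by (metis ComplD singletonI)
  qed
  finally show ?thesis .
qed

end

section \<open>Expected zeros in coordinates and their scaling\<close>

context evaluation_basis
begin

definition zeros_in :: "(real^'m) set \<Rightarrow> (real^'m) exp_data \<Rightarrow> (real^'m \<Rightarrow> real) \<Rightarrow> (nat \<Rightarrow> real) \<Rightarrow> (real^'m) set"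
  where "zeros_in V p z c = {x \<in> V. exp_sum p z x = 0 \<and> (\<forall>i<CARD('m) - 1. (\<Sum>j<n. c j * e j x i) = 0)}"

definition mean_zeros :: "((nat \<Rightarrow> real) \<Rightarrow> ennreal) \<Rightarrow> (real^'m) set \<Rightarrow> (real^'m) exp_data \<Rightarrow> ennreal"
  where "mean_zeros \<rho> V p = (\<integral>\<^sup>+z. \<integral>\<^sup>+c. \<rho> c * emeasure (count_space UNIV) (zeros_in V p z c)
    \<partial>PiM {..<n} (\<lambda>_. lborel) \<partial>PiM (fst p) (\<lambda>_. std_gauss))"

lemma continuous_entry: "j < n \<Longrightarrow> i < CARD('m) - 1 \<Longrightarrow> continuous_on W (\<lambda>x. e j x i)"
  by (intro C1_on_continuous C1_on_C_infinity[OF smooth])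

lemma measurable_zeros_in:
  assumes "fsigma V" "finite (fst p)"
  shows "(\<lambda>(z, c). emeasure (count_space UNIV) (zeros_in V p z c))
    \<in> borel_measurable (PiM (fst p) (\<lambda>_. std_gauss) \<Otimes>\<^sub>M PiM {..<n} (\<lambda>_. lborel))"
proof -
  \<comment> \<open>A sum of absolute values turns common zeros into the zeros of one continuous
    function, the form for which the count is known to be measurable.\<close>
  let ?G = "\<lambda>zc x. \<bar>exp_sum p (fst zc) x\<bar> + (\<Sum>i<CARD('m) - 1. \<bar>\<Sum>j<n. snd zc j * e j x i\<bar>)"
  have "{x \<in> V. ?G zc x = 0} = zeros_in V p (fst zc) (snd zc)" for zc
    unfolding zeros_in_def
    by (auto simp: add_nonneg_eq_0_iff sum_nonneg sum_nonneg_eq_0_iff)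
  then have eq: "(\<lambda>(z, c). emeasure (count_space UNIV) (zeros_in V p z c))
    = (\<lambda>zc. emeasure (count_space UNIV) {x \<in> V. ?G zc x = 0})"
    by (intro ext) (simp only: case_prod_beta)
  show ?thesis
    unfolding eq
  proof (rule measurable_zero_count[OF assms(1)])
    fix zc :: "(real^'m \<Rightarrow> real) \<times> (nat \<Rightarrow> real)"
    show "continuous_on V (?G zc)"
      unfolding exp_sum_def by (intro continuous_intros continuous_entry) auto
  next
    fix x
    have [measurable]: "(\<lambda>zc. fst zc a) \<in> borel_measurable (PiM (fst p) (\<lambda>_. std_gauss) \<Otimes>\<^sub>M PiM {..<n} (\<lambda>_. lborel))"
      if "a \<in> fst p" for a
      using that by measurable
    show "(\<lambda>zc. ?G zc x) \<in> borel_measurable (PiM (fst p) (\<lambda>_. std_gauss) \<Otimes>\<^sub>M PiM {..<n} (\<lambda>_. lborel))"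
      unfolding exp_sum_def by measurable
  qed
qed

text \<open>Inside one minor set the selected coordinates can be eliminated once the others are
  frozen. The resulting integrand depends on the exponential sum only through the variance of a
  linear form that is the same for \<open>p\<close> and \<open>q\<close>, so the factor
  \<open>sqrt d\<close> comes out pointwise.\<close>

lemma mean_zeros_piece:
  assumes \<rho>[measurable]: "\<rho> \<in> borel_measurable (PiM {..<n} (\<lambda>_. lborel))"
    and V: "fsigma V" "V \<subseteq> minor_set \<iota>"
    and p: "positive_data p" and q: "positive_data q" and d: "0 < d"
    and var: "\<And>x f. linear f \<Longrightarrow> exp_variance q x f = d * exp_variance p x f"
  shows "mean_zeros \<rho> V q = ennreal (sqrt d) * mean_zeros \<rho> V p"
proof (cases "V = {}")
  case True
  then show ?thesis by (simp add: mean_zeros_def zeros_in_def)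
next
  case False
  then have inj: "inj_on \<iota> (- {k})" and sub: "\<iota> ` (- {k}) \<subseteq> {..<n}"
    using V(2) by (auto simp: minor_set_def)
  define I J where "I = \<iota> ` (- {k})" and "J = {..<n} - I"
  have IJ: "J \<union> I = {..<n}" "J \<inter> I = {}" "finite I" "finite J"
    using sub by (auto simp: I_def J_def)
  let ?L = "PiM (- {k}) (\<lambda>_. lborel :: real measure)"
  interpret L: product_sigma_finite "\<lambda>_. lborel :: real measure" ..
  interpret Lf: finite_product_sigma_finite "\<lambda>_. lborel :: real measure" "- {k}" by standard simp
  interpret Ln: finite_product_sigma_finite "\<lambda>_. lborel :: real measure" "{..<n}" by standard simp
  interpret G: product_sigma_finite "\<lambda>_. std_gauss" by (rule product_sigma_finite_std_gauss)
  define inv where "inv = the_inv_into (- {k}) \<iota>"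
  have inv: "inv (\<iota> l) = l" if "l \<noteq> k" for l
    using that inj by (simp add: inv_def the_inv_into_f_f)
  have bij_inv: "bij_betw inv I (- {k})"
    unfolding inv_def I_def using inj by (intro bij_betw_the_inv_into) (simp add: bij_betw_def)
  \<comment> \<open>Frozen coordinates \<open>c\<close> stay on \<open>J\<close>; the eliminated
    ones, indexed by \<open>- {k}\<close> as in the area formula, are put back on
    \<open>I\<close>.\<close>
  define comb where "comb c s = merge J I (c, \<lambda>i\<in>I. s (inv i))" for c and s :: "'m \<Rightarrow> real"
  have comb_I: "comb c s (\<iota> l) = s l" if "l \<noteq> k" for c s l
    using that inv IJ(2) by (auto simp: comb_def merge_def I_def)
  have comb_J: "comb c s j = c j" if "j \<in> J" for c s j
    using that by (simp add: comb_def merge_def)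
  have comb_meas: "comb c \<in> measurable ?L (PiM {..<n} (\<lambda>_. lborel))"
    if "c \<in> space (PiM J (\<lambda>_. lborel))" for c
  proof -
    have [measurable]: "(\<lambda>s. \<lambda>i\<in>I. s (inv i)) \<in> measurable ?L (PiM I (\<lambda>_. lborel))"
      using bij_inv by (intro measurable_restrict measurable_component_singleton) (auto simp: bij_betw_def)
    show ?thesis
      unfolding comb_def IJ(1)[symmetric] using that by measurable
  qed
  have "\<exists>g. continuous_on (minor_set \<iota>) g \<and>
      (\<forall>x\<in>minor_set \<iota>. (cramer_sol \<iota> c l has_derivative (\<lambda>v. g x \<bullet> v)) (at x))" for c l
    using C1_cramer_sol unfolding C1_on_def by blast
  \<comment> \<open>The choice is made for each \<open>c\<close> separately, so measurability of
    \<open>g\<close> in \<open>c\<close> is not at hand; \<open>slice\<close> is therefore compared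
    pointwise and only scaled by a constant.\<close>
  then obtain g where g: "\<And>c l. continuous_on (minor_set \<iota>) (g c l)"
    "\<And>c l x. x \<in> minor_set \<iota> \<Longrightarrow> (cramer_sol \<iota> c l has_derivative (\<lambda>v. g c l x \<bullet> v)) (at x)"
    by metis
  define slice where "slice p' c = (\<integral>\<^sup>+x. indicator V x * (\<rho> (comb c (\<lambda>l\<in>- {k}. cramer_sol \<iota> c l x)) *
      (kac_rice_const * ennreal (sqrt (exp_variance p' x (\<lambda>y. jac_det ((\<lambda>l. g c l x)(k := y))))))) \<partial>lborel)"
    for p' :: "(real^'m) exp_data" and c
  have mean: "mean_zeros \<rho> V p' = (\<integral>\<^sup>+c. slice p' c \<partial>PiM J (\<lambda>_. lborel))" if p': "positive_data p'" for p'
  proof -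
    have fin: "finite (fst p')" using p' by (simp add: positive_data_def)
    interpret Gf: finite_product_sigma_finite "\<lambda>_. std_gauss" "fst p'" by standard (rule fin)
    let ?N = "\<lambda>z c. emeasure (count_space UNIV) (zeros_in V p' z c)"
    have N[measurable]: "case_prod ?N \<in> borel_measurable (PiM (fst p') (\<lambda>_. std_gauss) \<Otimes>\<^sub>M PiM {..<n} (\<lambda>_. lborel))"
      by (rule measurable_zeros_in[OF V(1) fin])
    interpret P: pair_sigma_finite "PiM (fst p') (\<lambda>_. std_gauss)" "PiM {..<n} (\<lambda>_. lborel :: real measure)" ..
    interpret P': pair_sigma_finite "PiM (fst p') (\<lambda>_. std_gauss)" ?L ..
    have "mean_zeros \<rho> V p' = (\<integral>\<^sup>+c. \<integral>\<^sup>+z. \<rho> c * ?N z c \<partial>PiM (fst p') (\<lambda>_. std_gauss) \<partial>PiM (J \<union> I) (\<lambda>_. lborel))"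
      unfolding mean_zeros_def IJ(1) by (rule P.Fubini'[symmetric]) measurable
    also have "\<dots> = (\<integral>\<^sup>+c. \<integral>\<^sup>+s. \<integral>\<^sup>+z. \<rho> (merge J I (c, s)) * ?N z (merge J I (c, s))
        \<partial>PiM (fst p') (\<lambda>_. std_gauss) \<partial>PiM I (\<lambda>_. lborel) \<partial>PiM J (\<lambda>_. lborel))"
      by (rule L.product_nn_integral_fold) (use IJ in \<open>simp_all, measurable\<close>)
    also have "\<dots> = (\<integral>\<^sup>+c. slice p' c \<partial>PiM J (\<lambda>_. lborel))"
    proof (rule nn_integral_cong)
      fix c assume c: "c \<in> space (PiM J (\<lambda>_. lborel :: real measure))"
      note [measurable] = comb_meas[OF c]
      have merge[measurable]: "(\<lambda>s. merge J I (c, s)) \<in> measurable (PiM I (\<lambda>_. lborel)) (PiM {..<n} (\<lambda>_. lborel))"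
        unfolding IJ(1)[symmetric] using c by measurable
      have "(\<integral>\<^sup>+s. \<integral>\<^sup>+z. \<rho> (merge J I (c, s)) * ?N z (merge J I (c, s))
          \<partial>PiM (fst p') (\<lambda>_. std_gauss) \<partial>PiM I (\<lambda>_. lborel))
        = (\<integral>\<^sup>+s. \<integral>\<^sup>+z. \<rho> (comb c s) * ?N z (comb c s) \<partial>PiM (fst p') (\<lambda>_. std_gauss) \<partial>?L)"
        unfolding comb_def by (rule nn_integral_PiM_reindex_lborel[OF bij_inv IJ(3)]) measurable
      also have "\<dots> = (\<integral>\<^sup>+z. \<integral>\<^sup>+s. \<rho> (comb c s) * ?N z (comb c s) \<partial>?L \<partial>PiM (fst p') (\<lambda>_. std_gauss))"
        by (rule P'.Fubini') measurable
      also have "\<dots> = (\<integral>\<^sup>+z. \<integral>\<^sup>+s. \<rho> (comb c s) * emeasure (count_space UNIV)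
          {x \<in> V. exp_sum p' z x = 0 \<and> (\<forall>l\<in>- {k}. s l = cramer_sol \<iota> c l x)} \<partial>?L \<partial>PiM (fst p') (\<lambda>_. std_gauss))"
      proof -
        \<comment> \<open>The linear system has only frozen coordinates on its right-hand side, so
          its solution does not move with \<open>s\<close>.\<close>
        have sol: "cramer_sol \<iota> (comb c s) l x = cramer_sol \<iota> c l x" for s l x
        proof -
          have "rhs_vec \<iota> (comb c s) x = rhs_vec \<iota> c x"
            by (auto simp: rhs_vec_def vec_eq_iff comb_J J_def I_def intro!: sum.cong)
          then show ?thesis unfolding cramer_sol_def by (simp only:)
        qed
        have "zeros_in V p' z (comb c s)
          = {x \<in> V. exp_sum p' z x = 0 \<and> (\<forall>l\<in>- {k}. s l = cramer_sol \<iota> c l x)}" for z s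
          unfolding zeros_in_def
        proof (intro Collect_cong conj_cong refl)
          fix x assume "x \<in> V"
          then have "x \<in> minor_set \<iota>" using V(2) by blast
          from zero_iff_cramer_sol[OF this, of "comb c s"]
          show "(\<forall>i<CARD('m) - 1. (\<Sum>j<n. comb c s j * e j x i) = 0)
            \<longleftrightarrow> (\<forall>l\<in>- {k}. s l = cramer_sol \<iota> c l x)"
            unfolding sol by (auto simp: comb_I)
        qed
        then show ?thesis by simp
      qed
      also have "\<dots> = slice p' c"
        unfolding slice_def
        by (rule gaussian_slice[OF p' open_minor_set V g(2) g(1)]) measurable
      finally show "(\<integral>\<^sup>+s. \<integral>\<^sup>+z. \<rho> (merge J I (c, s)) * ?N z (merge J I (c, s))
          \<partial>PiM (fst p') (\<lambda>_. std_gauss) \<partial>PiM I (\<lambda>_. lborel)) = slice p' c" .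
    qed
    finally show ?thesis .
  qed
  have eq: "slice q c = ennreal (sqrt d) * slice p c" for c
    unfolding slice_def var[OF jac_det_linear] real_sqrt_mult nn_integral_cmult_real[OF real_sqrt_gt_zero[OF d], symmetric]
    using d by (intro nn_integral_cong) (simp add: ennreal_mult' mult_ac)
  show ?thesis
    unfolding mean[OF p] mean[OF q] nn_integral_cmult_real[OF real_sqrt_gt_zero[OF d], symmetric]
    by (intro nn_integral_cong eq)
qed

text \<open>The selections \<open>\<iota>\<close> form a countable type because \<open>'m\<close> is
  finite, so the minor sets are a countable open cover. Disjointing it within \<open>U\<close>
  yields F-sigma pieces, and both sides are countably additive.\<close>

lemma mean_zeros_scaling:
  assumes \<rho>[measurable]: "\<rho> \<in> borel_measurable (PiM {..<n} (\<lambda>_. lborel))"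
    and U: "open U"
    and p: "positive_data p" and q: "positive_data q" and d: "0 < d"
    and var: "\<And>x f. linear f \<Longrightarrow> exp_variance q x f = d * exp_variance p x f"
  shows "mean_zeros \<rho> U q = ennreal (sqrt d) * mean_zeros \<rho> U p"
proof -
  define W :: "nat \<Rightarrow> _" where "W i = minor_set (from_nat i)" for i
  define V where "V i = U \<inter> disjointed W i" for i
  have V_alt: "V i = U \<inter> (W i \<inter> - (\<Union>j<i. W j))" for i
    by (auto simp: V_def disjointed_def atLeast0LessThan)
  have fV: "fsigma (V i)" for i
    unfolding V_alt
    by (intro fsigma_Int U fsigma_open fsigma_closed closed_Compl open_UN) (auto simp: W_def open_minor_set)
  have VW: "V i \<subseteq> minor_set (from_nat i)" for i by (auto simp: V_alt W_def)
  have "(\<Union>i. W i) = UNIV"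
  proof -
    have "x \<in> (\<Union>i. W i)" for x
    proof -
      obtain \<iota> where "x \<in> minor_set \<iota>" using minor_set_cover by blast
      then have "x \<in> W (to_nat \<iota>)" by (simp add: W_def)
      then show ?thesis by blast
    qed
    then show ?thesis by blast
  qed
  then have UV: "(\<Union>i. V i) = U"
    by (simp add: V_def UN_disjointed_eq flip: UN_extend_simps)
  have disj: "disjoint_family V"
    using disjoint_family_disjointed[of W] by (auto simp: V_def disjoint_family_on_def)
  have sum: "mean_zeros \<rho> U p' = (\<Sum>i. mean_zeros \<rho> (V i) p')" if p': "positive_data p'" for p'
  proof -
    have fin: "finite (fst p')" using p' by (simp add: positive_data_def)
    interpret L: finite_product_sigma_finite "\<lambda>_. lborel :: real measure" "{..<n}" by standard simp
    have [measurable]: "(\<lambda>(z, c). emeasure (count_space UNIV) (zeros_in (V i) p' z c))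
      \<in> borel_measurable (PiM (fst p') (\<lambda>_. std_gauss) \<Otimes>\<^sub>M PiM {..<n} (\<lambda>_. lborel))" for i
      by (rule measurable_zeros_in[OF fV fin])
    have dec: "emeasure (count_space UNIV) (zeros_in U p' z c)
      = (\<Sum>i. emeasure (count_space UNIV) (zeros_in (V i) p' z c))" for z c
    proof -
      have "zeros_in U p' z c = (\<Union>i. zeros_in (V i) p' z c)"
        unfolding zeros_in_def UV[symmetric] by auto
      moreover have "disjoint_family (\<lambda>i. zeros_in (V i) p' z c)"
        using disj unfolding disjoint_family_on_def zeros_in_def by blast
      ultimately show ?thesis by (subst suminf_emeasure) auto
    qed
    have "mean_zeros \<rho> U p' = (\<integral>\<^sup>+z. \<integral>\<^sup>+c. (\<Sum>i. \<rho> c * emeasure (count_space UNIV) (zeros_in (V i) p' z c))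
      \<partial>PiM {..<n} (\<lambda>_. lborel) \<partial>PiM (fst p') (\<lambda>_. std_gauss))"
      unfolding mean_zeros_def dec by simp
    also have "\<dots> = (\<integral>\<^sup>+z. (\<Sum>i. \<integral>\<^sup>+c. \<rho> c * emeasure (count_space UNIV) (zeros_in (V i) p' z c)
      \<partial>PiM {..<n} (\<lambda>_. lborel)) \<partial>PiM (fst p') (\<lambda>_. std_gauss))"
      by (intro nn_integral_cong nn_integral_suminf) measurable
    also have "\<dots> = (\<Sum>i. mean_zeros \<rho> (V i) p')"
      unfolding mean_zeros_def by (rule nn_integral_suminf) measurable
    finally show ?thesis .
  qed
  have "mean_zeros \<rho> (V i) q = ennreal (sqrt d) * mean_zeros \<rho> (V i) p" for i
    by (rule mean_zeros_piece[OF \<rho> fV VW p q d var])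
  then show ?thesis unfolding sum[OF p] sum[OF q] by simp
qed

end

section \<open>From random fields to coordinates\<close>

lemma sum_scaleR_field_apply:
  fixes e :: "nat \<Rightarrow> 'a field"
  shows "(\<Sum>j<n. c j *\<^sub>R e j) x i = (\<Sum>j<n. c j * e j x i)"
  by (induction n) (simp_all add: scaleR_fun_def)

text \<open>Rectangles determine the product measure, and on rectangles the claim is
  independence.\<close>

lemma distr_pair_independent_elems:
  assumes "prob_space M" and indep: "independent_elems M S X T Y"
  shows "distr M (S \<Otimes>\<^sub>M T) (\<lambda>\<omega>. (X \<omega>, Y \<omega>)) = distr M S X \<Otimes>\<^sub>M distr M T Y"
proof -
  interpret prob_space M by fact
  have [measurable]: "X \<in> measurable M S" "Y \<in> measurable M T"
    and ind: "indep_set {X -` B \<inter> space M |B. B \<in> sets S} {Y -` C \<inter> space M |C. C \<in> sets T}"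
    using indep by (auto simp: independent_elems_def)
  show ?thesis
  proof (rule pair_measure_eqI[symmetric])
    show "sigma_finite_measure (distr M S X)" "sigma_finite_measure (distr M T Y)"
      by (intro prob_space_imp_sigma_finite prob_space_distr; measurable)+
    show "sets (distr M S X \<Otimes>\<^sub>M distr M T Y) = sets (distr M (S \<Otimes>\<^sub>M T) (\<lambda>\<omega>. (X \<omega>, Y \<omega>)))"
      by (simp cong: sets_pair_measure_cong)
    fix B C assume "B \<in> sets (distr M S X)" "C \<in> sets (distr M T Y)"
    then have BC[measurable]: "B \<in> sets S" "C \<in> sets T" by auto
    have "prob ((X -` B \<inter> space M) \<inter> (Y -` C \<inter> space M)) = prob (X -` B \<inter> space M) * prob (Y -` C \<inter> space M)"
      by (rule indep_setD[OF ind]) (use BC in auto)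
    moreover have "(\<lambda>\<omega>. (X \<omega>, Y \<omega>)) -` (B \<times> C) \<inter> space M = (X -` B \<inter> space M) \<inter> (Y -` C \<inter> space M)"
      by auto
    ultimately show "emeasure (distr M S X) B * emeasure (distr M T Y) C
      = emeasure (distr M (S \<Otimes>\<^sub>M T) (\<lambda>\<omega>. (X \<omega>, Y \<omega>))) (B \<times> C)"
      by (simp add: emeasure_distr emeasure_eq_measure ennreal_mult)
  qed
qed

lemma measurable_exp_sum:
  "exp_sum p \<in> measurable (PiM (fst p) (\<lambda>_. borel)) fun_sigma"
  unfolding exp_sum_def by (rule measurable_abs_UNIV) measurable

lemma distr_gaussian_exp_sum:
  assumes M: "prob_space M" and E: "gaussian_exp_sum M p E" and p: "positive_data p"
  shows "distr M fun_sigma E = distr (PiM (fst p) (\<lambda>_. std_gauss)) fun_sigma (exp_sum p)"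
proof -
  interpret prob_space M by fact
  obtain \<xi> where ind: "indep_vars (\<lambda>_. borel) \<xi> (fst p)"
    and dist: "\<And>a. a \<in> fst p \<Longrightarrow> distributed M lborel (\<xi> a) std_normal_density"
    and E: "\<And>\<omega>. \<omega> \<in> space M \<Longrightarrow> E \<omega> = exp_sum p (\<lambda>a. \<xi> a \<omega>)"
    using E unfolding gaussian_exp_sum_def by auto
  have rv: "\<xi> a \<in> measurable M borel" if "a \<in> fst p" for a
    using ind that by (auto simp: indep_vars_def)
  have "distr M (PiM (fst p) (\<lambda>_. borel)) (\<lambda>\<omega>. \<lambda>a\<in>fst p. \<xi> a \<omega>) = PiM (fst p) (\<lambda>a. distr M borel (\<xi> a))"
    using ind p rv by (subst indep_vars_iff_distr_eq_PiM'[symmetric]) (auto simp: positive_data_def)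
  also have "\<dots> = PiM (fst p) (\<lambda>_. std_gauss)"
  proof (rule PiM_cong)
    fix a assume "a \<in> fst p"
    then have "distr M lborel (\<xi> a) = std_gauss"
      using dist distributed_distr_eq_density by blast
    moreover have "distr M borel (\<xi> a) = distr M lborel (\<xi> a)"
      by (rule distr_cong) auto
    ultimately show "distr M borel (\<xi> a) = std_gauss" by simp
  qed simp
  finally have law: "distr M (PiM (fst p) (\<lambda>_. borel)) (\<lambda>\<omega>. \<lambda>a\<in>fst p. \<xi> a \<omega>) = PiM (fst p) (\<lambda>_. std_gauss)" .
  have "distr M fun_sigma E = distr M fun_sigma (exp_sum p \<circ> (\<lambda>\<omega>. \<lambda>a\<in>fst p. \<xi> a \<omega>))"
    by (intro distr_cong refl) (simp add: E exp_sum_def fun_eq_iff)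
  also have "\<dots> = distr (distr M (PiM (fst p) (\<lambda>_. borel)) (\<lambda>\<omega>. \<lambda>a\<in>fst p. \<xi> a \<omega>)) fun_sigma (exp_sum p)"
    by (intro distr_distr[symmetric] measurable_exp_sum measurable_restrict rv)
  finally show ?thesis unfolding law .
qed

text \<open>Parseval's identity: distances in \<open>F\<close> are Euclidean distances of
  coordinates, so continuity of the density can be restated in coordinates.\<close>

lemma orthonormal_norm:
  fixes e :: "nat \<Rightarrow> 'v::real_vector"
  assumes F: "subspace F" and ip: "scalar_product_on F ip" and onb: "orthonormal_basis_of F ip e"
  shows "ip_norm ip (\<Sum>i<dim F. b i *\<^sub>R e i) = sqrt (\<Sum>i<dim F. (b i)\<^sup>2)"
proof -
  let ?n = "dim F"
  let ?T = "\<Sum>i<?n. b i *\<^sub>R e i"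
  have eF: "e i \<in> F" if "i < ?n" for i
    using onb that span_base[of "e i" "e ` {..<?n}"] by (auto simp: orthonormal_basis_of_def)
  have on: "ip (e i) (e j) = (if i = j then 1 else 0)" if "i < ?n" "j < ?n" for i j
    using onb that by (auto simp: orthonormal_basis_of_def)
  note ip' = ip[unfolded scalar_product_on_def]
  have sym: "f \<in> F \<Longrightarrow> g \<in> F \<Longrightarrow> ip f g = ip g f" for f g
    using conjunct1[OF ip'] by blast
  have add: "f \<in> F \<Longrightarrow> g \<in> F \<Longrightarrow> h \<in> F \<Longrightarrow> ip (f + g) h = ip f h + ip g h" for f g h
    using conjunct1[OF conjunct2[OF ip']] by blast
  have scale: "f \<in> F \<Longrightarrow> g \<in> F \<Longrightarrow> ip (c *\<^sub>R f) g = c * ip f g" for f g c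
    using conjunct1[OF conjunct2[OF conjunct2[OF ip']]] by blast
  have sums: "(\<Sum>i<N. b i *\<^sub>R e i) \<in> F \<and> ip (\<Sum>i<N. b i *\<^sub>R e i) g = (\<Sum>i<N. b i * ip (e i) g)"
    if "N \<le> ?n" and g: "g \<in> F" for N g
    using that(1)
  proof (induction N)
    case 0
    have "ip 0 g = 0" using scale[OF g g, of 0] by simp
    then show ?case using F by (simp add: subspace_0)
  next
    case (Suc N)
    then have "e N \<in> F" "b N *\<^sub>R e N \<in> F" using eF F by (auto intro: subspace_scale)
    then show ?case using Suc g F by (simp add: add scale subspace_add)
  qed
  have TF: "?T \<in> F"
    using sums[of ?n 0] F by (auto simp: subspace_0)
  have "ip (e i) ?T = b i" if "i < ?n" for i
  proof -
    have "ip (e i) ?T = ip ?T (e i)" using sym[OF eF[OF that] TF] .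
    also have "\<dots> = (\<Sum>j<?n. b j * ip (e j) (e i))" using sums[of ?n "e i"] eF[OF that] by simp
    also have "\<dots> = (\<Sum>j<?n. if j = i then b i else 0)"
      using that by (intro sum.cong refl) (auto simp: on)
    finally show ?thesis using that by simp
  qed
  then have "ip ?T ?T = (\<Sum>i<?n. (b i)\<^sup>2)"
    using sums[of ?n ?T] TF by (simp add: power2_eq_square)
  then show ?thesis by (simp add: ip_norm_def)
qed

text \<open>Continuity of \<open>\<rho>\<close> for the norm of \<open>F\<close> becomes continuity
  in the product topology on sequences, because the norm reads finitely many coordinates; the Borel
  sets of that topology are the product sigma-algebra.\<close>

lemma measurable_density_coordinates:
  fixes e :: "nat \<Rightarrow> 'v::real_vector" and \<rho> :: "'v \<Rightarrow> real"
  assumes F: "subspace F" and ip: "scalar_product_on F ip" and onb: "orthonormal_basis_of F ip e"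
    and cont: "\<forall>f\<in>F. \<forall>\<epsilon>>0. \<exists>\<delta>>0. \<forall>g\<in>F. ip_norm ip (g - f) < \<delta> \<longrightarrow> \<bar>\<rho> g - \<rho> f\<bar> < \<epsilon>"
  shows "(\<lambda>c. \<rho> (\<Sum>i<dim F. c i *\<^sub>R e i)) \<in> borel_measurable (PiM {..<dim F} (\<lambda>_. lborel))"
proof -
  let ?n = "dim F"
  let ?T = "\<lambda>c. \<Sum>i<?n. c i *\<^sub>R e i"
  have eF: "e i \<in> F" if "i < ?n" for i
    using onb that span_base[of "e i" "e ` {..<?n}"] by (auto simp: orthonormal_basis_of_def)
  have TF: "?T c \<in> F" for c
    using eF F by (intro subspace_sum subspace_scale) auto
  have "continuous_on UNIV (\<lambda>c :: nat \<Rightarrow> real. \<rho> (?T c))"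
    unfolding continuous_on_def
  proof (intro ballI tendstoI)
    fix a :: "nat \<Rightarrow> real" and \<epsilon> :: real assume "0 < \<epsilon>"
    then obtain \<delta> where \<delta>: "\<delta> > 0" "\<And>g. g \<in> F \<Longrightarrow> ip_norm ip (g - ?T a) < \<delta> \<Longrightarrow> \<bar>\<rho> g - \<rho> (?T a)\<bar> < \<epsilon>"
      using cont TF by meson
    have "continuous_on UNIV (\<lambda>c :: nat \<Rightarrow> real. sqrt (\<Sum>i<?n. (c i - a i)\<^sup>2))"
      by (intro continuous_intros) (auto intro: continuous_on_product_coordinates)
    then have "((\<lambda>c. sqrt (\<Sum>i<?n. (c i - a i)\<^sup>2)) \<longlongrightarrow> sqrt (\<Sum>i<?n. (a i - a i)\<^sup>2)) (at a within UNIV)"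
      unfolding continuous_on_def by blast
    then have "\<forall>\<^sub>F c in at a within UNIV. sqrt (\<Sum>i<?n. (c i - a i)\<^sup>2) < \<delta>"
      by (rule order_tendstoD) (use \<delta>(1) in simp)
    then show "\<forall>\<^sub>F c in at a within UNIV. dist (\<rho> (?T c)) (\<rho> (?T a)) < \<epsilon>"
    proof eventually_elim
      case (elim c)
      have "?T c - ?T a = (\<Sum>i<?n. (c i - a i) *\<^sub>R e i)"
        by (simp add: sum_subtractf scaleR_left_diff_distrib)
      then have "ip_norm ip (?T c - ?T a) = sqrt (\<Sum>i<?n. (c i - a i)\<^sup>2)"
        using orthonormal_norm[OF F ip onb, of "\<lambda>i. c i - a i"] by simp
      then show ?case using \<delta>(2)[OF TF, of c] elim by (simp add: dist_real_def)
    qed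
  qed
  then have m1: "(\<lambda>c. \<rho> (?T c)) \<in> borel_measurable (PiM UNIV (\<lambda>_. borel))"
    unfolding measurable_cong_sets[OF sets_PiM_equal_borel refl]
    by (rule borel_measurable_continuous_onI)
  \<comment> \<open>Points of the finite product are \<open>undefined\<close> beyond
    \<open>?n\<close>; padding with zeros lands in the full product and leaves
    \<open>\<rho> (?T c)\<close> unchanged.\<close>
  have m2: "(\<lambda>c i. if i < ?n then c i else 0) \<in> measurable (PiM {..<?n} (\<lambda>_. lborel)) (PiM UNIV (\<lambda>_. borel :: real measure))"
  proof (rule measurable_abs_UNIV)
    fix i
    show "(\<lambda>c. if i < ?n then c i else 0) \<in> borel_measurable (PiM {..<?n} (\<lambda>_. lborel :: real measure))"
      by (cases "i < ?n") simp_all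
  qed
  have "(\<lambda>c. \<rho> (?T c)) = (\<lambda>c. \<rho> (?T (\<lambda>i. if i < ?n then c i else 0)))" by simp
  also have "\<dots> \<in> borel_measurable (PiM {..<?n} (\<lambda>_. lborel))"
    using measurable_compose[OF m2 m1] .
  finally show ?thesis .
qed

text \<open>The count is a measurable functional of the pair of random functions, so its expectation
  is determined by their joint law. Independence factors this law, the density describes the field
  in coordinates, and the sum is a function of its Gaussian coefficients.\<close>

lemma (in evaluation_basis) expected_zeros_eq_mean_zeros:
  fixes E :: "'w \<Rightarrow> real^'m \<Rightarrow> real" and X :: "'w \<Rightarrow> (real^'m) field"
  defines "T \<equiv> \<lambda>c. \<Sum>i<n. c i *\<^sub>R e i"
  assumes M: "prob_space M" and U: "open U"
    and E: "gaussian_exp_sum M p E" and p: "positive_data p"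
    and X: "random_field M (CARD('m) - 1) X"
    and \<rho>[measurable]: "\<rho> \<in> borel_measurable (PiM {..<n} (\<lambda>_. lborel))"
    and law: "distr M field_sigma X = distr (density (PiM {..<n} (\<lambda>_. lborel)) \<rho>) field_sigma T"
    and indep: "independent_elems M field_sigma X fun_sigma E"
  shows "expected_zeros M (CARD('m) - 1) E X U = mean_zeros \<rho> U p"
proof -
  let ?k = "CARD('m) - 1"
  interpret prob_space M by fact
  have [measurable]: "X \<in> measurable M field_sigma" "E \<in> measurable M fun_sigma"
    using indep by (auto simp: independent_elems_def)
  have T_apply: "T c x i = (\<Sum>j<n. c j * e j x i)" for c x i
    by (simp add: T_def sum_scaleR_field_apply)
  have T[measurable]: "T \<in> measurable (PiM {..<n} (\<lambda>_. lborel)) field_sigma"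
  proof -
    have "(\<lambda>c x i. \<Sum>j<n. c j * e j x i) \<in> measurable (PiM {..<n} (\<lambda>_. lborel)) field_sigma"
      by (intro measurable_abs_UNIV) measurable
    moreover have "(\<lambda>c x i. \<Sum>j<n. c j * e j x i) = T" by (simp add: fun_eq_iff T_apply)
    ultimately show ?thesis by simp
  qed
  have exp_sum_meas[measurable]: "exp_sum p \<in> measurable (PiM (fst p) (\<lambda>_. std_gauss)) fun_sigma"
    using measurable_exp_sum[of p] by (subst measurable_cong_sets[OF sets_PiM_cong refl]) auto
  obtain cnt :: "(real^'m \<Rightarrow> real) \<Rightarrow> ennreal"
    where cnt_meas[measurable]: "cnt \<in> borel_measurable (PiM U (\<lambda>_. borel))"
    and cnt: "\<And>h. continuous_on U h \<Longrightarrow> cnt (restrict h U) = emeasure (count_space UNIV) {x \<in> U. h x = 0}"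
    by (rule zero_count_functional[OF fsigma_open[OF U]]) blast
  \<comment> \<open>Measurable on all pairs of functions, and equal to the number of common zeros
    when the functions are continuous on \<open>U\<close>, which both random functions are.\<close>
  define \<Phi> where "\<Phi> f \<epsilon> = cnt (\<lambda>x\<in>U. \<bar>\<epsilon> x\<bar> + (\<Sum>i<?k. \<bar>f x i\<bar>))" for f :: "(real^'m) field" and \<epsilon>
  have \<Phi>[measurable]: "case_prod \<Phi> \<in> borel_measurable (field_sigma \<Otimes>\<^sub>M fun_sigma)"
  proof -
    have ev: "(\<lambda>f. f x i) \<in> borel_measurable field_sigma" for x :: "real^'m" and i :: nat
      by (rule measurable_compose[OF measurable_component_singleton[of x UNIV "\<lambda>_. PiM UNIV (\<lambda>_. borel)"]
            measurable_component_singleton[of i UNIV "\<lambda>_. borel"]]) auto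
    note [measurable] = measurable_compose[OF measurable_fst ev]
    have "(\<lambda>z. \<lambda>x\<in>U. \<bar>snd z x\<bar> + (\<Sum>i<?k. \<bar>fst z x i\<bar>)) \<in> measurable (field_sigma \<Otimes>\<^sub>M fun_sigma) (PiM U (\<lambda>_. borel))"
      by (intro measurable_restrict) measurable
    from measurable_compose[OF this cnt_meas] show ?thesis
      by (simp add: \<Phi>_def case_prod_beta')
  qed
  have \<Phi>_eq: "\<Phi> f \<epsilon> = emeasure (count_space UNIV) (common_zeros ?k \<epsilon> f U)"
    if "continuous_on U \<epsilon>" "\<And>i. i < ?k \<Longrightarrow> continuous_on U (\<lambda>x. f x i)" for f \<epsilon>
  proof -
    have "\<Phi> f \<epsilon> = emeasure (count_space UNIV) {x \<in> U. \<bar>\<epsilon> x\<bar> + (\<Sum>i<?k. \<bar>f x i\<bar>) = 0}"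
      unfolding \<Phi>_def by (rule cnt) (auto intro!: continuous_intros that)
    also have "{x \<in> U. \<bar>\<epsilon> x\<bar> + (\<Sum>i<?k. \<bar>f x i\<bar>) = 0} = common_zeros ?k \<epsilon> f U"
      by (auto simp: common_zeros_def add_nonneg_eq_0_iff sum_nonneg sum_nonneg_eq_0_iff)
    finally show ?thesis .
  qed
  have exp_cont: "continuous_on S (exp_sum p z)" for S z
    unfolding exp_sum_def by (intro continuous_intros)
  let ?LX = "distr M field_sigma X" and ?LE = "distr M fun_sigma E"
  interpret LX: prob_space ?LX by (rule prob_space_distr) measurable
  interpret LE: prob_space ?LE by (rule prob_space_distr) measurable
  interpret P: pair_sigma_finite ?LX ?LE ..
  have "expected_zeros M ?k E X U = (\<integral>\<^sup>+\<omega>. case_prod \<Phi> (X \<omega>, E \<omega>) \<partial>M)"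
    unfolding expected_zeros_def
  proof (rule nn_integral_cong)
    fix \<omega> assume \<omega>: "\<omega> \<in> space M"
    have "continuous_on U (E \<omega>)"
      using E \<omega> exp_cont by (auto simp: gaussian_exp_sum_def)
    moreover have "continuous_on U (\<lambda>x. X \<omega> x i)" if "i < ?k" for i
      using X \<omega> that by (intro C1_on_continuous C1_on_C_infinity) (auto simp: random_field_def)
    ultimately show "emeasure (count_space UNIV) (common_zeros ?k (E \<omega>) (X \<omega>) U) = case_prod \<Phi> (X \<omega>, E \<omega>)"
      by (simp add: \<Phi>_eq)
  qed
  also have "\<dots> = (\<integral>\<^sup>+z. case_prod \<Phi> z \<partial>distr M (field_sigma \<Otimes>\<^sub>M fun_sigma) (\<lambda>\<omega>. (X \<omega>, E \<omega>)))"
    by (rule nn_integral_distr[symmetric]) measurable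
  also have "\<dots> = (\<integral>\<^sup>+z. case_prod \<Phi> z \<partial>(?LX \<Otimes>\<^sub>M ?LE))"
    unfolding distr_pair_independent_elems[OF M indep] ..
  also have "\<dots> = (\<integral>\<^sup>+\<epsilon>. \<integral>\<^sup>+f. \<Phi> f \<epsilon> \<partial>?LX \<partial>?LE)"
    by (subst P.nn_integral_snd[symmetric]) auto
  also have "\<dots> = (\<integral>\<^sup>+\<epsilon>. \<integral>\<^sup>+c. \<rho> c * \<Phi> (T c) \<epsilon> \<partial>PiM {..<n} (\<lambda>_. lborel) \<partial>?LE)"
  proof (rule nn_integral_cong)
    fix \<epsilon> :: "real^'m \<Rightarrow> real"
    have "(\<lambda>f. case_prod \<Phi> (f, \<epsilon>)) \<in> borel_measurable field_sigma"
      by (rule measurable_compose[OF measurable_Pair2' \<Phi>]) (simp add: space_PiM)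
    then have [measurable]: "(\<lambda>f. \<Phi> f \<epsilon>) \<in> borel_measurable field_sigma" by simp
    have [measurable]: "(\<lambda>c. \<Phi> (T c) \<epsilon>) \<in> borel_measurable (PiM {..<n} (\<lambda>_. lborel))"
      by measurable
    have "(\<integral>\<^sup>+f. \<Phi> f \<epsilon> \<partial>?LX)
      = (\<integral>\<^sup>+c. \<Phi> (T c) \<epsilon> \<partial>density (PiM {..<n} (\<lambda>_. lborel)) \<rho>)"
      unfolding law by (rule nn_integral_distr) measurable
    also have "\<dots> = (\<integral>\<^sup>+c. \<rho> c * \<Phi> (T c) \<epsilon> \<partial>PiM {..<n} (\<lambda>_. lborel))"
      by (rule nn_integral_density) measurable
    finally show "(\<integral>\<^sup>+f. \<Phi> f \<epsilon> \<partial>?LX) = (\<integral>\<^sup>+c. \<rho> c * \<Phi> (T c) \<epsilon> \<partial>PiM {..<n} (\<lambda>_. lborel))" .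
  qed
  also have "\<dots> = (\<integral>\<^sup>+z. \<integral>\<^sup>+c. \<rho> c * \<Phi> (T c) (exp_sum p z) \<partial>PiM {..<n} (\<lambda>_. lborel) \<partial>PiM (fst p) (\<lambda>_. std_gauss))"
  proof -
    interpret L: product_sigma_finite "\<lambda>_. lborel :: real measure" ..
    interpret Ln: finite_product_sigma_finite "\<lambda>_. lborel :: real measure" "{..<n}" by standard simp
    show ?thesis
      unfolding distr_gaussian_exp_sum[OF M E p] by (rule nn_integral_distr) measurable
  qed
  also have "\<dots> = mean_zeros \<rho> U p"
  proof -
    have "\<Phi> (T c) (exp_sum p z) = emeasure (count_space UNIV) (zeros_in U p z c)" for c z
    proof -
      have "continuous_on U (\<lambda>x. T c x i)" if "i < ?k" for i
        unfolding T_apply using that by (intro continuous_intros continuous_entry) auto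
      then show ?thesis
        by (subst \<Phi>_eq) (simp_all add: exp_cont common_zeros_def zeros_in_def T_apply)
    qed
    then show ?thesis by (simp add: mean_zeros_def)
  qed
  finally show ?thesis .
qed

theorem proposition4p27:
  fixes A :: "(real ^ 'm) set"
    and \<alpha> :: "real ^ 'm \<Rightarrow> real"
    and d :: nat
    and U :: "(real ^ 'm) set"
    and M :: "'w measure"
    and E E\<^sub>d :: "'w \<Rightarrow> real ^ 'm \<Rightarrow> real"
    and X :: "'w \<Rightarrow> (real ^ 'm) field"
  assumes "finite A"
    and "aff_dim (convex hull A) = int CARD('m)"
    and "\<forall>a\<in>A. 0 < \<alpha> a"
    and "0 < d"
    and "open U"
    and "prob_space M"
    and "gaussian_exp_sum M (A, \<alpha>) E"
    and "gaussian_exp_sum M (aronszajn_power (A, \<alpha>) d) E\<^sub>d"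
    and "admissible M (CARD('m) - 1) X"
    and "independent_elems M field_sigma X fun_sigma E"
    and "independent_elems M field_sigma X fun_sigma E\<^sub>d"
  shows "expected_zeros M (CARD('m) - 1) E\<^sub>d X U
    = ennreal (sqrt (real d)) * expected_zeros M (CARD('m) - 1) E X U"
proof -
  let ?k = "CARD('m) - 1" and ?p = "(A, \<alpha>)"
  \<comment> \<open>The empty set has affine dimension -1.\<close>
  have "A \<noteq> {}" using assms(2) by auto
  then have p: "positive_data ?p" using assms(1,3) by (simp add: positive_data_def)
  note q = aronszajn_power_variance[OF p \<open>0 < d\<close>]
  obtain F ip \<rho> where X: "random_field M ?k X" and F: "subspace F" "F \<subseteq> C_infinity ?k"
    and ip: "scalar_product_on F ip" and ev: "\<forall>x. (\<lambda>f. f x) ` F = Rk ?k"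
    and cont: "\<forall>f\<in>F. \<forall>\<epsilon>>0. \<exists>\<delta>>0. \<forall>g\<in>F. ip_norm ip (g - f) < \<delta> \<longrightarrow> \<bar>\<rho> g - \<rho> f\<bar> < \<epsilon>"
    and dens: "has_density_on M F ip \<rho> X"
    using assms(9) unfolding admissible_def by blast
  obtain e where onb: "orthonormal_basis_of F ip e"
    and law: "distr M field_sigma X = distr (density (PiM {..<dim F} (\<lambda>_. lborel))
      (\<lambda>c. ennreal (\<rho> (\<Sum>i<dim F. c i *\<^sub>R e i)))) field_sigma (\<lambda>c. \<Sum>i<dim F. c i *\<^sub>R e i)"
    using dens unfolding has_density_on_def Let_def by blast
  have F_span: "F = span (e ` {..<dim F})"
    using onb by (simp add: orthonormal_basis_of_def)
  \<comment> \<open>Any index can be set aside for the exponential sum.\<close>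
  obtain k :: 'm where True by simp
  have "card (- {k}) = card {..<?k}" by (simp add: Compl_eq_Diff_UNIV)
  then obtain \<beta> where \<beta>: "bij_betw \<beta> (- {k}) {..<?k}"
    using finite_same_card_bij[of "- {k}" "{..<?k}"] by auto
  interpret evaluation_basis e "dim F" k \<beta>
  proof
    show "bij_betw \<beta> (- {k}) {..<?k}" by (rule \<beta>)
    show "e j \<in> C_infinity ?k" if "j < dim F" for j
    proof -
      have "e j \<in> span (e ` {..<dim F})" using that by (intro span_base imageI) simp
      then have "e j \<in> F" by (simp only: F_span[symmetric])
      then show ?thesis using F(2) by blast
    qed
    show "\<exists>f\<in>span (e ` {..<dim F}). f x = y" if "y \<in> Rk ?k" for x y
    proof -
      have "y \<in> (\<lambda>f. f x) ` F" using ev that by (simp only:)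
      then show ?thesis unfolding F_span[symmetric] by blast
    qed
  qed
  define \<rho>' where "\<rho>' c = ennreal (\<rho> (\<Sum>i<dim F. c i *\<^sub>R e i))" for c
  have \<rho>': "\<rho>' \<in> borel_measurable (PiM {..<dim F} (\<lambda>_. lborel))"
    unfolding \<rho>'_def using measurable_density_coordinates[OF F(1) ip onb cont] by measurable
  \<comment> \<open>Each sum is independent of the field, so both expectations become
    \<open>mean_zeros\<close> with the same coordinates and the same \<open>\<rho>'\<close>; only
    the exponential data differ.\<close>
  note mean = expected_zeros_eq_mean_zeros[OF assms(6,5) _ _ X \<rho>' law[folded \<rho>'_def]]
  have "expected_zeros M ?k E\<^sub>d X U = mean_zeros \<rho>' U (aronszajn_power ?p d)"
    using q by (intro mean assms) auto
  also have "\<dots> = ennreal (sqrt (real d)) * mean_zeros \<rho>' U ?p"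
    using q assms(4) by (intro mean_zeros_scaling \<rho>' assms(5) p) auto
  also have "mean_zeros \<rho>' U ?p = expected_zeros M ?k E X U"
    by (intro mean[symmetric] assms p)
  finally show ?thesis .
qed

end
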